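(* Let $M$ be a matroid of rank at least $2$ on $[n]=\{1,\dots,n\}$. Then there exists $q_M>0$ such that $$\mathrm R_M^{\mathrm w}(\mathbb T_q)\subseteq\mathrm L_M\subseteq\mathrm R_M^{\mathrm w}(\mathbb T_2)$$ for all $0<q\le q_M$. Equivalently, after projectivizing, $$\mathrm{Gr}_M^{\mathrm w}(\mathbb T_q)\subseteq\mathbb P\mathrm L_M\subseteq\mathrm{Gr}_M^{\mathrm w}(\mathbb T_2)$$ for all sufficiently small $q>0$.
   Context: **Notation.** $e_1,\dots,e_n$ are the standard basis vectors of $\mathbb N^n$ ($0\in\mathbb N$); $\Delta_n^d=\{\alpha\in\mathbb N^n:\sum\alpha_i=d\}$; inequalities between vectors are coordinatewise. A matroid $M$ of rank $d$ on $[n]$ is identified with the set $J=J(M)=\{\sum_{i\in B}e_i: B\text{ a basis of }M\}\subseteq\Delta_n^d$. Let $\delta_J^-$ and $\delta_J^+$ be the coordinatewise minimum and maximum of $J$. The support of a polynomial or of a function on $\Delta_n^d$ is the set of $\alpha$ at which the coefficient (value) is nonzero. **Lorentzian polynomials.** For $d\ge2$, a homogeneous polynomial $f$ of degree $d$ in $x_1,\dots,x_n$ with nonnegative real coefficients is strictly Lorentzian if for every $\alpha\in\Delta_n^{d-2}$ the Hessian of the quadratic form $\partial^\alpha f$ has exactly one positive and $n-1$ negative eigenvalues. A Lorentzian polynomial is a limit of strictly Lorentzian polynomials. $\mathrm L_M$ is the set of Lorentzian polynomials with support $J(M)$, and $\mathbb P\mathrm L_M$ its quotient by multiplication by positive reals.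 **Weak representations.** For $q>0$, nonnegative reals $a,b,c$ satisfy the $\mathbb T_q$-relation if $a^{1/q},b^{1/q},c^{1/q}$ are the side lengths of a (possibly degenerate) Euclidean triangle (each at most the sum of the other two). A weak $\mathbb T_q$-representation of $M$ is a function $\rho:\Delta_n^d\to\mathbb R_{\ge0}$ with support $J=J(M)$ such that for every $\alpha\in\Delta_n^{d-2}$ and $1\le i\le j\le k\le\ell\le n$ with $\delta_J^-\le\alpha$ and $\alpha+e_i+e_j+e_k+e_\ell\le\delta_J^+$, the three numbers $\rho(\alpha+e_j+e_k)\rho(\alpha+e_i+e_\ell)$, $\rho(\alpha+e_i+e_k)\rho(\alpha+e_j+e_\ell)$, $\rho(\alpha+e_i+e_j)\rho(\alpha+e_k+e_\ell)$ satisfy the $\mathbb T_q$-relation. $\mathrm R_M^{\mathrm w}(\mathbb T_q)$ is the set of these, each $\rho$ being identified with the multi-affine polynomial $\sum_{\alpha\in J}\rho(\alpha)x^\alpha$; $\mathrm{Gr}_M^{\mathrm w}(\mathbb T_q)$ is its quotient by multiplication by positive reals. *)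

theory Defs
  imports
    Complex_Main
    "HOL-Library.Poly_Mapping"
    "Jordan_Normal_Form.Char_Poly"
begin

section \<open>Exponents and polynomials\<close>

text \<open>
  Exponent vectors in \<open>\<nat>\<^sup>n\<close> are finitely supported functions with keys in \<open>{1..n}\<close>.
  Real polynomials are finitely supported functions from exponent vectors to coefficients;
  addition and multiplication of this type are those of the polynomial ring.  The library order on
  \<open>\<Rightarrow>\<^sub>0\<close> is lexicographic, so coordinatewise inequalities are spelled out below.
\<close>

type_synonym expo = "nat \<Rightarrow>\<^sub>0 nat"

type_synonym rpoly = "expo \<Rightarrow>\<^sub>0 real"

abbreviation unit_expo :: "nat \<Rightarrow> expo" where
  "unit_expo i \<equiv> Poly_Mapping.single i 1"

definition simplex :: "nat \<Rightarrow> nat \<Rightarrow> expo set" where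
  "simplex n d = {\<alpha>. Poly_Mapping.keys \<alpha> \<subseteq> {1..n} \<and> (\<Sum>i\<in>{1..n}. Poly_Mapping.lookup \<alpha> i) = d}"

text \<open>The zero polynomial counts as homogeneous of every degree.\<close>

definition homogeneous :: "nat \<Rightarrow> nat \<Rightarrow> rpoly \<Rightarrow> bool" where
  "homogeneous n d f \<longleftrightarrow> Poly_Mapping.keys f \<subseteq> simplex n d"

text \<open>
  Termwise derivative in the variable \<open>x\<^sub>i\<close>.  Subtraction of exponents is truncated, but wherever
  truncation occurs the factor \<open>lookup \<alpha> i\<close> is \<open>0\<close>.
\<close>

definition partial_deriv :: "nat \<Rightarrow> rpoly \<Rightarrow> rpoly" where
  "partial_deriv i f =
     (\<Sum>\<alpha>\<in>Poly_Mapping.keys f.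
        Poly_Mapping.single (\<alpha> - unit_expo i) (real (Poly_Mapping.lookup \<alpha> i) * Poly_Mapping.lookup f \<alpha>))"

definition iter_deriv :: "nat \<Rightarrow> expo \<Rightarrow> rpoly \<Rightarrow> rpoly" where
  "iter_deriv n \<alpha> f = fold (\<lambda>i. partial_deriv i ^^ Poly_Mapping.lookup \<alpha> i) [1..<Suc n] f"

text \<open>
  The Hessian of a quadratic form has constant entries, so it is the real matrix of the constant
  coefficients of the second derivatives.  Matrix indices start at \<open>0\<close>, variables at \<open>1\<close>.
\<close>

definition hessian :: "nat \<Rightarrow> rpoly \<Rightarrow> real mat" where
  "hessian n g =
     mat n n (\<lambda>(i, j). Poly_Mapping.lookup (partial_deriv (Suc i) (partial_deriv (Suc j) g)) 0)"


section \<open>Lorentzian polynomials\<close>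

text \<open>Eigenvalues in \<open>S\<close>, counted with their multiplicity as roots of the characteristic polynomial.\<close>

definition num_eigenvalues :: "real mat \<Rightarrow> real set \<Rightarrow> nat" where
  "num_eigenvalues A S = (\<Sum>e | eigenvalue A e \<and> e \<in> S. Polynomial.order e (char_poly A))"

definition strictly_lorentzian :: "nat \<Rightarrow> nat \<Rightarrow> rpoly \<Rightarrow> bool" where
  "strictly_lorentzian n d f \<longleftrightarrow>
     2 \<le> d \<and> homogeneous n d f \<and> (\<forall>\<alpha>. 0 \<le> Poly_Mapping.lookup f \<alpha>) \<and>
     (\<forall>\<alpha>\<in>simplex n (d - 2).
        num_eigenvalues (hessian n (iter_deriv n \<alpha> f)) {0<..} = 1 \<and>
        num_eigenvalues (hessian n (iter_deriv n \<alpha> f)) {..<0} = n - 1)"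

text \<open>
  Limits are taken in the finite-dimensional space of homogeneous polynomials of degree \<open>d\<close>, that is,
  coefficientwise.
\<close>

definition lorentzian :: "nat \<Rightarrow> nat \<Rightarrow> rpoly \<Rightarrow> bool" where
  "lorentzian n d f \<longleftrightarrow>
     homogeneous n d f \<and>
     (\<exists>F :: nat \<Rightarrow> rpoly.
        (\<forall>k. strictly_lorentzian n d (F k)) \<and>
        (\<forall>\<alpha>\<in>simplex n d. (\<lambda>k. Poly_Mapping.lookup (F k) \<alpha>) \<longlonglongrightarrow> Poly_Mapping.lookup f \<alpha>))"


section \<open>Matroids\<close>

definition matroid_bases :: "'a set \<Rightarrow> 'a set set \<Rightarrow> bool" where
  "matroid_bases E \<B> \<longleftrightarrow>
     finite E \<and> \<B> \<noteq> {} \<and> (\<forall>B\<in>\<B>. B \<subseteq> E) \<and>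
     (\<forall>A\<in>\<B>. \<forall>B\<in>\<B>. \<forall>x\<in>A - B. \<exists>y\<in>B - A. insert y (A - {x}) \<in> \<B>)"

definition has_rank :: "'a set set \<Rightarrow> nat \<Rightarrow> bool" where
  "has_rank \<B> d \<longleftrightarrow> (\<forall>B\<in>\<B>. card B = d)"

definition basis_expos :: "nat set set \<Rightarrow> expo set" where
  "basis_expos \<B> = (\<lambda>B. \<Sum>i\<in>B. unit_expo i) ` \<B>"

definition delta_min :: "expo set \<Rightarrow> nat \<Rightarrow> nat" where
  "delta_min J i = Min ((\<lambda>\<alpha>. Poly_Mapping.lookup \<alpha> i) ` J)"

definition delta_max :: "expo set \<Rightarrow> nat \<Rightarrow> nat" where
  "delta_max J i = Max ((\<lambda>\<alpha>. Poly_Mapping.lookup \<alpha> i) ` J)"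


section \<open>Weak representations over the triangular hyperfields\<close>

text \<open>Meant for nonnegative \<open>a\<close>, \<open>b\<close>, \<open>c\<close>; note that \<open>0 powr (1 / q) = 0\<close>.\<close>

definition T_relation :: "real \<Rightarrow> real \<Rightarrow> real \<Rightarrow> real \<Rightarrow> bool" where
  "T_relation q a b c \<longleftrightarrow>
     a powr (1 / q) \<le> b powr (1 / q) + c powr (1 / q) \<and>
     b powr (1 / q) \<le> a powr (1 / q) + c powr (1 / q) \<and>
     c powr (1 / q) \<le> a powr (1 / q) + b powr (1 / q)"

text \<open>
  A function on \<open>simplex n d\<close> is represented by its extension by zero to all exponent vectors, so the
  support condition also fixes its values outside \<open>simplex n d\<close>.
\<close>

definition weak_rep :: "nat \<Rightarrow> nat \<Rightarrow> expo set \<Rightarrow> real \<Rightarrow> (expo \<Rightarrow> real) \<Rightarrow> bool" where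
  "weak_rep n d J q \<rho> \<longleftrightarrow>
     (\<forall>\<alpha>. 0 \<le> \<rho> \<alpha>) \<and> {\<alpha>. \<rho> \<alpha> \<noteq> 0} = J \<and>
     (\<forall>\<alpha>\<in>simplex n (d - 2). \<forall>i j k l.
        1 \<le> i \<and> i \<le> j \<and> j \<le> k \<and> k \<le> l \<and> l \<le> n \<and>
        (\<forall>m\<in>{1..n}. delta_min J m \<le> Poly_Mapping.lookup \<alpha> m) \<and>
        (\<forall>m\<in>{1..n}. Poly_Mapping.lookup (\<alpha> + unit_expo i + unit_expo j + unit_expo k + unit_expo l) m
                       \<le> delta_max J m) \<longrightarrow>
        T_relation q
          (\<rho> (\<alpha> + unit_expo j + unit_expo k) * \<rho> (\<alpha> + unit_expo i + unit_expo l))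
          (\<rho> (\<alpha> + unit_expo i + unit_expo k) * \<rho> (\<alpha> + unit_expo j + unit_expo l))
          (\<rho> (\<alpha> + unit_expo i + unit_expo j) * \<rho> (\<alpha> + unit_expo k + unit_expo l)))"

definition rep_poly :: "expo set \<Rightarrow> (expo \<Rightarrow> real) \<Rightarrow> rpoly" where
  "rep_poly J \<rho> = (\<Sum>\<alpha>\<in>J. Poly_Mapping.single \<alpha> (\<rho> \<alpha>))"


section \<open>The spaces attached to a matroid\<close>

definition lorentzian_space :: "nat \<Rightarrow> nat \<Rightarrow> nat set set \<Rightarrow> rpoly set" where
  "lorentzian_space n d \<B> = {f. lorentzian n d f \<and> Poly_Mapping.keys f = basis_expos \<B>}"

definition weak_rep_space :: "nat \<Rightarrow> nat \<Rightarrow> nat set set \<Rightarrow> real \<Rightarrow> rpoly set" where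
  "weak_rep_space n d \<B> q =
     rep_poly (basis_expos \<B>) ` {\<rho>. weak_rep n d (basis_expos \<B>) q \<rho>}"

definition pos_scaling :: "(rpoly \<times> rpoly) set" where
  "pos_scaling = {(f, g). \<exists>c>0. g = Poly_Mapping.single 0 c * f}"

text \<open>
  The relation lives on all polynomials; since the two spaces are closed under positive scaling, the
  classes below consist of elements of the respective space.
\<close>

definition proj_lorentzian_space :: "nat \<Rightarrow> nat \<Rightarrow> nat set set \<Rightarrow> rpoly set set" where
  "proj_lorentzian_space n d \<B> = lorentzian_space n d \<B> // pos_scaling"

definition weak_grassmannian :: "nat \<Rightarrow> nat \<Rightarrow> nat set set \<Rightarrow> real \<Rightarrow> rpoly set set" where
  "weak_grassmannian n d \<B> q = weak_rep_space n d \<B> q // pos_scaling"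

end

theory Submission
  imports Defs
begin

text \<open>
  Polynomials enter through their quadratic derivatives.  The property that carries the argument is
  \<open>lorentz_form\<close>: the reversed Cauchy-Schwarz inequality against nonnegative vectors, which for a
  nonnegative symmetric form means at most one positive eigenvalue.

  Lorentzian polynomials are weak representations for \<open>q = 2\<close>.  A strictly Lorentzian polynomial has
  quadratic derivatives with this property, which survives limits (\<open>lorentzian_form\<close>).
  For a multi-affine polynomial these forms have zero diagonal, and the inequality for vectors
  supported on \<open>{i, j}\<close> and \<open>{k, l}\<close> is, for the best weights, the triangle inequality between
  the square roots of the products of complementary coefficients (\<open>lorentz_form_four_point\<close>).

  Weak representations for small \<open>q\<close> are Lorentzian.  Normalise the entries of a quadratic derivative
  by one of its nonzero rows.  The relations say that their \<open>1/q\<close>-th powers are a pseudometric on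
  at most \<open>n\<close> points.  So the normalised entries are nearly an ultrametric, and near-ultrametrics on
  \<open>n\<close> points are of negative type once the error is below a bound that depends on \<open>n\<close> only
  (\<open>near_ultrametric_negative_type\<close>, \<open>triangular_form_lorentzian\<close>).
  It remains to see that a polynomial whose quadratic derivatives have the property, and whose support is
  M-convex, is a limit of strictly Lorentzian polynomials (\<open>lorentzian_criterion\<close>).  By induction on the
  degree (\<open>contraction_lorentzian\<close>, \<open>dir_derivs_lorentzian\<close>), derivatives along positive vectors also
  have the property.  So the polynomial stays in the class under a small positive linear substitution, which
  makes all its coefficients positive.  Subtracting a small multiple of a polynomial
  whose quadratic derivatives are positive definite then gives a strictly Lorentzian polynomial.
\<close>

section \<open>Diagonalisation of real symmetric matrices\<close>

text \<open>The diagonal matrix with entries \<open>l 0, \<dots>, l (n - 1)\<close>.\<close>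

definition sdiag :: "nat \<Rightarrow> (nat \<Rightarrow> real) \<Rightarrow> real mat" where
  "sdiag n l = mat n n (\<lambda>(i, j). if i = j then l i else 0)"

lemma real_symmetric_has_eigenvalue:
  fixes A :: "real mat"
  assumes A: "A \<in> carrier_mat n n" and sym: "transpose_mat A = A" and n: "0 < n"
  shows "\<exists>e. eigenvalue A e"
proof -
  let ?B = "map_mat complex_of_real A"
  have B: "?B \<in> carrier_mat n n" using A by simp
  have "degree (char_poly ?B) = n" using degree_monic_char_poly[OF B] by simp
  then have "\<not> constant (poly (char_poly ?B))"
    using n by (simp add: constant_degree)
  then obtain z where z: "poly (char_poly ?B) z = 0"
    using fundamental_theorem_of_algebra by blast
  then have "eigenvalue ?B z" using eigenvalue_root_char_poly[OF B] by simp
  then obtain v where v: "v \<in> carrier_vec n" "v \<noteq> 0\<^sub>v n" "?B *\<^sub>v v = z \<cdot>\<^sub>v v"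
    unfolding eigenvalue_def eigenvector_def using B by auto
  have Aij: "A $$ (i,j) = A $$ (j,i)" if "i < n" "j < n" for i j
    using that A sym by (metis carrier_matD index_transpose_mat(1))
  have row: "(\<Sum>j<n. complex_of_real (A $$ (i,j)) * v $ j) = z * v $ i" if i: "i < n" for i
  proof -
    have "(?B *\<^sub>v v) $ i = (z \<cdot>\<^sub>v v) $ i" using v by simp
    then show ?thesis using i A v(1)
      by (simp add: scalar_prod_def atLeast0LessThan)
  qed
  define N where "N = (\<Sum>i<n. cnj (v $ i) * v $ i)"
  \<comment> \<open>The Hermitian form of \<open>A\<close> takes the real value \<open>z * N\<close> at \<open>v\<close>, and \<open>N\<close> is a positive real number.\<close>
  have N1: "z * N = (\<Sum>i<n. \<Sum>j<n. of_real (A $$ (i,j)) * (cnj (v $ i) * v $ j))"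
  proof -
    have "z * N = (\<Sum>i<n. cnj (v $ i) * (z * v $ i))"
      unfolding N_def by (simp add: sum_distrib_left mult.commute mult.left_commute)
    also have "\<dots> = (\<Sum>i<n. cnj (v $ i) * (\<Sum>j<n. of_real (A $$ (i,j)) * v $ j))"
      by (intro sum.cong refl) (simp add: row)
    finally show ?thesis by (simp add: sum_distrib_left mult.commute mult.left_commute)
  qed
  have "cnj (z * N) = (\<Sum>i<n. \<Sum>j<n. of_real (A $$ (i,j)) * (v $ i * cnj (v $ j)))"
    unfolding N1 by simp
  also have "\<dots> = (\<Sum>j<n. \<Sum>i<n. of_real (A $$ (i,j)) * (v $ i * cnj (v $ j)))"
    by (rule sum.swap)
  also have "\<dots> = z * N" unfolding N1
    by (intro sum.cong refl) (simp add: Aij mult.commute mult.left_commute)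
  finally have zN: "cnj (z * N) = z * N" .
  have Nn: "N = of_real (\<Sum>i<n. (cmod (v $ i))\<^sup>2)"
    unfolding N_def of_real_sum by (intro sum.cong refl) (metis complex_norm_square mult.commute)
  have "N \<noteq> 0"
  proof
    assume "N = 0"
    then have "(\<Sum>i<n. (cmod (v $ i))\<^sup>2) = 0" using Nn by (simp del: of_real_sum)
    then have "\<forall>i<n. v $ i = 0" by (subst (asm) sum_nonneg_eq_0_iff) auto
    then have "v = 0\<^sub>v n" using v(1) by (intro eq_vecI) auto
    with v(2) show False by simp
  qed
  moreover have "cnj N = N" unfolding Nn by simp
  ultimately have "cnj z = z" using zN by simp
  then obtain r where r: "z = of_real r" by (metis Reals_cnj_iff Reals_cases)
  have "char_poly ?B = map_poly of_real (char_poly A)"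
    using of_real_hom.char_poly_hom[OF A] by simp
  then have "poly (map_poly complex_of_real (char_poly A)) (of_real r) = 0"
    using z r by simp
  then have "poly (char_poly A) r = 0"
    by (simp add: of_real_hom.poly_map_poly)
  then show ?thesis using eigenvalue_root_char_poly[OF A] by blast
qed

text \<open>The Householder reflection that exchanges \<open>v\<close> and the first standard basis vector.\<close>

lemma orthogonal_matrix_with_first_column:
  fixes v :: "real vec"
  assumes v: "v \<in> carrier_vec n" and unit: "v \<bullet> v = 1" and n: "0 < n"
  shows "\<exists>W. W \<in> carrier_mat n n \<and> transpose_mat W * W = 1\<^sub>m n \<and> col W 0 = v"
proof -
  define w where "w i = v $ i - (if i = 0 then 1 else 0)" for i
  have s1: "(\<Sum>i<n. v $ i * v $ i) = 1"
    using unit v by (simp add: scalar_prod_def atLeast0LessThan)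
  define s where "s = (\<Sum>i<n. w i * w i)"
  have "s = (\<Sum>i<n. v $ i * v $ i - 2 * (if i = 0 then v $ i else 0) + (if i = 0 then 1 else 0))"
    unfolding s_def by (intro sum.cong refl) (auto simp: w_def algebra_simps)
  also have "\<dots> = 1 - 2 * v $ 0 + 1"
    using n by (simp add: sum.distrib sum_subtractf s1 flip: sum_distrib_left)
  finally have s2: "s = - 2 * w 0" by (simp add: w_def)
  have s0: "\<forall>i<n. w i = 0" if "s = 0"
    using that unfolding s_def by (subst (asm) sum_nonneg_eq_0_iff) auto
  define c where "c = 2 / s"
  have cs: "c * s * c = 2 * c" by (simp add: c_def)
  define W where "W = mat n n (\<lambda>(i,j). (if i = j then 1 else 0) - c * w i * w j)"
  have W: "W \<in> carrier_mat n n" by (simp add: W_def)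
  have "transpose_mat W * W = 1\<^sub>m n"
  proof (rule eq_matI)
    fix i j assume "i < dim_row (1\<^sub>m n)" "j < dim_col (1\<^sub>m n)"
    then have i: "i < n" and j: "j < n" by auto
    have "(transpose_mat W * W) $$ (i,j) =
        (\<Sum>k<n. ((if k = i then 1 else 0) - c * w k * w i) * ((if k = j then 1 else 0) - c * w k * w j))"
      using i j by (simp add: W_def scalar_prod_def atLeast0LessThan)
    also have "\<dots> = (\<Sum>k<n. (if k = i then (if i = j then 1 else 0) else 0)
        - (if k = i then c * w i * w j else 0) - (if k = j then c * w i * w j else 0)
        + c * c * w i * w j * (w k * w k))"
      by (intro sum.cong refl) (auto simp: algebra_simps)
    also have "\<dots> = (if i = j then 1 else 0) - 2 * (c * w i * w j) + c * c * w i * w j * s"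
      using i j by (simp add: sum.distrib sum_subtractf s_def flip: sum_distrib_left)
    also have "c * c * w i * w j * s = 2 * (c * w i * w j)"
    proof -
      have "c * c * w i * w j * s = (c * s * c) * w i * w j" by (simp add: mult_ac)
      then show ?thesis by (simp add: cs)
    qed
    finally show "(transpose_mat W * W) $$ (i,j) = 1\<^sub>m n $$ (i,j)" using i j by simp
  qed (auto simp: W_def)
  moreover have "col W 0 = v"
  proof (rule eq_vecI)
    fix i assume "i < dim_vec v"
    then have i: "i < n" using v by simp
    have "w i = - c * w i * w 0"
    proof (cases "s = 0")
      case True then show ?thesis using s0 i by simp
    next
      case False
      then have "c * w 0 = -1" using s2 by (simp add: c_def field_simps)
      have "- c * w i * w 0 = - (c * w 0) * w i" by (simp add: mult_ac)
      then show ?thesis using \<open>c * w 0 = -1\<close> by simp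
    qed
    then have "(if i = 0 then 1 else 0) - c * w i * w 0 = v $ i"
      using w_def[of i] by linarith
    then show "col W 0 $ i = v $ i" using i n v by (simp add: W_def)
  qed (use v in \<open>auto simp: W_def\<close>)
  ultimately show ?thesis using W by blast
qed

lemma sdiag_carrier [simp]: "sdiag n l \<in> carrier_mat n n"
  by (simp add: sdiag_def)

theorem real_spectral_theorem:
  fixes A :: "real mat"
  assumes A: "A \<in> carrier_mat n n" and sym: "transpose_mat A = A"
  shows "\<exists>U l. U \<in> carrier_mat n n \<and> transpose_mat U * U = 1\<^sub>m n \<and>
           A = U * sdiag n l * transpose_mat U"
  using assms
proof (induction n arbitrary: A)
  case 0
  show ?case
    by (intro exI[of _ "1\<^sub>m 0"] exI[of _ "\<lambda>_. 0"] conjI eq_matI) (use 0 in auto)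
next
  case (Suc n)
  note A = Suc.prems(1) and sym = Suc.prems(2)
  obtain e where "eigenvalue A e" using real_symmetric_has_eigenvalue[OF A sym] by auto
  then obtain x where x: "x \<in> carrier_vec (Suc n)" "x \<noteq> 0\<^sub>v (Suc n)" "A *\<^sub>v x = e \<cdot>\<^sub>v x"
    unfolding eigenvalue_def eigenvector_def using A by auto
  have xx: "0 < x \<bullet> x"
  proof -
    have "x \<bullet> x = (\<Sum>i<Suc n. x $ i * x $ i)"
      using x(1) by (simp add: scalar_prod_def atLeast0LessThan del: sum.lessThan_Suc)
    moreover have "\<exists>i<Suc n. x $ i \<noteq> 0"
    proof (rule ccontr)
      assume "\<not> ?thesis"
      then have "x = 0\<^sub>v (Suc n)" using x(1) by (intro eq_vecI) auto
      with x(2) show False by simp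
    qed
    ultimately show ?thesis
      by (metis (no_types, lifting) finite_lessThan lessThan_iff not_real_square_gt_zero
          sum_pos2 zero_le_square)
  qed
  define v where "v = (1 / sqrt (x \<bullet> x)) \<cdot>\<^sub>v x"
  have v: "v \<in> carrier_vec (Suc n)" using x(1) by (simp add: v_def)
  have "v \<bullet> v = (1 / sqrt (x \<bullet> x)) * ((1 / sqrt (x \<bullet> x)) * (x \<bullet> x))"
    unfolding v_def using x(1) by simp
  also have "\<dots> = 1" using xx by (simp add: field_simps)
  finally have vv: "v \<bullet> v = 1" .
  have Av: "A *\<^sub>v v = e \<cdot>\<^sub>v v"
    unfolding v_def using x A by (simp add: mult_mat_vec smult_smult_assoc mult.commute)
  \<comment> \<open>Deflation: an orthogonal \<open>W\<close> with first column \<open>v\<close> splits off the eigenvalue \<open>e\<close>.\<close>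
  obtain W where W: "W \<in> carrier_mat (Suc n) (Suc n)" and WW: "transpose_mat W * W = 1\<^sub>m (Suc n)"
    and W0: "col W 0 = v" using orthogonal_matrix_with_first_column[OF v vv] by blast
  let ?T = "transpose_mat W"
  have T: "?T \<in> carrier_mat (Suc n) (Suc n)" using W by simp
  have WW': "W * ?T = 1\<^sub>m (Suc n)"
    using mat_mult_left_right_inverse[OF T W WW] .
  define B where "B = ?T * A * W"
  have B: "B \<in> carrier_mat (Suc n) (Suc n)" using W A by (simp add: B_def)
  have Bs: "transpose_mat B = B"
  proof -
    have "transpose_mat B = ?T * (transpose_mat A * transpose_mat ?T)"
      unfolding B_def using W A T
      by (metis mult_carrier_mat transpose_mult)
    then show ?thesis unfolding B_def sym using W A T by (simp add: assoc_mult_mat)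
  qed
  have Bsij: "B $$ (i,j) = B $$ (j,i)" if "i < Suc n" "j < Suc n" for i j
    using that B Bs by (metis carrier_matD index_transpose_mat(1))
  have c0: "B $$ (i,0) = (if i = 0 then e else 0)" if i: "i < Suc n" for i
  proof -
    have "col B 0 = ?T *\<^sub>v (A *\<^sub>v v)"
    proof -
      have "col B 0 = (?T * A) *\<^sub>v col W 0"
        unfolding B_def using W A T by (intro col_mult2[of _ "Suc n" "Suc n" _ "Suc n"]) auto
      then show ?thesis unfolding W0 using assoc_mult_mat_vec[OF T A v] by simp
    qed
    also have "\<dots> = e \<cdot>\<^sub>v (?T *\<^sub>v v)" unfolding Av using T v by (simp add: mult_mat_vec)
    also have "?T *\<^sub>v v = col (1\<^sub>m (Suc n)) 0"
      using col_mult2[OF T W, of 0] unfolding W0 WW by simp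
    finally have "col B 0 $ i = (e \<cdot>\<^sub>v col (1\<^sub>m (Suc n)) 0) $ i" by simp
    then show ?thesis using i B by simp
  qed
  define A3 where "A3 = mat n n (\<lambda>(i,j). B $$ (Suc i, Suc j))"
  have A3: "A3 \<in> carrier_mat n n" by (simp add: A3_def)
  have "transpose_mat A3 = A3"
    by (rule eq_matI) (auto simp: A3_def Bsij)
  from Suc.IH[OF A3 this] obtain U l where U: "U \<in> carrier_mat n n"
    and UU: "transpose_mat U * U = 1\<^sub>m n" and A3U: "A3 = U * sdiag n l * transpose_mat U" by blast
  define V where "V = four_block_mat (1\<^sub>m 1) (0\<^sub>m 1 n) (0\<^sub>m n 1) U"
  define l' where "l' k = (case k of 0 \<Rightarrow> e | Suc k \<Rightarrow> l k)" for k
  have V: "V \<in> carrier_mat (Suc n) (Suc n)" using four_block_carrier_mat[of "1\<^sub>m 1" 1 1 U n n] U by (simp add: V_def)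
  have Vt: "transpose_mat V = four_block_mat (1\<^sub>m 1) (0\<^sub>m 1 n) (0\<^sub>m n 1) (transpose_mat U)"
    unfolding V_def by (subst transpose_four_block_mat[OF _ _ _ U]) auto
  have VV: "transpose_mat V * V = 1\<^sub>m (Suc n)"
    unfolding Vt unfolding V_def
    by (subst mult_four_block_mat[of _ 1 1 _ n _ n _ _ 1 _ n]) (use U UU in \<open>auto intro!: eq_matI\<close>)
  have D': "sdiag (Suc n) l' = four_block_mat (mat 1 1 (\<lambda>_. e)) (0\<^sub>m 1 n) (0\<^sub>m n 1) (sdiag n l)"
    by (rule eq_matI) (auto simp: sdiag_def l'_def split: nat.splits)
  have Dc: "sdiag n l \<in> carrier_mat n n" by simp
  have VD: "V * sdiag (Suc n) l' = four_block_mat (mat 1 1 (\<lambda>_. e)) (0\<^sub>m 1 n) (0\<^sub>m n 1) (U * sdiag n l)"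
    unfolding D' V_def
    by (subst mult_four_block_mat[of _ 1 1 _ n _ n _ _ 1 _ n]) (use U Dc left_mult_zero_mat[OF Dc, of 1] in \<open>auto\<close>)
  have UDc: "U * sdiag n l \<in> carrier_mat n n" using U Dc by (rule mult_carrier_mat)
  have UDUc: "U * sdiag n l * transpose_mat U \<in> carrier_mat n n"
    using UDc U by (intro mult_carrier_mat[of _ n n]) auto
  have "V * sdiag (Suc n) l' * transpose_mat V
      = four_block_mat (mat 1 1 (\<lambda>_. e)) (0\<^sub>m 1 n) (0\<^sub>m n 1) (U * sdiag n l * transpose_mat U)"
    unfolding VD Vt
    by (subst mult_four_block_mat[of _ 1 1 _ n _ n _ _ 1 _ n])
      (use U Dc right_mult_zero_mat[OF UDc, of 1] left_add_zero_mat[OF UDUc] in \<open>auto\<close>)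
  also have "\<dots> = B"
  proof (rule eq_matI)
    fix i j assume "i < dim_row B" "j < dim_col B"
    then have ij: "i < Suc n" "j < Suc n" using B by auto
    have "B $$ (0,j) = (if j = 0 then e else 0)"
      using Bsij[OF _ ij(2), of 0] c0[OF ij(2)] by (metis zero_less_Suc)
    then show "four_block_mat (mat 1 1 (\<lambda>_. e)) (0\<^sub>m 1 n) (0\<^sub>m n 1) (U * sdiag n l * transpose_mat U) $$ (i,j) = B $$ (i,j)"
      unfolding A3U[symmetric] using ij c0[OF ij(1)] A3
      by (cases i; cases j) (simp_all add: A3_def)
  qed (use B U in simp_all)
  finally have BV: "V * sdiag (Suc n) l' * transpose_mat V = B" .
  let ?D = "sdiag (Suc n) l'"
  have Dc': "?D \<in> carrier_mat (Suc n) (Suc n)" by simp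
  have tV: "transpose_mat V \<in> carrier_mat (Suc n) (Suc n)" using V by simp
  note as = assoc_mult_mat[of _ "Suc n" "Suc n" _ "Suc n" _ "Suc n"]
  note cl = mult_carrier_mat[of _ "Suc n" "Suc n" _ "Suc n"]
  have "transpose_mat (W * V) * (W * V) = transpose_mat V * (?T * W) * V"
    using W V T tV by (simp only: transpose_mult[OF W V] as cl)
  also have "\<dots> = 1\<^sub>m (Suc n)" unfolding WW right_mult_one_mat[OF tV] by (rule VV)
  finally have 1: "transpose_mat (W * V) * (W * V) = 1\<^sub>m (Suc n)" .
  have "(W * V) * ?D * transpose_mat (W * V) = W * (V * ?D * transpose_mat V) * ?T"
    using W V T tV Dc' by (simp only: transpose_mult[OF W V] as cl)
  also have "\<dots> = (W * ?T) * A * (W * ?T)"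
    unfolding BV B_def using W A T by (simp only: as cl)
  also have "\<dots> = A" unfolding WW' left_mult_one_mat[OF A] by (rule right_mult_one_mat[OF A])
  finally have 2: "(W * V) * ?D * transpose_mat (W * V) = A" .
  show ?case
    by (rule exI[of _ "W * V"], rule exI[of _ l'], intro conjI cl[OF W V] 1 2[symmetric])
qed

lemma order_prod_linear_factors:
  fixes l :: "nat \<Rightarrow> real"
  shows "Polynomial.order e (\<Prod>k<n. [:- l k, 1:]) = card {k. k < n \<and> l k = e}"
proof (induction n)
  case 0
  show ?case by (simp add: order_0I)
next
  case (Suc n)
  have nz: "(\<Prod>k<n. [:- l k, 1:]) * [:- l n, 1:] \<noteq> 0"
    by (simp only: mult_eq_0_iff) simp
  have "Polynomial.order e [:- l n, 1:] = (if l n = e then 1 else 0)"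
    using order_power_n_n[of e 1] order_0I[of "[:- l n, 1:]" e] by auto
  moreover have "{k. k < Suc n \<and> l k = e} = (if l n = e then insert n {k. k < n \<and> l k = e} else {k. k < n \<and> l k = e})"
    using less_Suc_eq by auto
  ultimately show ?case using Suc order_mult[OF nz, of e] by auto
qed

lemma num_eigenvalues_diagonalised:
  assumes U: "U \<in> carrier_mat n n" "transpose_mat U * U = 1\<^sub>m n"
    and A: "A = U * sdiag n l * transpose_mat U"
  shows "num_eigenvalues A S = card {k. k < n \<and> l k \<in> S}"
proof -
  have Uc: "transpose_mat U \<in> carrier_mat n n" using U by simp
  have UU': "U * transpose_mat U = 1\<^sub>m n"
    using mat_mult_left_right_inverse[OF Uc U(1) U(2)] .
  have Ac: "A \<in> carrier_mat n n" unfolding A by (rule mult_carrier_mat[OF mult_carrier_mat[OF U(1) sdiag_carrier] Uc])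
  have "similar_mat_wit A (sdiag n l) U (transpose_mat U)"
    by (rule similar_mat_witI[of _ _ n]) (use U UU' A Ac Uc in auto)
  then have "char_poly A = char_poly (sdiag n l)"
    using char_poly_similar similar_mat_def by blast
  also have "\<dots> = (\<Prod>a\<leftarrow>diag_mat (sdiag n l). [:- a, 1:])"
    by (rule char_poly_upper_triangular[of _ n]) (auto simp: sdiag_def)
  also have "diag_mat (sdiag n l) = map l [0..<n]"
    by (auto simp: diag_mat_def sdiag_def)
  also have "(\<Prod>a\<leftarrow>map l [0..<n]. [:- a, 1:]) = (\<Prod>k<n. [:- l k, 1:])"
    using prod.distinct_set_conv_list[of "[0..<n]" "\<lambda>k. [:- l k, 1:]"]
    by (simp add: o_def atLeast0LessThan)
  finally have cp: "char_poly A = (\<Prod>k<n. [:- l k, 1:])" .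
  have ev: "eigenvalue A e \<longleftrightarrow> e \<in> l ` {..<n}" for e
    unfolding eigenvalue_root_char_poly[OF Ac] cp by (auto simp: poly_prod)
  have "num_eigenvalues A S = (\<Sum>e\<in>l ` {..<n} \<inter> S. card {k. k < n \<and> l k = e})"
    unfolding num_eigenvalues_def cp order_prod_linear_factors
    by (rule sum.cong) (auto simp: ev)
  also have "\<dots> = card (\<Union>e\<in>l ` {..<n} \<inter> S. {k. k < n \<and> l k = e})"
    by (rule card_UN_disjoint[symmetric]) auto
  also have "(\<Union>e\<in>l ` {..<n} \<inter> S. {k. k < n \<and> l k = e}) = {k. k < n \<and> l k \<in> S}"
    by auto
  finally show ?thesis .
qed

text \<open>Symmetry of a family of coefficients on an index set; nothing is required outside \<open>I\<close>.\<close>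

definition sym_on :: "'a set \<Rightarrow> ('a \<Rightarrow> 'a \<Rightarrow> real) \<Rightarrow> bool" where
  "sym_on I q \<longleftrightarrow> (\<forall>i\<in>I. \<forall>j\<in>I. q i j = q j i)"

text \<open>
  The vectors \<open>u 0, \<dots>, u (n - 1)\<close> are orthonormal in \<open>\<real>\<^sup>n\<close> and diagonalise the form with coefficients
  \<open>a\<close>.  Coordinates are indexed by \<open>{1..n}\<close>, like variables, and eigenvectors by \<open>{..<n}\<close>.
\<close>

definition diagonalises :: "nat \<Rightarrow> (nat \<Rightarrow> nat \<Rightarrow> real) \<Rightarrow> (nat \<Rightarrow> nat \<Rightarrow> real) \<Rightarrow> (nat \<Rightarrow> real) \<Rightarrow> bool" where
  "diagonalises n a u l \<longleftrightarrow>
     (\<forall>k<n. \<forall>m<n. (\<Sum>i\<in>{1..n}. u k i * u m i) = (if k = m then 1 else 0)) \<and>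
     (\<forall>i\<in>{1..n}. \<forall>j\<in>{1..n}. a i j = (\<Sum>k<n. l k * (u k i * u k j)))"

text \<open>
  The spectral theorem for symmetric forms, together with the fact that eigenvalues of the
  coefficient matrix are counted by the diagonal entries.
\<close>

theorem symmetric_form_diagonalisation:
  assumes sym: "sym_on {1..n} a"
  obtains u l where "diagonalises n a u l"
    "\<forall>S. num_eigenvalues (mat n n (\<lambda>(i, j). a (Suc i) (Suc j))) S = card {k. k < n \<and> l k \<in> S}"
proof -
  define A where "A = mat n n (\<lambda>(i, j). a (Suc i) (Suc j))"
  have A: "A \<in> carrier_mat n n" by (simp add: A_def)
  have "transpose_mat A = A"
    by (rule eq_matI) (use sym in \<open>auto simp: A_def sym_on_def\<close>)
  then obtain U l where U: "U \<in> carrier_mat n n" and UU: "transpose_mat U * U = 1\<^sub>m n"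
    and AU: "A = U * sdiag n l * transpose_mat U"
    using real_spectral_theorem[OF A] by blast
  have Uc: "transpose_mat U \<in> carrier_mat n n" using U by simp
  define u where "u k i = U $$ (i - 1, k)" for k i
  have shift: "(\<Sum>i\<in>{1..n}. f i) = (\<Sum>i<n. f (Suc i))" for f :: "nat \<Rightarrow> real"
    by (simp add: sum.atLeast1_atMost_eq)
  have 1: "(\<Sum>i\<in>{1..n}. u k i * u m i) = (if k = m then 1 else 0)" if "k < n" "m < n" for k m
  proof -
    have "(transpose_mat U * U) $$ (k,m) = (\<Sum>i<n. U $$ (i,k) * U $$ (i,m))"
      using that U by (simp add: scalar_prod_def atLeast0LessThan)
    then show ?thesis unfolding shift using that by (simp add: UU u_def)
  qed
  have 2: "a i j = (\<Sum>k<n. l k * (u k i * u k j))" if "i \<in> {1..n}" "j \<in> {1..n}" for i j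
  proof -
    have ij: "i - 1 < n" "j - 1 < n" using that by auto
    have UD: "(U * sdiag n l) $$ (i - 1, k) = U $$ (i - 1, k) * l k" if "k < n" for k
    proof -
      have "(U * sdiag n l) $$ (i - 1, k) = (\<Sum>m<n. if m = k then U $$ (i - 1, k) * l k else 0)"
        using that ij U
        by (simp add: scalar_prod_def atLeast0LessThan sdiag_def if_distrib cong: if_cong)
      then show ?thesis using that by simp
    qed
    have "a i j = A $$ (i - 1, j - 1)" using that ij by (simp add: A_def)
    also have "\<dots> = (\<Sum>k<n. (U * sdiag n l) $$ (i - 1, k) * U $$ (j - 1, k))"
      unfolding AU using ij U by (simp add: scalar_prod_def atLeast0LessThan sdiag_def)
    also have "\<dots> = (\<Sum>k<n. l k * (u k i * u k j))"
      by (intro sum.cong refl) (simp only: lessThan_iff UD u_def mult_ac)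
    finally show ?thesis .
  qed
  show thesis
    by (rule that[of u l]) (use 1 2 num_eigenvalues_diagonalised[OF U UU AU] in \<open>auto simp: diagonalises_def A_def\<close>)
qed

section \<open>Quadratic forms with one positive eigenvalue\<close>

text \<open>The bilinear form with coefficients \<open>q\<close> on vectors indexed by \<open>I\<close>.\<close>

definition bform :: "'a set \<Rightarrow> ('a \<Rightarrow> 'a \<Rightarrow> real) \<Rightarrow> ('a \<Rightarrow> real) \<Rightarrow> ('a \<Rightarrow> real) \<Rightarrow> real" where
  "bform I q u v = (\<Sum>i\<in>I. \<Sum>j\<in>I. u i * v j * q i j)"

text \<open>Vectors are total functions here, so linearity is asked of all functions, not only of those supported on an index set.\<close>

definition linear_functional :: "(('a \<Rightarrow> real) \<Rightarrow> real) \<Rightarrow> bool" where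
  "linear_functional L \<longleftrightarrow> (\<forall>x y u v. L (\<lambda>i. x * u i + y * v i) = x * L u + y * L v)"

text \<open>
  The reversed Cauchy-Schwarz inequality for vectors \<open>u \<ge> 0\<close>.  For a symmetric form with nonnegative
  coefficients it says that there is at most one positive eigenvalue; unlike the exact
  signature it passes to limits and to pullbacks along nonnegative matrices.
\<close>

definition lorentz_form :: "'a set \<Rightarrow> ('a \<Rightarrow> 'a \<Rightarrow> real) \<Rightarrow> bool" where
  "lorentz_form I q \<longleftrightarrow>
     (\<forall>u v. (\<forall>i\<in>I. 0 \<le> u i) \<longrightarrow> bform I q u u * bform I q v v \<le> (bform I q u v)\<^sup>2)"

lemma bform_commute:
  assumes "sym_on I q" shows "bform I q u v = bform I q v u"
  unfolding bform_def
  by (subst sum.swap, intro sum.cong refl) (use assms in \<open>simp add: sym_on_def mult_ac\<close>)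

lemma bform_left: "bform I q (\<lambda>i. x * u i + y * v i) w = x * bform I q u w + y * bform I q v w"
  unfolding bform_def by (simp add: sum_distrib_left algebra_simps sum.distrib)

lemma bform_right: "bform I q w (\<lambda>i. x * u i + y * v i) = x * bform I q w u + y * bform I q w v"
  unfolding bform_def by (simp add: sum_distrib_left algebra_simps sum.distrib)

lemma bform_combination:
  assumes "sym_on I q"
  shows "bform I q (\<lambda>i. x * u i + y * v i) (\<lambda>i. x * u i + y * v i)
       = x\<^sup>2 * bform I q u u + 2 * x * y * bform I q u v + y\<^sup>2 * bform I q v v"
  unfolding bform_left bform_right bform_commute[OF assms, of v u]
  by (simp add: power2_eq_square algebra_simps)

lemma linear_functional_bform: "linear_functional (bform I q w)"
  by (simp add: linear_functional_def bform_right)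

lemma linear_functional_sum: "linear_functional (\<lambda>v. \<Sum>i\<in>I. c i * v i)"
  by (simp add: linear_functional_def sum_distrib_left algebra_simps sum.distrib)

text \<open>
  If the inequality failed, the form would be positive definite on the span of \<open>u\<close> and \<open>v\<close>, which
  meets the kernel of \<open>L\<close> in a nonzero vector.
\<close>

lemma reversed_cauchy_schwarz:
  assumes sym: "sym_on I q" and L: "linear_functional L"
    and neg: "\<And>v. L v = 0 \<Longrightarrow> bform I q v v \<le> 0"
    and u: "0 \<le> bform I q u u"
  shows "bform I q u u * bform I q v v \<le> (bform I q u v)\<^sup>2"
proof (rule ccontr)
  assume "\<not> ?thesis"
  then have less: "(bform I q u v)\<^sup>2 < bform I q u u * bform I q v v" by simp
  then have upos: "0 < bform I q u u" using u
    by (metis le_less mult_zero_left not_less zero_le_power2)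
  define x y where "x = L v" and "y = - L u"
  let ?w = "\<lambda>i. x * u i + y * v i"
  have "L ?w = x * L u + y * L v" using L unfolding linear_functional_def by blast
  then have "L ?w = 0" by (simp add: x_def y_def)
  then have "bform I q ?w ?w \<le> 0" by (rule neg)
  then have "bform I q u u * (x\<^sup>2 * bform I q u u + 2 * x * y * bform I q u v + y\<^sup>2 * bform I q v v) \<le> 0"
    unfolding bform_combination[OF sym] using upos by (simp add: mult_le_0_iff)
  then have "(x * bform I q u u + y * bform I q u v)\<^sup>2
      + y\<^sup>2 * (bform I q u u * bform I q v v - (bform I q u v)\<^sup>2) \<le> 0"
    by (simp add: power2_eq_square algebra_simps)
  moreover have "0 \<le> (x * bform I q u u + y * bform I q u v)\<^sup>2" by simp
  ultimately have "y\<^sup>2 * (bform I q u u * bform I q v v - (bform I q u v)\<^sup>2) \<le> 0" by linarith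
  then have "y = 0" using less by (simp add: mult_le_0_iff)
  then have "L u = 0" by (simp add: y_def)
  then show False using neg upos by force
qed

lemma lorentz_formI:
  fixes I :: "'a set"
  assumes "sym_on I q" "linear_functional L"
    and "\<And>v. L v = 0 \<Longrightarrow> bform I q v v \<le> 0"
    and "\<And>i j. i \<in> I \<Longrightarrow> j \<in> I \<Longrightarrow> 0 \<le> q i j"
  shows "lorentz_form I q"
  unfolding lorentz_form_def
proof (intro allI impI)
  fix u v :: "'a \<Rightarrow> real" assume "\<forall>i\<in>I. 0 \<le> u i"
  then have "0 \<le> bform I q u u"
    unfolding bform_def by (intro sum_nonneg mult_nonneg_nonneg assms) auto
  then show "bform I q u u * bform I q v v \<le> (bform I q u v)\<^sup>2"
    using reversed_cauchy_schwarz[OF assms(1-3)] by blast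
qed

lemma bform_diagonalised:
  assumes "\<And>i j. i \<in> I \<Longrightarrow> j \<in> I \<Longrightarrow> q i j = (\<Sum>k<n. l k * (u k i * u k j))"
  shows "bform I q v w = (\<Sum>k<n. l k * ((\<Sum>i\<in>I. u k i * v i) * (\<Sum>i\<in>I. u k i * w i)))"
proof -
  have "bform I q v w = (\<Sum>i\<in>I. \<Sum>j\<in>I. \<Sum>k<n. l k * ((u k i * v i) * (u k j * w j)))"
    unfolding bform_def
    by (intro sum.cong refl) (simp add: assms sum_distrib_left mult_ac)
  also have "\<dots> = (\<Sum>i\<in>I. \<Sum>k<n. \<Sum>j\<in>I. l k * ((u k i * v i) * (u k j * w j)))"
    by (intro sum.cong refl sum.swap)
  also have "\<dots> = (\<Sum>k<n. \<Sum>i\<in>I. \<Sum>j\<in>I. l k * ((u k i * v i) * (u k j * w j)))"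
    by (rule sum.swap)
  also have "\<dots> = (\<Sum>k<n. l k * ((\<Sum>i\<in>I. u k i * v i) * (\<Sum>i\<in>I. u k i * w i)))"
    unfolding sum_product by (simp only: sum_distrib_left)
  finally show ?thesis .
qed

lemma negative_hyperplane_of_signature:
  assumes sym: "sym_on {1..n} q"
    and one: "num_eigenvalues (mat n n (\<lambda>(i, j). q (Suc i) (Suc j))) {0<..} = 1"
  obtains L where "linear_functional L" "\<And>v. L v = 0 \<Longrightarrow> bform {1..n} q v v \<le> 0"
proof -
  obtain u l where diag: "diagonalises n q u l"
    and num: "\<forall>S. num_eigenvalues (mat n n (\<lambda>(i, j). q (Suc i) (Suc j))) S = card {k. k < n \<and> l k \<in> S}"
    using symmetric_form_diagonalisation[OF sym] by blast
  have orth: "(\<Sum>i\<in>{1..n}. u k i * u m i) = (if k = m then 1 else 0)" if "k < n" "m < n" for k m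
    using diag that by (simp add: diagonalises_def)
  have q: "q i j = (\<Sum>k<n. l k * (u k i * u k j))" if "i \<in> {1..n}" "j \<in> {1..n}" for i j
    using diag that by (simp add: diagonalises_def)
  have bd: "bform {1..n} q v w
      = (\<Sum>k<n. l k * ((\<Sum>i\<in>{1..n}. u k i * v i) * (\<Sum>i\<in>{1..n}. u k i * w i)))" for v w
    by (rule bform_diagonalised) (rule q)
  have "card {k. k < n \<and> 0 < l k} = 1" using one by (simp add: num)
  then obtain k0 where k0: "{k. k < n \<and> 0 < l k} = {k0}" by (rule card_1_singletonE)
  show thesis
  proof (rule that[of "\<lambda>v. \<Sum>i\<in>{1..n}. u k0 i * v i"])
    show "linear_functional (\<lambda>v. \<Sum>i = 1..n. u k0 i * v i)" by (rule linear_functional_sum)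
    fix v assume v: "(\<Sum>i = 1..n. u k0 i * v i) = 0"
    show "bform {1..n} q v v \<le> 0"
      unfolding bd
    proof (rule sum_nonpos)
      fix k assume "k \<in> {..<n}"
      then have "k = k0 \<or> l k \<le> 0" using k0 by force
      then show "l k * ((\<Sum>i = 1..n. u k i * v i) * (\<Sum>i = 1..n. u k i * v i)) \<le> 0"
        using v by (auto simp: mult_nonpos_nonneg)
    qed
  qed
qed

lemma signature_of_negative_hyperplane:
  assumes sym: "sym_on {1..n} q" and L: "linear_functional L"
    and neg: "\<And>v. L v = 0 \<Longrightarrow> \<exists>i\<in>{1..n}. v i \<noteq> 0 \<Longrightarrow> bform {1..n} q v v < 0"
    and pos: "0 < bform {1..n} q w w"
  shows "num_eigenvalues (mat n n (\<lambda>(i, j). q (Suc i) (Suc j))) {0<..} = 1"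
    and "num_eigenvalues (mat n n (\<lambda>(i, j). q (Suc i) (Suc j))) {..<0} = n - 1"
proof -
  obtain u l where diag: "diagonalises n q u l"
    and num: "\<forall>S. num_eigenvalues (mat n n (\<lambda>(i, j). q (Suc i) (Suc j))) S = card {k. k < n \<and> l k \<in> S}"
    using symmetric_form_diagonalisation[OF sym] by blast
  have orth: "(\<Sum>i\<in>{1..n}. u k i * u m i) = (if k = m then 1 else 0)" if "k < n" "m < n" for k m
    using diag that by (simp add: diagonalises_def)
  have q: "q i j = (\<Sum>k<n. l k * (u k i * u k j))" if "i \<in> {1..n}" "j \<in> {1..n}" for i j
    using diag that by (simp add: diagonalises_def)
  have bd: "bform {1..n} q v w
      = (\<Sum>k<n. l k * ((\<Sum>i\<in>{1..n}. u k i * v i) * (\<Sum>i\<in>{1..n}. u k i * w i)))" for v w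
    by (rule bform_diagonalised) (rule q)
  have bu: "bform {1..n} q (u k) (u m) = (if k = m then l k else 0)" if "k < n" "m < n" for k m
  proof -
    have "bform {1..n} q (u k) (u m) = (\<Sum>p<n. l p * ((if p = k then 1 else 0) * (if p = m then 1 else 0)))"
      unfolding bd using that by (intro sum.cong refl) (simp only: orth lessThan_iff)
    also have "\<dots> = (\<Sum>p<n. if p = k then (if k = m then l k else 0) else 0)"
      by (intro sum.cong refl) auto
    finally show ?thesis using that by simp
  qed
  obtain k0 where k0: "k0 < n" "0 < l k0"
  proof -
    have "\<exists>k<n. 0 < l k"
    proof (rule ccontr)
      assume "\<not> ?thesis"
      then have "l k \<le> 0" if "k < n" for k using that by force
      then have "bform {1..n} q w w \<le> 0"
        unfolding bd by (intro sum_nonpos mult_nonpos_nonneg) auto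
      with pos show False by simp
    qed
    then show thesis using that by blast
  qed
  have rest: "l k < 0" if k: "k < n" "k \<noteq> k0" for k
  proof (rule ccontr)
    assume "\<not> l k < 0"
    then have lk: "0 \<le> l k" by simp
    \<comment> \<open>Two nonnegative eigenvalues would give a nonzero vector in the kernel of \<open>L\<close> where the form is
      nonnegative.\<close>
    define x y where "x = (if L (u k) = 0 \<and> L (u k0) = 0 then 1 else L (u k0))"
      and "y = (if L (u k) = 0 \<and> L (u k0) = 0 then 0 else - L (u k))"
    let ?w = "\<lambda>i. x * u k i + y * u k0 i"
    have xy: "x \<noteq> 0 \<or> y \<noteq> 0" by (auto simp: x_def y_def)
    have "L ?w = x * L (u k) + y * L (u k0)" using L by (simp add: linear_functional_def)
    then have L0: "L ?w = 0" by (auto simp: x_def y_def)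
    have "(\<Sum>i\<in>{1..n}. u k i * ?w i) = x" "(\<Sum>i\<in>{1..n}. u k0 i * ?w i) = y"
    proof -
      have e: "(\<Sum>i\<in>{1..n}. u m i * ?w i) = x * (\<Sum>i\<in>{1..n}. u m i * u k i) + y * (\<Sum>i\<in>{1..n}. u m i * u k0 i)" for m
        by (simp add: sum_distrib_left algebra_simps sum.distrib)
      show "(\<Sum>i\<in>{1..n}. u k i * ?w i) = x" "(\<Sum>i\<in>{1..n}. u k0 i * ?w i) = y"
        unfolding e using k k0 by (simp_all only: orth) simp_all
    qed
    then have "\<exists>i\<in>{1..n}. ?w i \<noteq> 0"
      using xy by (metis (no_types, lifting) mult_zero_right sum.neutral)
    then have "bform {1..n} q ?w ?w < 0" using neg[OF L0] by blast
    moreover have "0 \<le> bform {1..n} q ?w ?w"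
      unfolding bform_combination[OF sym] bu[OF k(1) k(1)] bu[OF k(1) k0(1)] bu[OF k0(1) k0(1)]
      using k k0 lk by simp
    ultimately show False by simp
  qed
  have 1: "{k. k < n \<and> l k \<in> {0<..}} = {k0}" using k0 rest by force
  have 2: "{k. k < n \<and> l k \<in> {..<0}} = {..<n} - {k0}" using k0 rest by force
  show "num_eigenvalues (mat n n (\<lambda>(i, j). q (Suc i) (Suc j))) {0<..} = 1"
    using num 1 by simp
  show "num_eigenvalues (mat n n (\<lambda>(i, j). q (Suc i) (Suc j))) {..<0} = n - 1"
    using num 2 k0 by simp
qed

section \<open>Forms satisfying triangle relations\<close>

lemma bform_insert:
  assumes S: "finite S" "a \<notin> S" and sym: "sym_on (insert a S) q"
  shows "bform (insert a S) q c c = bform S q c c + 2 * c a * (\<Sum>k\<in>S. c k * q a k) + (c a)\<^sup>2 * q a a"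
proof -
  define X where "X = (\<Sum>k\<in>S. c k * q a k)"
  have 1: "(\<Sum>i\<in>S. c i * c a * q i a) = c a * X"
    unfolding X_def sum_distrib_left
  proof (intro sum.cong refl)
    fix i assume "i \<in> S"
    then have "q i a = q a i" using sym unfolding sym_on_def by blast
    then show "c i * c a * q i a = c a * (c i * q a i)" by simp
  qed
  have 2: "(\<Sum>j\<in>S. c a * c j * q a j) = c a * X"
    unfolding X_def by (simp add: sum_distrib_left mult.assoc)
  have "bform (insert a S) q c c = c a * c a * q a a + (\<Sum>j\<in>S. c a * c j * q a j)
      + ((\<Sum>i\<in>S. c i * c a * q i a) + bform S q c c)"
    using S by (simp add: bform_def sum.distrib)
  then show ?thesis unfolding 1 2 X_def[symmetric] by (simp add: power2_eq_square)
qed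

lemma bform_cong:
  assumes "\<And>i. i \<in> I \<Longrightarrow> u i = u' i" "\<And>i. i \<in> I \<Longrightarrow> v i = v' i"
    "\<And>i j. i \<in> I \<Longrightarrow> j \<in> I \<Longrightarrow> q i j = q' i j"
  shows "bform I q u v = bform I q' u' v'"
  unfolding bform_def by (intro sum.cong refl) (simp add: assms)

text \<open>
  Near-ultrametrics are of negative type, quantitatively.  The induction removes one point \<open>a\<close> of a
  closest pair \<open>a, b\<close> and adds its weight to \<open>b\<close>.  The rows of \<open>a\<close> and \<open>b\<close> differ by at most
  \<open>\<epsilon> * u a b\<close>, and \<open>u a b\<close> is no larger than the smallest distance that remains, so the negative
  bound for the smaller set absorbs the error.  For an exact ultrametric the constant is \<open>1\<close>; the
  step from \<open>N - 1\<close> to \<open>N\<close> points turns a loss \<open>e\<close> into at most \<open>2 * e + \<epsilon> * N\<close>.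
\<close>

lemma near_ultrametric_negative_type:
  fixes u :: "'a \<Rightarrow> 'a \<Rightarrow> real"
  assumes "finite R" and "card R = N"
    and "sym_on R u" and "\<And>i. i \<in> R \<Longrightarrow> u i i = 0"
    and "\<And>i j k. i \<in> R \<Longrightarrow> j \<in> R \<Longrightarrow> k \<in> R \<Longrightarrow> u i j \<le> u i k \<Longrightarrow> u i j \<le> u j k
           \<Longrightarrow> \<bar>u i k - u j k\<bar> \<le> \<epsilon> * u i j"
    and "0 \<le> \<epsilon>" and "\<epsilon> * N * 2 ^ N \<le> 1"
    and "0 \<le> \<delta>" and "\<And>i j. i \<in> R \<Longrightarrow> j \<in> R \<Longrightarrow> i \<noteq> j \<Longrightarrow> \<delta> \<le> u i j"
    and "(\<Sum>i\<in>R. c i) = 0"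
  shows "bform R u c c \<le> - (1 - \<epsilon> * N * 2 ^ N) * \<delta> * (\<Sum>i\<in>R. (c i)\<^sup>2)"
  using assms
proof (induction N arbitrary: R c \<delta>)
  case 0
  have "R = {}" using 0(1,2) by simp
  then show ?case by (simp add: bform_def)
next
  case (Suc N)
  note sym = Suc.prems(3) and diag = Suc.prems(4) and near = Suc.prems(5) and eps = Suc.prems(6)
  show ?case
  proof (cases "N = 0")
    case True
    then obtain x where R: "R = {x}" using Suc.prems(2) card_1_singletonE by auto
    then show ?thesis using Suc.prems(10) by (simp add: bform_def)
  next
    case False
    define P where "P = {(i,j). i \<in> R \<and> j \<in> R \<and> i \<noteq> j}"
    have "P \<subseteq> R \<times> R" by (auto simp: P_def)
    then have finP: "finite P" using Suc.prems(1) finite_subset by blast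
    have "\<exists>x y. x \<in> R \<and> y \<in> R \<and> x \<noteq> y"
    proof (rule ccontr)
      assume "\<not> ?thesis"
      then have "card R \<le> Suc 0" using Suc.prems(1) by (simp add: card_le_Suc0_iff_eq)
      then show False using Suc.prems(2) False by simp
    qed
    then have "P \<noteq> {}" by (auto simp: P_def)
    then have "Min ((\<lambda>(i,j). u i j) ` P) \<in> (\<lambda>(i,j). u i j) ` P" using finP by (intro Min_in) auto
    then obtain a b where ab: "(a,b) \<in> P" "u a b = Min ((\<lambda>(i,j). u i j) ` P)" by force
    have a: "a \<in> R" and b: "b \<in> R" and neq: "a \<noteq> b" using ab(1) by (auto simp: P_def)
    have min: "u a b \<le> u i j" if "i \<in> R" "j \<in> R" "i \<noteq> j" for i j
      unfolding ab(2) using finP that by (intro Min_le) (auto simp: P_def image_iff)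
    define D where "D = u a b"
    have D: "0 \<le> D" "\<delta> \<le> D" using Suc.prems(8) Suc.prems(9)[OF a b neq] by (auto simp: D_def)
    define S where "S = R - {a,b}"
    have Sfin: "finite S" using Suc.prems(1) by (simp add: S_def)
    have aS: "a \<notin> insert b S" and bS: "b \<notin> S" using neq by (auto simp: S_def)
    have R: "R = insert a (insert b S)" using a b by (auto simp: S_def)
    have SR: "insert b S \<subseteq> R" using b by (auto simp: S_def)
    have cardS: "card (insert b S) = N" using Suc.prems(2) aS Sfin unfolding R by simp
    have cardS': "real (card S) \<le> real (Suc N)" using cardS bS Sfin by simp
    define c' where "c' = c(b := c a + c b)"
    define T where "T = (\<Sum>k\<in>S. (c k)\<^sup>2)"
    have T0: "0 \<le> T" by (simp add: T_def sum_nonneg)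
    define e where "e = \<epsilon> * N * 2 ^ N"
    define e1 where "e1 = \<epsilon> * Suc N * 2 ^ Suc N"
    have e0: "0 \<le> e" using eps by (simp add: e_def)
    have e1: "2 * e + \<epsilon> * Suc N \<le> e1"
    proof -
      have "real (Suc N) \<le> 2 ^ Suc N" 
        by (rule less_imp_le[OF of_nat_less_two_power])
      then have "\<epsilon> * real (Suc N) \<le> \<epsilon> * 2 ^ Suc N" using eps mult_left_mono by blast
      then show ?thesis by (simp add: e_def e1_def algebra_simps)
    qed
    have e1': "e1 \<le> 1" using Suc.prems(7) by (simp add: e1_def)
    have IH: "bform (insert b S) u c' c' \<le> - (1 - e) * D * (\<Sum>i\<in>insert b S. (c' i)\<^sup>2)"
      unfolding e_def
    proof (rule Suc.IH)
      show "finite (insert b S)" using Sfin by simp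
      show "card (insert b S) = N" by (rule cardS)
      show "sym_on (insert b S) u" using sym SR unfolding sym_on_def by blast
      show "u i i = 0" if "i \<in> insert b S" for i using SR that by (intro diag) auto
      show "\<bar>u i k - u j k\<bar> \<le> \<epsilon> * u i j"
        if "i \<in> insert b S" "j \<in> insert b S" "k \<in> insert b S" "u i j \<le> u i k" "u i j \<le> u j k" for i j k
        using SR that by (intro near) auto
      show "0 \<le> \<epsilon>" by (rule eps)
      show "\<epsilon> * real N * 2 ^ N \<le> 1"
      proof -
        have "e \<le> 2 * e + \<epsilon> * Suc N" using e0 eps by simp
        then show ?thesis using e1 e1' unfolding e_def by linarith
      qed
      show "0 \<le> D" by (rule D)
      show "D \<le> u i j" if "i \<in> insert b S" "j \<in> insert b S" "i \<noteq> j" for i j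
        unfolding D_def using SR that by (intro min) auto
      have "(\<Sum>i\<in>S. c' i) = (\<Sum>i\<in>S. c i)" using bS by (intro sum.cong) (auto simp: c'_def)
      then show "(\<Sum>i\<in>insert b S. c' i) = 0"
        using Suc.prems(10) Sfin bS aS unfolding R by (simp add: c'_def)
    qed
    have sq': "(\<Sum>i\<in>insert b S. (c' i)\<^sup>2) = (c a + c b)\<^sup>2 + T"
    proof -
      have "(\<Sum>i\<in>S. (c' i)\<^sup>2) = T" unfolding T_def using bS by (intro sum.cong) (auto simp: c'_def)
      then show ?thesis using Sfin bS by (simp add: c'_def)
    qed
    have sq: "(\<Sum>i\<in>R. (c i)\<^sup>2) = (c a)\<^sup>2 + (c b)\<^sup>2 + T"
      unfolding R using Sfin bS aS by (simp add: T_def)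
    have sym_S: "sym_on (insert b S) u" using sym SR unfolding sym_on_def by blast
    have f1: "bform R u c c = bform S u c c + 2 * c b * (\<Sum>k\<in>S. c k * u b k)
        + 2 * c a * (\<Sum>k\<in>S. c k * u a k) + 2 * c a * c b * D"
      using bform_insert[of "insert b S" a u c] bform_insert[of S b u c] Sfin aS bS sym sym_S
        diag[OF a] diag[OF b]
      unfolding R[symmetric] by (simp add: D_def algebra_simps)
    have f2: "bform (insert b S) u c' c' = bform S u c c + 2 * (c a + c b) * (\<Sum>k\<in>S. c k * u b k)"
    proof -
      have "bform S u c' c' = bform S u c c" using bS by (intro bform_cong) (auto simp: c'_def)
      moreover have "(\<Sum>k\<in>S. c' k * u b k) = (\<Sum>k\<in>S. c k * u b k)"
        using bS by (intro sum.cong) (auto simp: c'_def)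
      ultimately show ?thesis
        using bform_insert[of S b u c'] Sfin bS sym_S diag[OF b] by (simp add: c'_def)
    qed
    have f3: "bform R u c c = bform (insert b S) u c' c'
        + 2 * c a * (\<Sum>k\<in>S. c k * (u a k - u b k)) + 2 * c a * c b * D"
      unfolding f1 f2 by (simp add: algebra_simps sum_subtractf)
    have small: "2 * c a * (\<Sum>k\<in>S. c k * (u a k - u b k)) \<le> \<epsilon> * D * (Suc N * (c a)\<^sup>2 + T)"
    proof -
      have term_le: "2 * c a * (c k * (u a k - u b k)) \<le> \<epsilon> * D * ((c a)\<^sup>2 + (c k)\<^sup>2)" if k: "k \<in> S" for k
      proof -
        have kR: "k \<in> R" "k \<noteq> a" "k \<noteq> b" using k by (auto simp: S_def)
        have d: "\<bar>u a k - u b k\<bar> \<le> \<epsilon> * D" unfolding D_def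
          by (rule near[OF a b kR(1) min[OF a kR(1) kR(2)[symmetric]] min[OF b kR(1) kR(3)[symmetric]]])
        have "2 * c a * (c k * (u a k - u b k)) \<le> \<bar>2 * c a * (c k * (u a k - u b k))\<bar>"
          by (rule abs_ge_self)
        also have "\<dots> = (2 * \<bar>c a\<bar> * \<bar>c k\<bar>) * \<bar>u a k - u b k\<bar>" by (simp add: abs_mult)
        also have "\<dots> \<le> (2 * \<bar>c a\<bar> * \<bar>c k\<bar>) * (\<epsilon> * D)" using d by (intro mult_left_mono) auto
        also have "\<dots> \<le> ((c a)\<^sup>2 + (c k)\<^sup>2) * (\<epsilon> * D)"
        proof (rule mult_right_mono)
          have "0 \<le> (\<bar>c a\<bar> - \<bar>c k\<bar>)\<^sup>2" by simp
          then show "2 * \<bar>c a\<bar> * \<bar>c k\<bar> \<le> (c a)\<^sup>2 + (c k)\<^sup>2"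
            by (simp add: power2_diff)
        qed (use eps D in simp)
        finally show ?thesis by (simp add: mult_ac)
      qed
      have "2 * c a * (\<Sum>k\<in>S. c k * (u a k - u b k)) = (\<Sum>k\<in>S. 2 * c a * (c k * (u a k - u b k)))"
        by (simp add: sum_distrib_left)
      also have "\<dots> \<le> (\<Sum>k\<in>S. \<epsilon> * D * ((c a)\<^sup>2 + (c k)\<^sup>2))" by (intro sum_mono term_le)
      also have "\<dots> = \<epsilon> * D * (card S * (c a)\<^sup>2 + T)"
        by (simp add: T_def sum.distrib flip: sum_distrib_left)
      also have "\<dots> \<le> \<epsilon> * D * (Suc N * (c a)\<^sup>2 + T)"
        using eps D cardS' by (intro mult_left_mono add_right_mono mult_right_mono) auto
      finally show ?thesis .
    qed
    have "bform R u c c \<le> - (1 - e) * D * ((c a + c b)\<^sup>2 + T) + \<epsilon> * D * (Suc N * (c a)\<^sup>2 + T) + 2 * c a * c b * D"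
      unfolding f3 using IH small unfolding sq' by linarith
    also have "\<dots> = D * (- (1 - e) * ((c a)\<^sup>2 + (c b)\<^sup>2 + T) + e * (2 * c a * c b) + \<epsilon> * (Suc N * (c a)\<^sup>2 + T))"
      by (simp add: algebra_simps power2_eq_square)
    also have "\<dots> \<le> D * (- (1 - e1) * ((c a)\<^sup>2 + (c b)\<^sup>2 + T))"
    proof (rule mult_left_mono)
      have X1: "2 * c a * c b \<le> (c a)\<^sup>2 + (c b)\<^sup>2"
        by (rule sum_squares_bound)
      have i1: "e * (2 * c a * c b) \<le> e * ((c a)\<^sup>2 + (c b)\<^sup>2 + T)"
        using e0 T0 X1 by (intro mult_left_mono) auto
      have i2': "real (Suc N) * (c a)\<^sup>2 + T \<le> Suc N * ((c a)\<^sup>2 + (c b)\<^sup>2 + T)"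
        using T0 by (simp add: algebra_simps)
      have i2: "\<epsilon> * (Suc N * (c a)\<^sup>2 + T) \<le> (\<epsilon> * Suc N) * ((c a)\<^sup>2 + (c b)\<^sup>2 + T)"
        using mult_left_mono[OF i2' eps] by (simp only: mult.assoc)
      have i3: "(2 * e + \<epsilon> * Suc N) * ((c a)\<^sup>2 + (c b)\<^sup>2 + T) \<le> e1 * ((c a)\<^sup>2 + (c b)\<^sup>2 + T)"
        using e1 T0 by (intro mult_right_mono) auto
      define X where "X = (c a)\<^sup>2 + (c b)\<^sup>2 + T"
      show "- (1 - e) * ((c a)\<^sup>2 + (c b)\<^sup>2 + T) + e * (2 * c a * c b) + \<epsilon> * (Suc N * (c a)\<^sup>2 + T)
          \<le> - (1 - e1) * ((c a)\<^sup>2 + (c b)\<^sup>2 + T)"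
        using i1 i2 i3 unfolding X_def[symmetric] by (simp add: algebra_simps)
    qed (rule D)
    also have "\<dots> \<le> - (1 - e1) * \<delta> * ((c a)\<^sup>2 + (c b)\<^sup>2 + T)"
    proof -
      have "(1 - e1) * ((c a)\<^sup>2 + (c b)\<^sup>2 + T) * \<delta> \<le> (1 - e1) * ((c a)\<^sup>2 + (c b)\<^sup>2 + T) * D"
        using e1' T0 D by (intro mult_left_mono) auto
      then show ?thesis by (simp add: algebra_simps)
    qed
    finally show ?thesis unfolding sq e1_def .
  qed
qed

lemma powr_add_le_small_exponent:
  fixes b c q :: real
  assumes q: "0 < q" "q \<le> 1" and c: "0 \<le> c" "c \<le> b"
  shows "(b + c) powr q \<le> b powr q + 2 * q * c powr q"
proof (cases "b = 0")
  case True
  then show ?thesis using c by simp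
next
  case False
  then have b: "0 < b" using c by simp
  define s where "s = c / b"
  have s: "0 \<le> s" "s \<le> 1" using b c by (auto simp: s_def)
  have ln: "ln (1 + s) \<le> s" using s by (intro ln_add_one_self_le_self) auto
  define x where "x = q * ln (1 + s)"
  have x: "0 \<le> x" "x \<le> q * s" using q s ln by (auto simp: x_def)
  have qs: "q * s \<le> 1" using q s by (simp add: mult_le_one)
  have "(1 + s) powr q = exp x" using s by (simp add: powr_def x_def)
  also have "\<dots> \<le> 1 + x + x\<^sup>2" using x qs by (intro exp_bound) auto
  also have "x\<^sup>2 \<le> x" using x qs by (simp add: power2_eq_square mult_left_le)
  finally have 1: "(1 + s) powr q \<le> 1 + 2 * q * s" using x by simp
  have 2: "s \<le> s powr q"
  proof (cases "s = 0")
    case False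
    then show ?thesis using powr_mono'[of q 1 s] s q by simp
  qed simp
  have "1 + 2 * q * s \<le> 1 + 2 * q * s powr q" using 2 q by simp
  with 1 have "(1 + s) powr q \<le> 1 + 2 * q * s powr q" by linarith
  then have "b powr q * (1 + s) powr q \<le> b powr q * (1 + 2 * q * s powr q)"
    by (intro mult_left_mono) auto
  moreover have "b powr q * (1 + s) powr q = (b + c) powr q"
  proof -
    have "b * (1 + s) = b + c" using b by (simp add: s_def field_simps)
    then show ?thesis using powr_mult[of b "1 + s" q] b s by simp
  qed
  moreover have "b powr q * s powr q = c powr q"
    using b s c by (simp add: s_def flip: powr_mult)
  ultimately show ?thesis by (simp add: algebra_simps)
qed

text \<open>
  Writing \<open>x, y, z\<close> as \<open>q\<close>-th powers of the sides of a triangle, a short side \<open>z\<close> forces the other two to be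
  nearly equal, with an error proportional to \<open>z\<close> itself and not only to \<open>x\<close>.
\<close>

lemma T_relation_near:
  assumes q: "0 < q" "q \<le> 1" and T: "T_relation q x y z"
    and z: "0 \<le> z" "z \<le> x" "z \<le> y"
  shows "\<bar>x - y\<bar> \<le> 2 * q * z"
proof -
  have inv: "(t powr (1 / q)) powr q = t" if "0 \<le> t" for t
    using that q by (simp add: powr_powr)
  have main: "s \<le> t + 2 * q * z" if "z \<le> t" "z \<le> s" "s powr (1 / q) \<le> t powr (1 / q) + z powr (1 / q)" for s t
  proof -
    have "s = (s powr (1 / q)) powr q" using inv that z by simp
    also have "\<dots> \<le> (t powr (1 / q) + z powr (1 / q)) powr q"
      using that q by (intro powr_mono2) auto
    also have "\<dots> \<le> (t powr (1 / q)) powr q + 2 * q * (z powr (1 / q)) powr q"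
      using q z that by (intro powr_add_le_small_exponent powr_mono2) auto
    also have "\<dots> = t + 2 * q * z" using inv[of t] inv[of z] that z by simp
    finally show ?thesis .
  qed
  have "x \<le> y + 2 * q * z" "y \<le> x + 2 * q * z"
    using T z by (auto intro!: main simp: T_relation_def)
  then show ?thesis by simp
qed

lemma T_relation_scale:
  assumes "T_relation q x y z" "0 \<le> x" "0 \<le> y" "0 \<le> z" "0 < s"
  shows "T_relation q (x / s) (y / s) (z / s)"
proof -
  have "(t / s) powr (1 / q) = t powr (1 / q) / s powr (1 / q)" if "0 \<le> t" for t
    using that assms(5) by (simp add: powr_divide)
  moreover have "0 < s powr (1 / q)" using assms(5) by simp
  ultimately show ?thesis
    using assms by (simp add: T_relation_def divide_right_mono flip: add_divide_distrib)
qed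

lemma T_relation_degenerate:
  assumes "T_relation q x y 0" "0 < q" "0 \<le> x" "0 \<le> y"
  shows "x = y"
proof -
  have "x powr (1 / q) = y powr (1 / q)" using assms by (simp add: T_relation_def)
  then have "(x powr (1 / q)) powr q = (y powr (1 / q)) powr q" by simp
  then show ?thesis using assms by (simp add: powr_powr)
qed

text \<open>
  Fix an index \<open>z\<close> whose row is not zero.  On the indices with \<open>p z i \<noteq> 0\<close>, the normalised entries
  \<open>p i j / (p z i * p z j)\<close> are a near-ultrametric, by the relations for \<open>i, j, k, z\<close>.  The rows of the
  other indices are multiples of the row of \<open>z\<close>.  So the form is nonpositive on the complement,
  with respect to \<open>p\<close>, of the \<open>z\<close>-th basis vector.
\<close>

theorem triangular_form_lorentzian:
  fixes p :: "'a \<Rightarrow> 'a \<Rightarrow> real" and q :: real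
  assumes fin: "finite I" and q: "0 < q" "2 * q * card I * 2 ^ card I \<le> 1"
    and sym: "sym_on I p" and nonneg: "\<And>i j. i \<in> I \<Longrightarrow> j \<in> I \<Longrightarrow> 0 \<le> p i j"
    and diag: "\<And>i. i \<in> I \<Longrightarrow> p i i = 0"
    and T: "\<And>i j k l. i \<in> I \<Longrightarrow> j \<in> I \<Longrightarrow> k \<in> I \<Longrightarrow> l \<in> I \<Longrightarrow>
              T_relation q (p j k * p i l) (p i k * p j l) (p i j * p k l)"
  shows "lorentz_form I p"
proof (cases "\<exists>z\<in>I. \<exists>s\<in>I. p z s \<noteq> 0")
  case False
  then have "bform I p u v = 0" for u v by (auto simp: bform_def intro!: sum.neutral)
  then show ?thesis by (simp add: lorentz_form_def)
next
  case True
  then obtain z s where zs: "z \<in> I" "s \<in> I" "p z s \<noteq> 0" by blast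
  then have zs_pos: "0 < p z s" using nonneg[of z s] by simp
  have symD: "p i j = p j i" if "i \<in> I" "j \<in> I" for i j using sym that unfolding sym_on_def by blast
  define Z where "Z = {i \<in> I. p z i = 0}"
  define R where "R = {i \<in> I. p z i \<noteq> 0}"
  have ZR: "I = Z \<union> R" "Z \<inter> R = {}" by (auto simp: Z_def R_def)
  have finZR: "finite Z" "finite R" using fin by (auto simp: Z_def R_def)
  have Rpos: "0 < p z i" if "i \<in> R" for i using that nonneg[of z i] zs(1) by (auto simp: R_def)
  have row: "p i k = p i s / p z s * p z k" if i: "i \<in> Z" and k: "k \<in> I" for i k
  proof -
    have iI: "i \<in> I" "p z i = 0" using i by (auto simp: Z_def)
    have "T_relation q (p i k * p z s) (p z k * p i s) 0"
      using T[of z i k s] iI k zs by simp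
    then have "p i k * p z s = p z k * p i s"
      using q iI k zs nonneg by (intro T_relation_degenerate) auto
    then show ?thesis using zs_pos by (simp add: field_simps)
  qed
  have qle: "q \<le> 1"
  proof -
    have "1 \<le> card I" using zs(1) fin by (metis One_nat_def Suc_leI card_gt_0_iff empty_iff)
    then have "(1::real) \<le> real (card I) * 2 ^ card I"
      using mult_mono[of 1 "real (card I)" 1 "2 ^ card I"] by simp
    then have "2 * q * 1 \<le> 2 * q * (real (card I) * 2 ^ card I)" using q by (intro mult_left_mono) auto
    also have "\<dots> \<le> 1" using q(2) by (simp only: mult.assoc)
    finally show ?thesis using q by linarith
  qed
  define L where "L v = (\<Sum>j\<in>I. p z j * v j)" for v
  show ?thesis
  proof (rule lorentz_formI[OF sym _ _ nonneg])
    show "linear_functional L" unfolding L_def by (rule linear_functional_sum)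
    fix v assume Lv: "L v = 0"
    have LR: "(\<Sum>j\<in>R. p z j * v j) = 0"
    proof -
      have "(\<Sum>j\<in>Z. p z j * v j) = 0" by (rule sum.neutral) (auto simp: Z_def)
      then show ?thesis using Lv finZR ZR unfolding L_def by (simp add: sum.union_disjoint)
    qed
    have rowR: "(\<Sum>j\<in>R. p i j * v j) = 0" if i: "i \<in> Z" for i
    proof -
      have "(\<Sum>j\<in>R. p i j * v j) = (\<Sum>j\<in>R. p i s / p z s * (p z j * v j))"
        by (intro sum.cong refl) (use row[OF i] ZR in auto)
      also have "\<dots> = 0" unfolding sum_distrib_left[symmetric] LR by simp
      finally show ?thesis .
    qed
    have ZZ: "p i j = 0" if "i \<in> Z" "j \<in> Z" for i j
      using row[of i j] that by (auto simp: Z_def)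
    have split: "(\<Sum>j\<in>I. f j) = (\<Sum>j\<in>Z. f j) + (\<Sum>j\<in>R. f j)" for f :: "'a \<Rightarrow> real"
      using finZR ZR by (simp add: sum.union_disjoint)
    have zero1: "(\<Sum>i\<in>Z. \<Sum>j\<in>R. v i * v j * p i j) = 0"
    proof (rule sum.neutral, rule ballI)
      fix i assume "i \<in> Z"
      then have "v i * (\<Sum>j\<in>R. p i j * v j) = 0" using rowR by simp
      then show "(\<Sum>j\<in>R. v i * v j * p i j) = 0" by (simp add: sum_distrib_left mult_ac)
    qed
    have zero2: "(\<Sum>i\<in>R. \<Sum>j\<in>Z. v i * v j * p i j) = 0"
    proof -
      have "(\<Sum>i\<in>R. \<Sum>j\<in>Z. v i * v j * p i j) = (\<Sum>j\<in>Z. \<Sum>i\<in>R. v i * v j * p i j)" by (rule sum.swap)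
      also have "\<dots> = (\<Sum>j\<in>Z. \<Sum>i\<in>R. v j * v i * p j i)"
        by (intro sum.cong refl) (use symD ZR in auto)
      finally show ?thesis using zero1 by simp
    qed
    have zero3: "(\<Sum>i\<in>Z. \<Sum>j\<in>Z. v i * v j * p i j) = 0" by (intro sum.neutral ballI) (simp add: ZZ)
    have "bform I p v v = bform R p v v"
      unfolding bform_def split sum.distrib using zero1 zero2 zero3 by simp
    also have "\<dots> = bform R (\<lambda>i j. p i j / (p z i * p z j)) (\<lambda>i. p z i * v i) (\<lambda>i. p z i * v i)"
      unfolding bform_def
    proof (intro sum.cong refl)
      fix i j assume "i \<in> R" "j \<in> R"
      then have "p z i \<noteq> 0" "p z j \<noteq> 0" by (auto simp: R_def)
      then show "v i * v j * p i j = p z i * v i * (p z j * v j) * (p i j / (p z i * p z j))"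
        by (simp add: field_simps)
    qed
    also have "\<dots> \<le> - (1 - 2 * q * card R * 2 ^ card R) * 0 * (\<Sum>i\<in>R. (p z i * v i)\<^sup>2)"
    proof (rule near_ultrametric_negative_type)
      show "finite R" by (rule finZR)
      show "card R = card R" ..
      show "sym_on R (\<lambda>i j. p i j / (p z i * p z j))"
        using symD unfolding sym_on_def R_def by (simp add: mult.commute)
      show "p i i / (p z i * p z i) = 0" if "i \<in> R" for i using that diag by (simp add: R_def)
      show "0 \<le> 2 * q" using q by simp
      have "card R \<le> card I" using fin by (intro card_mono) (auto simp: R_def)
      then have "real (card R) * 2 ^ card R \<le> real (card I) * 2 ^ card I"
        by (intro mult_mono power_increasing) auto
      then have "2 * q * (real (card R) * 2 ^ card R) \<le> 2 * q * (real (card I) * 2 ^ card I)"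
        using q by (intro mult_left_mono) auto
      also have "\<dots> \<le> 1" using q(2) by (simp only: mult.assoc)
      finally show "2 * q * real (card R) * 2 ^ card R \<le> 1" by (simp only: mult.assoc)
      show "0 \<le> p i j / (p z i * p z j)" if "i \<in> R" "j \<in> R" for i j
        using that nonneg Rpos by (intro divide_nonneg_pos) (auto simp: R_def)
      show "(\<Sum>i\<in>R. p z i * v i) = 0" by (rule LR)
      fix i j k assume ijk: "i \<in> R" "j \<in> R" "k \<in> R"
        and le: "p i j / (p z i * p z j) \<le> p i k / (p z i * p z k)"
          "p i j / (p z i * p z j) \<le> p j k / (p z j * p z k)"
      have I: "i \<in> I" "j \<in> I" "k \<in> I" using ijk by (auto simp: R_def)
      have pos: "0 < p z i" "0 < p z j" "0 < p z k" using Rpos ijk by auto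
      have "T_relation q (p j k * p i z / (p z i * p z j * p z k)) (p i k * p j z / (p z i * p z j * p z k))
           (p i j * p k z / (p z i * p z j * p z k))"
        using T[OF I zs(1)] I zs(1) nonneg pos by (intro T_relation_scale) auto
      then have "T_relation q (p j k / (p z j * p z k)) (p i k / (p z i * p z k)) (p i j / (p z i * p z j))"
        using pos I zs(1) by (simp add: symD[of _ z] field_simps)
      then have "\<bar>p j k / (p z j * p z k) - p i k / (p z i * p z k)\<bar> \<le> 2 * q * (p i j / (p z i * p z j))"
        using le q qle pos I nonneg by (intro T_relation_near) auto
      then show "\<bar>p i k / (p z i * p z k) - p j k / (p z j * p z k)\<bar> \<le> 2 * q * (p i j / (p z i * p z j))"
        by (simp only: abs_minus_commute)
    qed simp_all
    finally show "bform I p v v \<le> 0" by simp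
  qed
qed

section \<open>Mixed derivatives of Lorentzian forms\<close>

text \<open>
  For a nonnegative form the right-hand side is a Dirichlet energy: this replaces the Perron-Frobenius
  theorem in what follows.
\<close>

lemma dirichlet_identity:
  fixes q :: "'a \<Rightarrow> 'a \<Rightarrow> real"
  assumes sym: "sym_on I q" and a: "\<And>i. i \<in> I \<Longrightarrow> a i \<noteq> 0"
  shows "2 * ((\<Sum>i\<in>I. (\<Sum>j\<in>I. q i j * a j) / a i * (x i)\<^sup>2) - bform I q x x)
       = (\<Sum>i\<in>I. \<Sum>j\<in>I. q i j * a i * a j * (x i / a i - x j / a j)\<^sup>2)"
proof -
  define E where "E = (\<Sum>i\<in>I. (\<Sum>j\<in>I. q i j * a j) / a i * (x i)\<^sup>2)"
  have E1: "E = (\<Sum>i\<in>I. \<Sum>j\<in>I. q i j * a j / a i * (x i)\<^sup>2)"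
    by (simp add: E_def sum_distrib_right sum_divide_distrib)
  also have "\<dots> = (\<Sum>j\<in>I. \<Sum>i\<in>I. q i j * a j / a i * (x i)\<^sup>2)" by (rule sum.swap)
  also have "\<dots> = (\<Sum>i\<in>I. \<Sum>j\<in>I. q i j * a i / a j * (x j)\<^sup>2)"
    by (intro sum.cong refl) (use sym in \<open>unfold sym_on_def, auto\<close>)
  finally have E2: "E = (\<Sum>i\<in>I. \<Sum>j\<in>I. q i j * a i / a j * (x j)\<^sup>2)" .
  have "(\<Sum>i\<in>I. \<Sum>j\<in>I. q i j * a i * a j * (x i / a i - x j / a j)\<^sup>2)
      = (\<Sum>i\<in>I. \<Sum>j\<in>I. q i j * a j / a i * (x i)\<^sup>2 + q i j * a i / a j * (x j)\<^sup>2 - 2 * (x i * x j * q i j))"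
  proof (intro sum.cong refl)
    fix i j assume "i \<in> I" "j \<in> I"
    then show "q i j * a i * a j * (x i / a i - x j / a j)\<^sup>2
        = q i j * a j / a i * (x i)\<^sup>2 + q i j * a i / a j * (x j)\<^sup>2 - 2 * (x i * x j * q i j)"
      using a[of i] a[of j] by (simp add: field_simps power2_eq_square)
  qed
  also have "\<dots> = E + E - 2 * bform I q x x"
    by (simp only: sum.distrib sum_subtractf bform_def E1[symmetric] E2[symmetric] sum_distrib_left[symmetric])
  finally show ?thesis by (simp add: E_def)
qed

text \<open>
  The induction step for mixed derivatives, by the Bochner method of Shenfeld and van Handel.  After
  rescaling by \<open>w\<close>, every eigenvalue \<open>\<lambda>\<close> of \<open>q\<close> satisfies \<open>\<lambda> \<le> \<lambda>\<^sup>2\<close>, because the slices \<open>T i\<close> satisfy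
  the reversed Cauchy-Schwarz inequality, and \<open>\<lambda> \<le> 1\<close>, by the Dirichlet identity.  Hence \<open>\<lambda> \<le> 0\<close> or
  \<open>\<lambda> = 1\<close>, and connectedness makes the eigenvectors for \<open>1\<close> correspond to multiples of \<open>a\<close> on the nonzero
  rows.  So the form is nonpositive on the complement of \<open>a\<close> with respect to \<open>q\<close>.
\<close>

theorem contraction_lorentzian:
  fixes T :: "nat \<Rightarrow> nat \<Rightarrow> nat \<Rightarrow> real"
  assumes I_def: "I = {1..n}"
    and nonneg: "\<And>i j k. i \<in> I \<Longrightarrow> j \<in> I \<Longrightarrow> k \<in> I \<Longrightarrow> 0 \<le> T i j k"
    and sym1: "\<And>i j k. T i j k = T j i k" and sym2: "\<And>i j k. T i j k = T i k j"
    and slices: "\<And>i. i \<in> I \<Longrightarrow> lorentz_form I (T i)"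
    and a: "\<And>i. i \<in> I \<Longrightarrow> 0 < a i"
    and q: "\<And>j k. q j k = (\<Sum>i\<in>I. a i * T i j k)"
    and connected: "\<And>i j. i \<in> I \<Longrightarrow> j \<in> I \<Longrightarrow> i \<noteq> j \<Longrightarrow> \<exists>k\<in>I. 0 < q i k \<Longrightarrow> \<exists>k\<in>I. 0 < q j k \<Longrightarrow>
           0 < q i j \<or> (\<exists>k\<in>I. 0 < q i k \<and> 0 < q k j)"
  shows "lorentz_form I q"
proof -
  have fin: "finite I" by (simp add: I_def)
  have a0: "0 \<le> a i" if "i \<in> I" for i using a[OF that] by simp
  have q_sym: "q i j = q j i" for i j unfolding q by (subst sym2) simp
  have sym: "sym_on I q" unfolding sym_on_def using q_sym by blast
  have q0: "0 \<le> q i j" if "i \<in> I" "j \<in> I" for i j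
    unfolding q using that nonneg a by (intro sum_nonneg mult_nonneg_nonneg) (auto intro: less_imp_le)
  define d where "d i = (\<Sum>j\<in>I. q i j * a j)" for i
  have d0: "0 \<le> d i" if "i \<in> I" for i
    unfolding d_def using that q0 a by (intro sum_nonneg mult_nonneg_nonneg) (auto intro: less_imp_le)
  have d_pos_iff: "0 < d i \<longleftrightarrow> (\<exists>k\<in>I. 0 < q i k)" if i: "i \<in> I" for i
  proof
    assume "0 < d i"
    then obtain k where "k \<in> I" "q i k * a k \<noteq> 0" unfolding d_def
      by (metis (no_types, lifting) less_irrefl sum.neutral)
    then show "\<exists>k\<in>I. 0 < q i k" using q0[OF i, of k] by (intro bexI[of _ k]) auto
  next
    assume "\<exists>k\<in>I. 0 < q i k"
    then obtain k where k: "k \<in> I" "0 < q i k" by blast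
    show "0 < d i" unfolding d_def
    proof (rule sum_pos2[OF fin k(1)])
      show "0 < q i k * a k" using k a by simp
      show "0 \<le> q i j * a j" if "j \<in> I" for j using q0[OF i that] a[OF that] by simp
    qed
  qed
  \<comment> \<open>Indices with \<open>d i = 0\<close> have a zero row; any positive weight will do for them.\<close>
  define w where "w i = (if d i = 0 then 1 else d i / a i)" for i
  have w: "0 < w i" if "i \<in> I" for i using d0[OF that] a[OF that] by (auto simp: w_def less_le)
  define r where "r i = sqrt (w i)" for i
  have r: "0 < r i" "r i * r i = w i" if "i \<in> I" for i using w[OF that] by (auto simp: r_def)
  define S where "S i j = q i j / (r i * r j)" for i j
  have "sym_on {1..n} S" unfolding sym_on_def S_def using q_sym by (simp add: mult.commute)
  then obtain u l where diag: "diagonalises n S u l"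
    using symmetric_form_diagonalisation by blast
  have orth: "(\<Sum>i\<in>I. u k i * u m i) = (if k = m then 1 else 0)" if "k < n" "m < n" for k m
    using diag that unfolding diagonalises_def I_def by blast
  have Sd: "S i j = (\<Sum>k<n. l k * (u k i * u k j))" if "i \<in> I" "j \<in> I" for i j
    using diag that unfolding diagonalises_def I_def by blast
  have qS: "q i j = S i j * (r i * r j)" if "i \<in> I" "j \<in> I" for i j
    using r[OF that(1)] r[OF that(2)] by (simp add: S_def)
  have quad: "bform I q v v = (\<Sum>k<n. l k * (\<Sum>i\<in>I. u k i * (r i * v i))\<^sup>2)" for v
  proof -
    have "bform I q v v = bform I S (\<lambda>i. r i * v i) (\<lambda>i. r i * v i)"
      unfolding bform_def by (intro sum.cong refl) (simp add: qS mult_ac)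
    also have "\<dots> = (\<Sum>k<n. l k * ((\<Sum>i\<in>I. u k i * (r i * v i)) * (\<Sum>i\<in>I. u k i * (r i * v i))))"
      by (rule bform_diagonalised) (rule Sd)
    finally show ?thesis by (simp add: power2_eq_square)
  qed
  define L where "L v = (\<Sum>i\<in>I. d i * v i)" for v
  have key: "l k \<le> 0 \<or> (\<forall>v. L v = 0 \<longrightarrow> (\<Sum>i\<in>I. u k i * (r i * v i)) = 0)" if k: "k < n" for k
  proof -
    define x where "x i = u k i / r i" for i
    have ux: "u k i = r i * x i" if "i \<in> I" for i using r[OF that] by (simp add: x_def)
    have eig: "(\<Sum>j\<in>I. q i j * x j) = l k * w i * x i" if i: "i \<in> I" for i
    proof -
      have "(\<Sum>j\<in>I. q i j * x j) = r i * (\<Sum>j\<in>I. S i j * u k j)"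
        unfolding sum_distrib_left by (intro sum.cong refl) (simp add: qS i ux)
      also have "(\<Sum>j\<in>I. S i j * u k j) = (\<Sum>j\<in>I. \<Sum>m<n. l m * u m i * (u m j * u k j))"
      proof (rule sum.cong[OF refl])
        fix j assume j: "j \<in> I"
        show "S i j * u k j = (\<Sum>m<n. l m * u m i * (u m j * u k j))"
          unfolding Sd[OF i j] sum_distrib_right by (simp only: mult.assoc)
      qed
      also have "\<dots> = (\<Sum>m<n. \<Sum>j\<in>I. l m * u m i * (u m j * u k j))" by (rule sum.swap)
      also have "\<dots> = (\<Sum>m<n. l m * u m i * (if m = k then 1 else 0))"
        by (intro sum.cong refl) (simp add: orth k flip: sum_distrib_left)
      also have "\<dots> = (\<Sum>m<n. if m = k then l k * u k i else 0)"
        by (intro sum.cong refl) auto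
      also have "\<dots> = l k * u k i" using k by simp
      finally show ?thesis using r(2)[OF i] ux[OF i] by (simp add: mult_ac) 
    qed
    have norm1: "(\<Sum>i\<in>I. w i * (x i)\<^sup>2) = 1"
    proof -
      have "(\<Sum>i\<in>I. w i * (x i)\<^sup>2) = (\<Sum>i\<in>I. u k i * u k i)"
        by (intro sum.cong refl) (simp add: ux r(2)[symmetric] power2_eq_square mult_ac)
      then show ?thesis using orth[OF k k] by simp
    qed
    have qxx: "bform I q x x = l k"
    proof -
      have "bform I q x x = (\<Sum>i\<in>I. x i * (\<Sum>j\<in>I. q i j * x j))"
        unfolding bform_def by (simp add: sum_distrib_left mult_ac)
      also have "\<dots> = (\<Sum>i\<in>I. l k * (w i * (x i)\<^sup>2))"
      proof (rule sum.cong[OF refl])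
        fix i assume i: "i \<in> I"
        show "x i * (\<Sum>j\<in>I. q i j * x j) = l k * (w i * (x i)\<^sup>2)"
          unfolding eig[OF i] by (simp add: power2_eq_square)
      qed
      finally show ?thesis by (simp add: norm1 flip: sum_distrib_left)
    qed
    have qTx: "(\<Sum>j\<in>I. q i j * y j) = bform I (T i) a y" for i y
    proof -
      have "(\<Sum>j\<in>I. q i j * y j) = (\<Sum>j\<in>I. \<Sum>m\<in>I. a m * y j * T m i j)"
        unfolding q by (simp add: sum_distrib_right sum_distrib_left mult_ac)
      also have "\<dots> = (\<Sum>m\<in>I. \<Sum>j\<in>I. a m * y j * T m i j)" by (rule sum.swap)
      finally show ?thesis unfolding bform_def by (simp add: sym1[of _ i])
    qed
    have local: "a i * bform I (T i) x x \<le> (l k)\<^sup>2 * (w i * (x i)\<^sup>2)" if i: "i \<in> I" for i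
    proof (cases "d i = 0")
      case True
      have "T i j m = 0" if "j \<in> I" "m \<in> I" for j m
      proof -
        have "q i m * a m = 0"
          using True that(2) q0[OF i] a0 fin unfolding d_def
          by (subst (asm) sum_nonneg_eq_0_iff) auto
        then have "q i m = 0" using a[OF that(2)] by simp
        then have "a j * T j i m = 0"
          using that nonneg i a0 fin unfolding q
          by (subst (asm) sum_nonneg_eq_0_iff) auto
        then show ?thesis using a[OF that(1)] sym1[of i j m] by simp
      qed
      then have "bform I (T i) x x = 0" unfolding bform_def by simp
      then show ?thesis using w[OF i] by simp
    next
      case False
      then have dw: "d i = w i * a i" using a[OF i] by (simp add: w_def)
      have "bform I (T i) a a * bform I (T i) x x \<le> (bform I (T i) a x)\<^sup>2"
        using slices[OF i] a unfolding lorentz_form_def by (simp add: less_imp_le)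
      then have "d i * bform I (T i) x x \<le> (l k * w i * x i)\<^sup>2"
        unfolding qTx[symmetric] eig[OF i] d_def .
      then have "w i * (a i * bform I (T i) x x) \<le> w i * ((l k)\<^sup>2 * (w i * (x i)\<^sup>2))"
        unfolding dw by (simp add: power2_eq_square mult_ac)
      then show ?thesis using w[OF i] by simp
    qed
    have "l k = (\<Sum>i\<in>I. a i * bform I (T i) x x)"
    proof -
      have "bform I q x x = (\<Sum>i\<in>I. \<Sum>j\<in>I. \<Sum>m\<in>I. a m * (x i * x j * T m i j))"
        unfolding bform_def q by (simp add: sum_distrib_left mult_ac)
      also have "\<dots> = (\<Sum>i\<in>I. \<Sum>m\<in>I. \<Sum>j\<in>I. a m * (x i * x j * T m i j))"
        by (intro sum.cong refl sum.swap)
      also have "\<dots> = (\<Sum>m\<in>I. \<Sum>i\<in>I. \<Sum>j\<in>I. a m * (x i * x j * T m i j))"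
        by (rule sum.swap)
      finally show ?thesis using qxx unfolding bform_def by (simp add: sum_distrib_left)
    qed
    also have "\<dots> \<le> (\<Sum>i\<in>I. (l k)\<^sup>2 * (w i * (x i)\<^sup>2))" by (intro sum_mono local)
    also have "\<dots> = (l k)\<^sup>2" by (simp add: norm1 flip: sum_distrib_left)
    finally have bochner: "l k \<le> (l k)\<^sup>2" .
    define E where "E = (\<Sum>i\<in>I. d i / a i * (x i)\<^sup>2)"
    define G where "G = (\<Sum>i\<in>I. \<Sum>j\<in>I. q i j * a i * a j * (x i / a i - x j / a j)\<^sup>2)"
    have "a i \<noteq> 0" if "i \<in> I" for i using a[OF that] by simp
    then have EG: "2 * (E - l k) = G"
      using dirichlet_identity[OF sym, of a x] unfolding E_def G_def d_def qxx by blast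
    have Gterm: "0 \<le> q i j * a i * a j * (x i / a i - x j / a j)\<^sup>2" if "i \<in> I" "j \<in> I" for i j
      using q0[OF that] a[OF that(1)] a[OF that(2)] by simp
    have G0: "0 \<le> G" unfolding G_def by (intro sum_nonneg Gterm)
    have wd: "d i / a i * (x i)\<^sup>2 \<le> w i * (x i)\<^sup>2" if "i \<in> I" for i by (simp add: w_def)
    have E1: "E \<le> 1" unfolding E_def norm1[symmetric] by (intro sum_mono wd)
    show ?thesis
    proof (cases "l k \<le> 0")
      case False
      then have "1 \<le> l k" using bochner by (simp add: power2_eq_square)
      have EQ: "E = 1" "G = 0" using \<open>1 \<le> l k\<close> EG G0 E1 by simp_all
      have flat: "x i / a i = x j / a j" if ij: "i \<in> I" "j \<in> I" "0 < q i j" for i j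
      proof -
        have "(\<Sum>j\<in>I. q i j * a i * a j * (x i / a i - x j / a j)\<^sup>2) = 0"
          using EQ(2) unfolding G_def using fin ij(1)
          by (subst (asm) sum_nonneg_eq_0_iff) (auto intro!: sum_nonneg Gterm)
        then have "q i j * a i * a j * (x i / a i - x j / a j)\<^sup>2 = 0"
          using fin ij by (subst (asm) sum_nonneg_eq_0_iff) (auto intro!: Gterm)
        then show ?thesis using ij(3) a[OF ij(1)] a[OF ij(2)] by simp
      qed
      have const: "x i / a i = x j / a j" if ij: "i \<in> I" "j \<in> I" "0 < d i" "0 < d j" for i j
      proof (cases "i = j \<or> 0 < q i j")
        case True then show ?thesis using flat ij by blast
      next
        case False
        then obtain m where "m \<in> I" "0 < q i m" "0 < q m j"
          using connected[OF ij(1,2)] ij d_pos_iff by blast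
        then show ?thesis using flat[OF ij(1), of m] flat[OF _ ij(2), of m] by simp
      qed
      obtain \<gamma> where \<gamma>: "x i = \<gamma> * a i" if "i \<in> I" "0 < d i" for i
      proof (cases "\<exists>i\<in>I. 0 < d i")
        case True
        then obtain i0 where i0: "i0 \<in> I" "0 < d i0" by blast
        show thesis
        proof (rule that[of "x i0 / a i0"])
          fix i assume i: "i \<in> I" "0 < d i"
          have "x i / a i = x i0 / a i0" by (rule const[OF i(1) i0(1) i(2) i0(2)])
          then show "x i = x i0 / a i0 * a i" using a[OF i(1)] by (simp add: field_simps)
        qed
      next
        case False then show thesis using that by blast
      qed
      have zero: "x i = 0" if i: "i \<in> I" "d i = 0" for i
      proof -
        have "(\<Sum>i\<in>I. w i * (x i)\<^sup>2 - d i / a i * (x i)\<^sup>2) = 0"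
          unfolding sum_subtractf norm1 using EQ(1) unfolding E_def by simp
        then have "w i * (x i)\<^sup>2 - d i / a i * (x i)\<^sup>2 = 0"
          using fin i wd by (subst (asm) sum_nonneg_eq_0_iff) auto
        then show ?thesis using i by (simp add: w_def)
      qed
      have "u k i * (r i * v i) = \<gamma> * (d i * v i)" if i: "i \<in> I" for i v
      proof (cases "d i = 0")
        case True then show ?thesis using zero[OF i] ux[OF i] by simp
      next
        case False
        then have "0 < d i" using d0[OF i] by simp
        then have "u k i * (r i * v i) = (r i * r i) * (\<gamma> * a i) * v i" using ux[OF i] \<gamma>[OF i] by simp
        also have "\<dots> = \<gamma> * (d i * v i)" using False a[OF i] r(2)[OF i] by (simp add: w_def)
        finally show ?thesis .
      qed
      then have "(\<Sum>i\<in>I. u k i * (r i * v i)) = \<gamma> * L v" for v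
        unfolding L_def sum_distrib_left by (intro sum.cong refl) blast
      then show ?thesis by simp
    qed simp
  qed
  show ?thesis
  proof (rule lorentz_formI[OF sym _ _ q0])
    show "linear_functional L" unfolding L_def by (rule linear_functional_sum)
    fix v assume "L v = 0"
    then show "bform I q v v \<le> 0"
      unfolding quad using key by (intro sum_nonpos) (force simp: mult_nonpos_nonneg)
  qed
qed

text \<open>
  The directional derivative along \<open>a\<close>, on the level of the normalised coefficients \<open>c M\<close>, which are
  the derivatives at \<open>0\<close> indexed by multisets \<open>M\<close> of variables.
\<close>

definition dir_deriv :: "nat set \<Rightarrow> (nat \<Rightarrow> real) \<Rightarrow> (nat multiset \<Rightarrow> real) \<Rightarrow> (nat multiset \<Rightarrow> real)" where
  "dir_deriv I a c = (\<lambda>M. \<Sum>i\<in>I. a i * c (add_mset i M))"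

text \<open>
  The iterated derivative along \<open>a x\<close> for all \<open>x\<close> in the multiset \<open>K\<close>; the order does not matter since
  directional derivatives commute.
\<close>

definition dir_derivs ::
    "nat set \<Rightarrow> (nat \<Rightarrow> nat \<Rightarrow> real) \<Rightarrow> (nat multiset \<Rightarrow> real) \<Rightarrow> nat multiset \<Rightarrow> (nat multiset \<Rightarrow> real)" where
  "dir_derivs I a c K = fold_mset (\<lambda>x. dir_deriv I (a x)) c K"

lemma dir_deriv_commute: "dir_deriv I a (dir_deriv I b c) = dir_deriv I b (dir_deriv I a c)"
proof
  fix M
  have "dir_deriv I a (dir_deriv I b c) M = (\<Sum>i\<in>I. \<Sum>j\<in>I. a i * b j * c (add_mset j (add_mset i M)))"
    by (simp add: dir_deriv_def sum_distrib_left mult.assoc)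
  also have "\<dots> = (\<Sum>j\<in>I. \<Sum>i\<in>I. a i * b j * c (add_mset j (add_mset i M)))" by (rule sum.swap)
  also have "\<dots> = dir_deriv I b (dir_deriv I a c) M"
    by (simp add: dir_deriv_def sum_distrib_left add_mset_commute mult_ac)
  finally show "dir_deriv I a (dir_deriv I b c) M = dir_deriv I b (dir_deriv I a c) M" .
qed

interpretation dir_deriv_fold: comp_fun_commute "\<lambda>x. dir_deriv I (a x)" for I a
  by unfold_locales (simp add: fun_eq_iff dir_deriv_commute)

lemma dir_derivs_empty [simp]: "dir_derivs I a c {#} = c"
  by (simp add: dir_derivs_def)

lemma dir_derivs_add [simp]:
  "dir_derivs I a c (add_mset x K) = dir_deriv I (a x) (dir_derivs I a c K)"
  by (simp add: dir_derivs_def)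

lemma dir_derivs_contraction:
  "dir_derivs I a (\<lambda>N. c (add_mset x N)) K N = dir_derivs I a c K (add_mset x N)"
proof (induction K arbitrary: N)
  case (add y K)
  then show ?case by (simp add: dir_deriv_def add_mset_commute)
qed simp

lemma dir_derivs_nonneg:
  assumes "\<And>N. 0 \<le> c N" and "\<And>x i. i \<in> I \<Longrightarrow> 0 \<le> a x i"
  shows "0 \<le> dir_derivs I a c K N"
proof (induction K arbitrary: N)
  case (add y K)
  then show ?case using assms by (auto simp: dir_deriv_def intro!: sum_nonneg mult_nonneg_nonneg)
qed (simp add: assms)

lemma dir_derivs_pos_iff:
  assumes fin: "finite I" and c: "\<And>N. 0 \<le> c N" and a: "\<And>x i. i \<in> I \<Longrightarrow> 0 < a x i"
  shows "0 < dir_derivs I a c K N \<longleftrightarrow> (\<exists>M. size M = size K \<and> set_mset M \<subseteq> I \<and> 0 < c (M + N))"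
proof (induction K arbitrary: N)
  case (add y K)
  have nn: "0 \<le> dir_derivs I a c K N" for N
    using c a by (intro dir_derivs_nonneg) (auto intro: less_imp_le)
  have "0 < dir_derivs I a c (add_mset y K) N \<longleftrightarrow> (\<exists>i\<in>I. 0 < dir_derivs I a c K (add_mset i N))"
  proof
    assume "0 < dir_derivs I a c (add_mset y K) N"
    then obtain i where "i \<in> I" "a y i * dir_derivs I a c K (add_mset i N) \<noteq> 0"
      unfolding dir_derivs_add dir_deriv_def by (metis (no_types, lifting) less_irrefl sum.neutral)
    then show "\<exists>i\<in>I. 0 < dir_derivs I a c K (add_mset i N)"
      using nn[of "add_mset i N"] by (intro bexI[of _ i]) auto
  next
    assume "\<exists>i\<in>I. 0 < dir_derivs I a c K (add_mset i N)"
    then obtain i where i: "i \<in> I" "0 < dir_derivs I a c K (add_mset i N)" by blast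
    show "0 < dir_derivs I a c (add_mset y K) N"
      unfolding dir_derivs_add dir_deriv_def
    proof (rule sum_pos2[OF fin i(1)])
      show "0 < a y i * dir_derivs I a c K (add_mset i N)" using i a by simp
      show "0 \<le> a y j * dir_derivs I a c K (add_mset j N)" if "j \<in> I" for j
        using nn a[OF that] by (simp add: less_imp_le)
    qed
  qed
  also have "\<dots> \<longleftrightarrow> (\<exists>i\<in>I. \<exists>M. size M = size K \<and> set_mset M \<subseteq> I \<and> 0 < c (M + add_mset i N))"
    unfolding add.IH ..
  also have "\<dots> \<longleftrightarrow> (\<exists>M. size M = size (add_mset y K) \<and> set_mset M \<subseteq> I \<and> 0 < c (M + N))"
  proof
    assume "\<exists>i\<in>I. \<exists>M. size M = size K \<and> set_mset M \<subseteq> I \<and> 0 < c (M + add_mset i N)"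
    then obtain i M where "i \<in> I" "size M = size K" "set_mset M \<subseteq> I" "0 < c (M + add_mset i N)" by blast
    then show "\<exists>M. size M = size (add_mset y K) \<and> set_mset M \<subseteq> I \<and> 0 < c (M + N)"
      by (intro exI[of _ "add_mset i M"]) auto
  next
    assume "\<exists>M. size M = size (add_mset y K) \<and> set_mset M \<subseteq> I \<and> 0 < c (M + N)"
    then obtain M where M: "size M = Suc (size K)" "set_mset M \<subseteq> I" "0 < c (M + N)" by auto
    then obtain i M' where "M = add_mset i M'" by (metis size_eq_Suc_imp_eq_union)
    then show "\<exists>i\<in>I. \<exists>M. size M = size K \<and> set_mset M \<subseteq> I \<and> 0 < c (M + add_mset i N)"
      using M by (intro bexI[of _ i] exI[of _ M']) auto
  qed
  finally show ?case .
qed simp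

text \<open>
  The exchange axiom for M-convex sets, for exponent vectors written as multisets.  The empty set is
  M-convex here.
\<close>

definition M_convex :: "nat multiset set \<Rightarrow> bool" where
  "M_convex S \<longleftrightarrow> (\<forall>A\<in>S. \<forall>B\<in>S. \<forall>x. count B x < count A x \<longrightarrow>
     (\<exists>y. count A y < count B y \<and> add_mset y (A - {#x#}) \<in> S))"

lemma M_convex_contraction:
  assumes "M_convex S" shows "M_convex {N. add_mset i N \<in> S}"
  unfolding M_convex_def
proof (intro ballI allI impI)
  fix A B x assume A: "A \<in> {N. add_mset i N \<in> S}" and B: "B \<in> {N. add_mset i N \<in> S}"
    and less: "count B x < count A x"
  then have "count (add_mset i B) x < count (add_mset i A) x" by simp
  then obtain y where y: "count (add_mset i A) y < count (add_mset i B) y"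
      "add_mset y (add_mset i A - {#x#}) \<in> S"
    using assms A B unfolding M_convex_def by blast
  have "x \<in># A" using less by (metis count_greater_zero_iff gr_zeroI not_less_zero)
  then have "add_mset y (add_mset i A - {#x#}) = add_mset i (add_mset y (A - {#x#}))"
    by (cases "x = i") (auto simp: add_mset_commute)
  moreover have "count A y < count B y" using y(1) by (simp split: if_splits)
  ultimately show "\<exists>y. count A y < count B y \<and> add_mset y (A - {#x#}) \<in> {N. add_mset i N \<in> S}"
    using y(2) by (intro exI[of _ y]) (metis mem_Collect_eq)
qed

text \<open>
  Call two variables adjacent if they occur together in an element of \<open>S\<close>.  Then any two variables that
  occur at all are adjacent or have a common neighbour.
\<close>

lemma M_convex_connected:
  assumes S: "M_convex S" and size: "\<And>A. A \<in> S \<Longrightarrow> 2 \<le> size A"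
    and A: "A \<in> S" "i \<in># A" and B: "B \<in> S" "j \<in># B" and ij: "i \<noteq> j"
  shows "(\<exists>C\<in>S. i \<in># C \<and> j \<in># C) \<or>
    (\<exists>k. k \<noteq> i \<and> k \<noteq> j \<and> (\<exists>C\<in>S. i \<in># C \<and> k \<in># C) \<and> (\<exists>C\<in>S. k \<in># C \<and> j \<in># C))"
proof (cases "\<exists>C\<in>S. i \<in># C \<and> j \<in># C")
  case False
  then have jA: "j \<notin># A" and iB: "i \<notin># B" using A B by auto
  show ?thesis
  proof (cases "\<exists>x. count A x < count (B - {#j#}) x")
    case True
    then obtain x where x: "count A x < count (B - {#j#}) x" by blast
    then have "count A x < count B x" by (simp split: if_splits)
    then obtain y where y: "count B y < count A y" "add_mset y (B - {#x#}) \<in> S"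
      using S A(1) B(1) unfolding M_convex_def by blast
    have yA: "y \<in># A" using y(1) by (metis count_inI not_less_zero)
    have "0 < count (B - {#x#}) j"
    proof (cases "x = j")
      case True
      then show ?thesis using x by simp
    next
      case False
      then show ?thesis using B(2) by simp
    qed
    then have "j \<in># B - {#x#}" by (simp only: count_greater_zero_iff)
    then have jC: "j \<in># add_mset y (B - {#x#})" by simp
    then have "y \<noteq> i" using \<open>\<not> (\<exists>C\<in>S. i \<in># C \<and> j \<in># C)\<close> y(2) by auto
    moreover have "y \<noteq> j" using yA jA by auto
    moreover have "y \<in># add_mset y (B - {#x#})" by simp
    ultimately show ?thesis using A yA y(2) jC by blast
  next
    case False
    then have sub: "count (B - {#j#}) x \<le> count A x" for x by (auto simp: not_less)
    have "size (B - {#j#}) \<noteq> 0" using size[OF B(1)] B(2) by (simp add: size_Diff_singleton)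
    then obtain k where k: "k \<in># B - {#j#}" by (metis multiset_nonemptyE size_empty)
    then have "k \<in># B" by (rule in_diffD)
    moreover have kA: "k \<in># A" using sub[of k] k by (metis count_greater_zero_iff le_zero_eq not_gr_zero)
    moreover have "k \<noteq> i" "k \<noteq> j" using \<open>k \<in># B\<close> iB kA jA by auto
    ultimately show ?thesis using A B by (intro disjI2 exI[of _ k]) auto
  qed
qed simp

text \<open>
  If all coordinate derivatives of order \<open>d - 2\<close> are Lorentzian forms and the support is M-convex,
  then so are all derivatives of order \<open>d - 2\<close> along strictly positive vectors.
\<close>

theorem dir_derivs_lorentzian:
  fixes c :: "nat multiset \<Rightarrow> real"
  assumes I: "I = {1..n}" and a: "\<And>x i. i \<in> I \<Longrightarrow> 0 < a x i"
    and "\<And>N. 0 \<le> c N" and "M_convex {N. c N \<noteq> 0}"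
    and "\<And>N. c N \<noteq> 0 \<Longrightarrow> size N = size K + 2 \<and> set_mset N \<subseteq> I"
    and "\<And>M. size M = size K \<Longrightarrow> set_mset M \<subseteq> I \<Longrightarrow>
           lorentz_form I (\<lambda>i j. c (add_mset i (add_mset j M)))"
  shows "lorentz_form I (\<lambda>i j. dir_derivs I a c K {#i, j#})"
  using assms(3-6)
proof (induction K arbitrary: c)
  case empty
  then show ?case by simp
next
  case (add x K c)
  have fin: "finite I" using I by simp
  have a0: "0 \<le> a x i" if "i \<in> I" for x i using a[OF that, of x] by simp
  define T where "T i j k = dir_derivs I a c K {#i, j, k#}" for i j k
  have q: "dir_derivs I a c (add_mset x K) {#j, k#} = (\<Sum>i\<in>I. a x i * T i j k)" for j k
    by (simp add: dir_deriv_def T_def)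
  have q_pos: "0 < dir_derivs I a c (add_mset x K) {#i, j#} \<longleftrightarrow> (\<exists>C. c C \<noteq> 0 \<and> i \<in># C \<and> j \<in># C)"
    if ij: "i \<noteq> j" for i j
  proof -
    have "0 < dir_derivs I a c (add_mset x K) {#i, j#} \<longleftrightarrow>
      (\<exists>M. size M = size (add_mset x K) \<and> set_mset M \<subseteq> I \<and> 0 < c (M + {#i, j#}))"
      by (rule dir_derivs_pos_iff[OF fin add.prems(1) a])
    also have "\<dots> \<longleftrightarrow> (\<exists>C. c C \<noteq> 0 \<and> i \<in># C \<and> j \<in># C)"
    proof
      assume "\<exists>M. size M = size (add_mset x K) \<and> set_mset M \<subseteq> I \<and> 0 < c (M + {#i, j#})"
      then obtain M where "0 < c (M + {#i, j#})" by blast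
      then show "\<exists>C. c C \<noteq> 0 \<and> i \<in># C \<and> j \<in># C"
        by (intro exI[of _ "M + {#i, j#}"]) auto
    next
      assume "\<exists>C. c C \<noteq> 0 \<and> i \<in># C \<and> j \<in># C"
      then obtain C where C: "c C \<noteq> 0" "i \<in># C" "j \<in># C" by blast
      then obtain C1 where "C = add_mset i C1" by (meson multi_member_split)
      moreover with C(3) ij obtain C2 where "C1 = add_mset j C2" by (auto dest: multi_member_split)
      ultimately have CM: "C = C2 + {#i, j#}" by simp
      then have "size C2 = size (add_mset x K)" "set_mset C2 \<subseteq> I"
        using add.prems(3)[OF C(1)] by auto
      moreover have "0 < c (C2 + {#i, j#})" using C(1) CM add.prems(1)[of C] by simp
      ultimately show "\<exists>M. size M = size (add_mset x K) \<and> set_mset M \<subseteq> I \<and> 0 < c (M + {#i, j#})"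
        by blast
    qed
    finally show ?thesis .
  qed
  have q_posD: "\<exists>C. c C \<noteq> 0 \<and> i \<in># C" if pos: "0 < dir_derivs I a c (add_mset x K) {#i, k#}" for i k
  proof -
    obtain M where "0 < c (M + {#i, k#})"
      using iffD1[OF dir_derivs_pos_iff[OF fin add.prems(1) a] pos] by blast
    then show ?thesis by (intro exI[of _ "M + {#i, k#}"]) auto
  qed
  have "lorentz_form I (\<lambda>j k. dir_derivs I a c (add_mset x K) {#j, k#})"
  proof (rule contraction_lorentzian[OF I, of T "a x"])
    show "0 \<le> T i j k" for i j k
      unfolding T_def by (rule dir_derivs_nonneg) (use add.prems(1) a0 in auto)
    show "T i j k = T j i k" "T i j k = T i k j" for i j k
      by (simp_all add: T_def add_mset_commute)
    show "0 < a x i" if "i \<in> I" for i by (rule a[OF that])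
    show "dir_derivs I a c (add_mset x K) {#j, k#} = (\<Sum>i\<in>I. a x i * T i j k)" for j k by (rule q)
    show "lorentz_form I (T i)" if i: "i \<in> I" for i
    proof -
      have "lorentz_form I (\<lambda>j k. dir_derivs I a (\<lambda>N. c (add_mset i N)) K {#j, k#})"
      proof (rule add.IH)
        show "0 \<le> c (add_mset i N)" for N by (rule add.prems(1))
        show "M_convex {N. c (add_mset i N) \<noteq> 0}"
          using M_convex_contraction[OF add.prems(2), of i] by simp
        show "size N = size K + 2 \<and> set_mset N \<subseteq> I" if "c (add_mset i N) \<noteq> 0" for N
          using add.prems(3)[OF that] by auto
        show "lorentz_form I (\<lambda>j k. c (add_mset i (add_mset j (add_mset k M))))"
          if "size M = size K" "set_mset M \<subseteq> I" for M
          using add.prems(4)[of "add_mset i M"] that i by (simp add: add_mset_commute)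
      qed
      then show ?thesis unfolding dir_derivs_contraction T_def .
    qed
    fix i j assume ij: "i \<in> I" "j \<in> I" "i \<noteq> j"
      and "\<exists>k\<in>I. 0 < dir_derivs I a c (add_mset x K) {#i, k#}"
      and "\<exists>k\<in>I. 0 < dir_derivs I a c (add_mset x K) {#j, k#}"
    then obtain A B where AB: "c A \<noteq> 0" "i \<in># A" "c B \<noteq> 0" "j \<in># B" using q_posD by blast
    have "2 \<le> size N" if "N \<in> {N. c N \<noteq> 0}" for N using add.prems(3)[of N] that by simp
    from M_convex_connected[OF add.prems(2) this _ AB(2) _ AB(4) ij(3)] AB
    consider "\<exists>C. c C \<noteq> 0 \<and> i \<in># C \<and> j \<in># C"
      | k where "k \<noteq> i" "k \<noteq> j" "\<exists>C. c C \<noteq> 0 \<and> i \<in># C \<and> k \<in># C" "\<exists>C. c C \<noteq> 0 \<and> k \<in># C \<and> j \<in># C"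
      by auto
    then show "0 < dir_derivs I a c (add_mset x K) {#i, j#} \<or>
      (\<exists>k\<in>I. 0 < dir_derivs I a c (add_mset x K) {#i, k#} \<and> 0 < dir_derivs I a c (add_mset x K) {#k, j#})"
    proof cases
      case 1
      then show ?thesis using q_pos[OF ij(3)] by blast
    next
      case (2 k)
      then have "k \<in> I" using add.prems(3) by blast
      then show ?thesis using 2 q_pos[of i k] q_pos[of k j] by blast
    qed
  qed
  then show ?case .
qed

section \<open>Exponents, normalised coefficients and Hessians\<close>

text \<open>Exponent vectors and finite multisets of variables are the same thing; the two translations follow.\<close>

definition expo_of :: "nat multiset \<Rightarrow> expo" where
  "expo_of M = (\<Sum>i\<in>#M. unit_expo i)"

definition mset_of :: "expo \<Rightarrow> nat multiset" where
  "mset_of \<alpha> = (\<Sum>i\<in>Poly_Mapping.keys \<alpha>. replicate_mset (Poly_Mapping.lookup \<alpha> i) i)"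

lemma expo_of_add [simp]: "expo_of (add_mset i M) = unit_expo i + expo_of M"
  by (simp add: expo_of_def)

lemma lookup_expo_of [simp]: "Poly_Mapping.lookup (expo_of M) i = count M i"
  by (induction M) (auto simp: expo_of_def lookup_add lookup_single when_def)

lemma count_mset_of [simp]: "count (mset_of \<alpha>) i = Poly_Mapping.lookup \<alpha> i"
proof -
  have "count (mset_of \<alpha>) i = (\<Sum>j\<in>Poly_Mapping.keys \<alpha>. if i = j then Poly_Mapping.lookup \<alpha> j else 0)"
    by (simp add: mset_of_def count_sum)
  also have "\<dots> = Poly_Mapping.lookup \<alpha> i" by (simp add: in_keys_iff)
  finally show ?thesis .
qed

lemma expo_of_mset_of [simp]: "expo_of (mset_of \<alpha>) = \<alpha>"
  by (rule poly_mapping_eqI) simp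

lemma mset_of_expo_of [simp]: "mset_of (expo_of M) = M"
  by (rule multiset_eqI) simp

lemma mset_of_add_unit [simp]: "mset_of (\<alpha> + unit_expo i) = add_mset i (mset_of \<alpha>)"
  by (rule multiset_eqI) (simp add: lookup_add lookup_single when_def)

lemma mset_of_add_single_Suc_0 [simp]:
  "mset_of (\<alpha> + Poly_Mapping.single i (Suc 0)) = add_mset i (mset_of \<alpha>)"
  using mset_of_add_unit[of \<alpha> i] by simp

lemma keys_expo_of [simp]: "Poly_Mapping.keys (expo_of M) = set_mset M"
  by (auto simp: in_keys_iff)

lemma expo_of_in_simplex [simp]: "expo_of M \<in> simplex n d \<longleftrightarrow> set_mset M \<subseteq> {1..n} \<and> size M = d"
proof -
  have "(\<Sum>i\<in>{1..n}. count M i) = size M" if "set_mset M \<subseteq> {1..n}"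
    unfolding size_multiset_overloaded_eq using that
    by (intro sum.mono_neutral_right) (auto simp: not_in_iff)
  then show ?thesis unfolding simplex_def by auto
qed

lemma in_simplex_iff: "\<alpha> \<in> simplex n d \<longleftrightarrow> set_mset (mset_of \<alpha>) \<subseteq> {1..n} \<and> size (mset_of \<alpha>) = d"
  using expo_of_in_simplex[of "mset_of \<alpha>"] by simp

lemma finite_simplex [simp]: "finite (simplex n d)"
proof -
  have "simplex n d \<subseteq> (\<lambda>xs. expo_of (mset xs)) ` {xs. set xs \<subseteq> {1..n} \<and> length xs = d}"
  proof
    fix \<alpha> assume \<alpha>: "\<alpha> \<in> simplex n d"
    obtain xs where xs: "mset xs = mset_of \<alpha>" using ex_mset by blast
    then have "set xs \<subseteq> {1..n}" "length xs = d"
      using \<alpha> unfolding in_simplex_iff by (metis set_mset_mset, metis size_mset)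
    moreover have "\<alpha> = expo_of (mset xs)" using xs by simp
    ultimately show "\<alpha> \<in> (\<lambda>xs. expo_of (mset xs)) ` {xs. set xs \<subseteq> {1..n} \<and> length xs = d}" by blast
  qed
  then show ?thesis using finite_lists_length_eq[of "{1..n}" d] finite_subset by fastforce
qed

text \<open>The factor \<open>\<beta>!\<close> for exponents with keys in \<open>{1..n}\<close>.\<close>

definition expo_fact :: "nat \<Rightarrow> expo \<Rightarrow> real" where
  "expo_fact n \<beta> = (\<Prod>i\<in>{1..n}. fact (Poly_Mapping.lookup \<beta> i))"

text \<open>The normalised coefficient \<open>\<beta>! f\<^sub>\<beta>\<close>; differentiation only shifts its index.\<close>

definition ncoeff :: "nat \<Rightarrow> rpoly \<Rightarrow> expo \<Rightarrow> real" where
  "ncoeff n f \<beta> = expo_fact n \<beta> * Poly_Mapping.lookup f \<beta>"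

lemma expo_fact_pos [simp]: "0 < expo_fact n \<beta>"
  unfolding expo_fact_def by (intro prod_pos) simp

lemma expo_fact_zero [simp]: "expo_fact n 0 = 1"
  by (simp add: expo_fact_def)

lemma lookup_partial_deriv:
  "Poly_Mapping.lookup (partial_deriv i f) \<beta>
     = real (Suc (Poly_Mapping.lookup \<beta> i)) * Poly_Mapping.lookup f (\<beta> + unit_expo i)"
proof -
  let ?b = "\<beta> + unit_expo i"
  have eq: "\<alpha> = ?b" if "\<alpha> - unit_expo i = \<beta>" "Poly_Mapping.lookup \<alpha> i \<noteq> 0" for \<alpha>
    by (rule poly_mapping_eqI) (use that in \<open>auto simp: lookup_add lookup_minus lookup_single when_def\<close>)
  have "Poly_Mapping.lookup (partial_deriv i f) \<beta>
      = (\<Sum>\<alpha>\<in>Poly_Mapping.keys f. if \<alpha> - unit_expo i = \<beta>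
           then real (Poly_Mapping.lookup \<alpha> i) * Poly_Mapping.lookup f \<alpha> else 0)"
    unfolding partial_deriv_def lookup_sum
    by (intro sum.cong refl) (auto simp: lookup_single when_def)
  also have "\<dots> = (\<Sum>\<alpha>\<in>Poly_Mapping.keys f. if \<alpha> = ?b
           then real (Poly_Mapping.lookup ?b i) * Poly_Mapping.lookup f ?b else 0)"
  proof (intro sum.cong refl)
    fix \<alpha> assume "\<alpha> \<in> Poly_Mapping.keys f"
    show "(if \<alpha> - unit_expo i = \<beta> then real (Poly_Mapping.lookup \<alpha> i) * Poly_Mapping.lookup f \<alpha> else 0)
        = (if \<alpha> = ?b then real (Poly_Mapping.lookup ?b i) * Poly_Mapping.lookup f ?b else 0)"
    proof (cases "\<alpha> = ?b")
      case True
      then show ?thesis by simp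
    next
      case False
      then show ?thesis using eq[of \<alpha>] by auto
    qed
  qed
  also have "\<dots> = real (Poly_Mapping.lookup ?b i) * Poly_Mapping.lookup f ?b"
    by (simp add: in_keys_iff)
  finally show ?thesis by (simp add: lookup_add)
qed

lemma expo_fact_add_unit:
  assumes "i \<in> {1..n}"
  shows "expo_fact n (\<beta> + unit_expo i) = real (Suc (Poly_Mapping.lookup \<beta> i)) * expo_fact n \<beta>"
proof -
  have "expo_fact n (\<beta> + unit_expo i)
      = fact (Suc (Poly_Mapping.lookup \<beta> i)) * (\<Prod>j\<in>{1..n} - {i}. fact (Poly_Mapping.lookup \<beta> j))"
    unfolding expo_fact_def using assms
    by (subst prod.remove[of _ i]) (auto simp: lookup_add lookup_single when_def intro!: prod.cong)
  also have "\<dots> = real (Suc (Poly_Mapping.lookup \<beta> i)) * expo_fact n \<beta>"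
    unfolding expo_fact_def using assms by (subst (2) prod.remove[of _ i]) auto
  finally show ?thesis .
qed

lemma ncoeff_partial_deriv:
  assumes "i \<in> {1..n}"
  shows "ncoeff n (partial_deriv i f) \<beta> = ncoeff n f (\<beta> + unit_expo i)"
  unfolding ncoeff_def lookup_partial_deriv expo_fact_add_unit[OF assms] by simp

lemma ncoeff_partial_deriv_power:
  assumes "i \<in> {1..n}"
  shows "ncoeff n ((partial_deriv i ^^ k) f) \<beta> = ncoeff n f (\<beta> + Poly_Mapping.single i k)"
proof (induction k arbitrary: \<beta>)
  case (Suc k)
  have "\<beta> + unit_expo i + Poly_Mapping.single i k = \<beta> + Poly_Mapping.single i (Suc k)"
    by (rule poly_mapping_eqI) (simp add: lookup_add lookup_single when_def)
  then show ?case using Suc by (simp add: ncoeff_partial_deriv[OF assms])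
qed simp

lemma ncoeff_fold_partial_deriv:
  assumes "set xs \<subseteq> {1..n}"
  shows "ncoeff n (fold (\<lambda>i. partial_deriv i ^^ Poly_Mapping.lookup \<alpha> i) xs f) \<beta>
       = ncoeff n f (\<beta> + (\<Sum>i\<leftarrow>xs. Poly_Mapping.single i (Poly_Mapping.lookup \<alpha> i)))"
  using assms
proof (induction xs arbitrary: f \<beta>)
  case (Cons x xs)
  then show ?case by (simp add: ncoeff_partial_deriv_power add_ac)
qed simp

lemma ncoeff_iter_deriv:
  assumes "Poly_Mapping.keys \<alpha> \<subseteq> {1..n}"
  shows "ncoeff n (iter_deriv n \<alpha> f) \<beta> = ncoeff n f (\<beta> + \<alpha>)"
proof -
  have "(\<Sum>i\<leftarrow>[1..<Suc n]. Poly_Mapping.single i (Poly_Mapping.lookup \<alpha> i))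
      = (\<Sum>i\<in>{1..<Suc n}. Poly_Mapping.single i (Poly_Mapping.lookup \<alpha> i))"
    by (simp only: interv_sum_list_conv_sum_set_nat set_upt)
  also have "\<dots> = \<alpha>"
  proof (rule poly_mapping_eqI)
    fix k
    have "Poly_Mapping.lookup (\<Sum>i\<in>{1..<Suc n}. Poly_Mapping.single i (Poly_Mapping.lookup \<alpha> i)) k
        = (\<Sum>i\<in>{1..<Suc n}. if i = k then Poly_Mapping.lookup \<alpha> k else 0)"
      unfolding lookup_sum by (intro sum.cong refl) (auto simp: lookup_single when_def)
    also have "\<dots> = Poly_Mapping.lookup \<alpha> k"
    proof (cases "k \<in> {1..<Suc n}")
      case False
      then have "k \<notin> Poly_Mapping.keys \<alpha>" using assms by auto
      then show ?thesis using False by (simp add: in_keys_iff)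
    qed simp
    finally show "Poly_Mapping.lookup (\<Sum>i\<in>{1..<Suc n}. Poly_Mapping.single i (Poly_Mapping.lookup \<alpha> i)) k
      = Poly_Mapping.lookup \<alpha> k" .
  qed
  finally show ?thesis unfolding iter_deriv_def by (subst ncoeff_fold_partial_deriv) auto
qed

lemma hessian_iter_deriv:
  assumes "Poly_Mapping.keys \<alpha> \<subseteq> {1..n}"
  shows "hessian n (iter_deriv n \<alpha> f)
       = mat n n (\<lambda>(i, j). ncoeff n f (\<alpha> + unit_expo (Suc i) + unit_expo (Suc j)))"
proof -
  have "Poly_Mapping.lookup (partial_deriv (Suc i) (partial_deriv (Suc j) (iter_deriv n \<alpha> f))) 0
      = ncoeff n f (\<alpha> + unit_expo (Suc i) + unit_expo (Suc j))" if "i < n" "j < n" for i j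
  proof -
    have r: "Suc i \<in> {1..n}" "Suc j \<in> {1..n}" using that by auto
    have "Poly_Mapping.lookup g 0 = ncoeff n g 0" for g by (simp add: ncoeff_def)
    then have "Poly_Mapping.lookup (partial_deriv (Suc i) (partial_deriv (Suc j) (iter_deriv n \<alpha> f))) 0
      = ncoeff n f (0 + unit_expo (Suc i) + unit_expo (Suc j) + \<alpha>)"
      by (simp only: ncoeff_partial_deriv[OF r(1)] ncoeff_partial_deriv[OF r(2)] ncoeff_iter_deriv[OF assms])
    then show ?thesis by (simp add: add_ac)
  qed
  then show ?thesis unfolding hessian_def by (intro cong_mat) auto
qed

section \<open>Approximation by strictly Lorentzian polynomials\<close>

lemma lorentz_form_pullback:
  assumes Q: "lorentz_form I Q" and a: "\<And>i p. i \<in> J \<Longrightarrow> p \<in> I \<Longrightarrow> 0 \<le> a i p"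
  shows "lorentz_form J (\<lambda>i j. bform I Q (a i) (a j))"
proof -
  have eq: "bform J (\<lambda>i j. bform I Q (a i) (a j)) u v
      = bform I Q (\<lambda>p. \<Sum>i\<in>J. u i * a i p) (\<lambda>p. \<Sum>i\<in>J. v i * a i p)" for u v
  proof -
    have "bform I Q (\<lambda>p. \<Sum>i\<in>J. u i * a i p) (\<lambda>p. \<Sum>i\<in>J. v i * a i p)
        = (\<Sum>p\<in>I. \<Sum>p'\<in>I. \<Sum>i\<in>J. \<Sum>j\<in>J. u i * v j * (a i p * a j p' * Q p p'))"
      unfolding bform_def
    proof (intro sum.cong refl)
      fix p p'
      show "(\<Sum>i\<in>J. u i * a i p) * (\<Sum>i\<in>J. v i * a i p') * Q p p'
          = (\<Sum>i\<in>J. \<Sum>j\<in>J. u i * v j * (a i p * a j p' * Q p p'))"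
        by (simp only: sum_product, simp only: sum_distrib_right, simp only: mult_ac)
    qed
    also have "\<dots> = (\<Sum>p\<in>I. \<Sum>i\<in>J. \<Sum>p'\<in>I. \<Sum>j\<in>J. u i * v j * (a i p * a j p' * Q p p'))"
      by (intro sum.cong refl sum.swap)
    also have "\<dots> = (\<Sum>i\<in>J. \<Sum>p\<in>I. \<Sum>p'\<in>I. \<Sum>j\<in>J. u i * v j * (a i p * a j p' * Q p p'))"
      by (rule sum.swap)
    also have "\<dots> = (\<Sum>i\<in>J. \<Sum>p\<in>I. \<Sum>j\<in>J. \<Sum>p'\<in>I. u i * v j * (a i p * a j p' * Q p p'))"
      by (intro sum.cong refl sum.swap)
    also have "\<dots> = (\<Sum>i\<in>J. \<Sum>j\<in>J. \<Sum>p\<in>I. \<Sum>p'\<in>I. u i * v j * (a i p * a j p' * Q p p'))"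
      by (intro sum.cong refl sum.swap)
    finally show ?thesis unfolding bform_def by (simp add: sum_distrib_left)
  qed
  show ?thesis unfolding lorentz_form_def eq
  proof (intro allI impI)
    fix u v :: "'b \<Rightarrow> real" assume "\<forall>i\<in>J. 0 \<le> u i"
    then have nn: "\<forall>p\<in>I. 0 \<le> (\<Sum>i\<in>J. u i * a i p)"
      using a by (auto intro!: sum_nonneg mult_nonneg_nonneg)
    show "bform I Q (\<lambda>p. \<Sum>i\<in>J. u i * a i p) (\<lambda>p. \<Sum>i\<in>J. u i * a i p)
        * bform I Q (\<lambda>p. \<Sum>i\<in>J. v i * a i p) (\<lambda>p. \<Sum>i\<in>J. v i * a i p)
        \<le> (bform I Q (\<lambda>p. \<Sum>i\<in>J. u i * a i p) (\<lambda>p. \<Sum>i\<in>J. v i * a i p))\<^sup>2"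
      by (rule Q[unfolded lorentz_form_def, THEN spec, THEN spec, THEN mp, OF nn])
  qed
qed

text \<open>
  The normalised coefficients, up to the factor \<open>d!\<close>, of the sum over \<open>m\<close> of the powers
  \<open>(x\<^sub>1 + \<dots> + x\<^sub>n + x\<^sub>m)\<^sup>d\<close>.  The linear forms in it are a basis, so every coordinate derivative of order \<open>d - 2\<close> is
  a positive definite quadratic form; subtracting a small multiple makes forms nondegenerate.
\<close>

definition positive_weight :: "nat \<Rightarrow> nat multiset \<Rightarrow> real" where
  "positive_weight n M = (\<Sum>m\<in>{1..n}. 2 ^ count M m)"

lemma positive_weight_form_pos:
  assumes v: "\<exists>i\<in>{1..n}. v i \<noteq> 0"
  shows "0 < bform {1..n} (\<lambda>i j. positive_weight n (add_mset i (add_mset j K))) v v"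
proof -
  let ?I = "{1..n}"
  define s where "s = (\<Sum>i\<in>?I. v i)"
  have fac: "(\<Sum>i\<in>?I. v i * (if i = m then 2 else 1)) = s + v m" if "m \<in> ?I" for m
  proof -
    have "(\<Sum>i\<in>?I. v i * (if i = m then 2 else 1)) = (\<Sum>i\<in>?I. v i + (if i = m then v i else 0))"
      by (intro sum.cong refl) auto
    then show ?thesis using that by (simp add: sum.distrib s_def)
  qed
  have "bform ?I (\<lambda>i j. positive_weight n (add_mset i (add_mset j K))) v v
      = (\<Sum>i\<in>?I. \<Sum>j\<in>?I. \<Sum>m\<in>?I. 2 ^ count K m * ((v i * (if i = m then 2 else 1)) * (v j * (if j = m then 2 else 1))))"
    unfolding bform_def positive_weight_def sum_distrib_left
    by (intro sum.cong refl) auto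
  also have "\<dots> = (\<Sum>i\<in>?I. \<Sum>m\<in>?I. \<Sum>j\<in>?I. 2 ^ count K m * ((v i * (if i = m then 2 else 1)) * (v j * (if j = m then 2 else 1))))"
    by (intro sum.cong refl sum.swap)
  also have "\<dots> = (\<Sum>m\<in>?I. \<Sum>i\<in>?I. \<Sum>j\<in>?I. 2 ^ count K m * ((v i * (if i = m then 2 else 1)) * (v j * (if j = m then 2 else 1))))"
    by (rule sum.swap)
  also have "\<dots> = (\<Sum>m\<in>?I. 2 ^ count K m * ((\<Sum>i\<in>?I. v i * (if i = m then 2 else 1)) * (\<Sum>j\<in>?I. v j * (if j = m then 2 else 1))))"
    by (simp only: sum_product) (simp only: sum_distrib_left)
  also have "\<dots> = (\<Sum>m\<in>?I. 2 ^ count K m * (s + v m)\<^sup>2)"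
    by (intro sum.cong refl) (simp only: fac power2_eq_square)
  finally have eq: "bform ?I (\<lambda>i j. positive_weight n (add_mset i (add_mset j K))) v v
      = (\<Sum>m\<in>?I. 2 ^ count K m * (s + v m)\<^sup>2)" .
  have "\<exists>m\<in>?I. s + v m \<noteq> 0"
  proof (rule ccontr)
    assume "\<not> ?thesis"
    then have vm: "v m = - s" if "m \<in> ?I" for m using that by (simp add: eq_neg_iff_add_eq_0 add.commute)
    have "(\<Sum>i\<in>?I. v i) = (\<Sum>m\<in>?I. - s)" by (rule sum.cong[OF refl]) (rule vm)
    then have "s = (\<Sum>m\<in>?I. - s)" by (simp only: s_def[symmetric])
    then have "s * (1 + real n) = 0" by (simp add: algebra_simps)
    then have "s = 0" by simp
    then show False using vm v by simp
  qed
  then obtain m where "m \<in> ?I" "s + v m \<noteq> 0" by blast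
  then show ?thesis unfolding eq by (intro sum_pos2[of _ m]) auto
qed

lemma small_multiple_below:
  fixes g h :: "'a \<Rightarrow> real"
  assumes "finite S" "0 < t" "\<And>b. b \<in> S \<Longrightarrow> 0 < g b" "\<And>b. b \<in> S \<Longrightarrow> 0 \<le> h b"
  shows "\<exists>\<epsilon>>0. \<epsilon> \<le> t \<and> (\<forall>b\<in>S. \<epsilon> * h b < g b)"
  using assms
proof (induction S rule: finite_induct)
  case empty
  then show ?case by blast
next
  case (insert b S)
  then obtain \<epsilon> where e: "0 < \<epsilon>" "\<epsilon> \<le> t" "\<forall>b\<in>S. \<epsilon> * h b < g b" by auto
  have gb: "0 < g b" and hb: "0 \<le> h b" using insert.prems by auto
  define \<epsilon>' where "\<epsilon>' = min \<epsilon> (g b / (h b + 1))"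
  have "0 < \<epsilon>'" using e gb hb by (simp add: \<epsilon>'_def)
  moreover have "\<epsilon>' \<le> t" using e by (simp add: \<epsilon>'_def)
  moreover have "\<epsilon>' * h x < g x" if "x \<in> insert b S" for x
  proof (cases "x = b")
    case True
    have "\<epsilon>' * h b \<le> g b / (h b + 1) * h b" using hb by (intro mult_right_mono) (auto simp: \<epsilon>'_def)
    also have "\<dots> < g b" using gb hb by (simp add: field_simps)
    finally show ?thesis using True by simp
  next
    case False
    then have x: "x \<in> S" using that by simp
    have "\<epsilon>' * h x \<le> \<epsilon> * h x" using insert.prems(3)[of x] x by (intro mult_right_mono) (auto simp: \<epsilon>'_def)
    then show ?thesis using e(3) x by force
  qed
  ultimately show ?case by blast
qed

lemma dir_derivs_unit:
  assumes "finite I" "set_mset K \<subseteq> I"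
  shows "dir_derivs I (\<lambda>x i. if i = x then 1 else 0) c K N = c (K + N)"
  using assms(2)
proof (induction K arbitrary: N)
  case (add x K)
  have "dir_derivs I (\<lambda>x i. if i = x then 1 else 0) c (add_mset x K) N
      = (\<Sum>i\<in>I. if i = x then c (K + add_mset x N) else 0)"
    unfolding dir_derivs_add dir_deriv_def by (intro sum.cong refl) (use add in auto)
  also have "\<dots> = c (K + add_mset x N)" using assms(1) add.prems by simp
  finally show ?case by simp
qed simp

lemma dir_derivs_tendsto:
  assumes "\<And>x i. (\<lambda>k. a k x i) \<longlonglongrightarrow> b x i"
  shows "(\<lambda>k. dir_derivs I (a k) c K N) \<longlonglongrightarrow> dir_derivs I b c K N"
proof (induction K arbitrary: N)
  case (add x K)
  then show ?case unfolding dir_derivs_add dir_deriv_def by (intro tendsto_sum tendsto_mult assms) auto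
qed simp

text \<open>The homogeneous polynomial with prescribed normalised coefficients.\<close>

definition simplex_poly :: "nat \<Rightarrow> nat \<Rightarrow> (nat multiset \<Rightarrow> real) \<Rightarrow> rpoly" where
  "simplex_poly n d g =
     (\<Sum>\<beta>\<in>simplex n d. Poly_Mapping.single \<beta> (g (mset_of \<beta>) / expo_fact n \<beta>))"

lemma lookup_simplex_poly:
  "Poly_Mapping.lookup (simplex_poly n d g) \<beta>
     = (if \<beta> \<in> simplex n d then g (mset_of \<beta>) / expo_fact n \<beta> else 0)"
proof -
  have "Poly_Mapping.lookup (simplex_poly n d g) \<beta>
      = (\<Sum>\<alpha>\<in>simplex n d. if \<alpha> = \<beta> then g (mset_of \<beta>) / expo_fact n \<beta> else 0)"
    unfolding simplex_poly_def lookup_sum by (intro sum.cong refl) (auto simp: lookup_single when_def)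
  then show ?thesis by simp
qed

lemma ncoeff_simplex_poly:
  assumes "\<beta> \<in> simplex n d" shows "ncoeff n (simplex_poly n d g) \<beta> = g (mset_of \<beta>)"
proof -
  have "expo_fact n \<beta> \<noteq> 0" using expo_fact_pos[of n \<beta>] by linarith
  then show ?thesis using assms by (simp add: ncoeff_def lookup_simplex_poly)
qed

lemma simplex_add_two:
  assumes "\<alpha> \<in> simplex n (d - 2)" "2 \<le> d" "i \<in> {1..n}" "j \<in> {1..n}"
  shows "\<alpha> + unit_expo i + unit_expo j \<in> simplex n d"
  using assms unfolding in_simplex_iff by auto

text \<open>
  On the hyperplane where the form \<open>G\<close> is nonpositive, the perturbed form is negative definite; its
  coefficients stay positive, so it is positive at the all-ones vector.
\<close>

lemma strictly_lorentzian_perturbation: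
  fixes G :: "nat multiset \<Rightarrow> real"
  assumes d: "2 \<le> d" and n: "1 \<le> n" and e: "0 < \<epsilon>"
    and less: "\<And>\<beta>. \<beta> \<in> simplex n d \<Longrightarrow> \<epsilon> * positive_weight n (mset_of \<beta>) < G (mset_of \<beta>)"
    and lor: "\<And>K. size K = d - 2 \<Longrightarrow> set_mset K \<subseteq> {1..n} \<Longrightarrow>
                lorentz_form {1..n} (\<lambda>i j. G (add_mset i (add_mset j K)))"
  shows "strictly_lorentzian n d (simplex_poly n d (\<lambda>M. G M - \<epsilon> * positive_weight n M))"
proof -
  let ?I = "{1..n}" and ?g = "\<lambda>M. G M - \<epsilon> * positive_weight n M"
  let ?F = "simplex_poly n d ?g"
  have hom: "homogeneous n d ?F"
    unfolding homogeneous_def by (auto simp: in_keys_iff lookup_simplex_poly split: if_splits)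
  have nonneg: "0 \<le> Poly_Mapping.lookup ?F \<beta>" for \<beta>
  proof (cases "\<beta> \<in> simplex n d")
    case True
    have "0 \<le> ?g (mset_of \<beta>) / expo_fact n \<beta>"
      using less[OF True] expo_fact_pos[of n \<beta>] by (intro divide_nonneg_pos) auto
    then show ?thesis using True by (simp add: lookup_simplex_poly)
  qed (simp add: lookup_simplex_poly)
  have "num_eigenvalues (hessian n (iter_deriv n \<alpha> ?F)) {0<..} = 1 \<and>
      num_eigenvalues (hessian n (iter_deriv n \<alpha> ?F)) {..<0} = n - 1" if \<alpha>: "\<alpha> \<in> simplex n (d - 2)" for \<alpha>
  proof -
    define K where "K = mset_of \<alpha>"
    have K: "size K = d - 2" "set_mset K \<subseteq> ?I" using \<alpha> unfolding in_simplex_iff K_def by auto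
    define Q where "Q i j = G (add_mset i (add_mset j K))" for i j
    define P where "P i j = positive_weight n (add_mset i (add_mset j K))" for i j
    define q where "q i j = ncoeff n ?F (\<alpha> + unit_expo i + unit_expo j)" for i j
    have ms: "mset_of (\<alpha> + unit_expo i + unit_expo j) = add_mset i (add_mset j K)" for i j
      by (simp add: K_def add_mset_commute)
    have q: "q i j = Q i j - \<epsilon> * P i j" if "i \<in> ?I" "j \<in> ?I" for i j
      unfolding q_def ncoeff_simplex_poly[OF simplex_add_two[OF \<alpha> d that]] ms Q_def P_def ..
    have qpos: "0 < q i j" if "i \<in> ?I" "j \<in> ?I" for i j
      using less[OF simplex_add_two[OF \<alpha> d that]] q[OF that] unfolding ms Q_def P_def by simp
    have P0: "0 \<le> P i j" for i j unfolding P_def positive_weight_def by (intro sum_nonneg) simp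
    have Qpos: "0 < Q i j" if "i \<in> ?I" "j \<in> ?I" for i j
      using qpos[OF that] q[OF that] mult_nonneg_nonneg[OF less_imp_le[OF e] P0[of i j]] by linarith
    have bq: "bform ?I q v v = bform ?I Q v v - \<epsilon> * bform ?I P v v" for v
    proof -
      have "bform ?I q v v = (\<Sum>i\<in>?I. \<Sum>j\<in>?I. v i * v j * Q i j - \<epsilon> * (v i * v j * P i j))"
        unfolding bform_def by (intro sum.cong refl) (simp only: q right_diff_distrib mult_ac)
      then show ?thesis by (simp only: sum_subtractf bform_def sum_distrib_left[symmetric])
    qed
    let ?one = "\<lambda>_::nat. 1::real"
    have ones: "0 < bform ?I R ?one ?one" if "\<And>i j. i \<in> ?I \<Longrightarrow> j \<in> ?I \<Longrightarrow> 0 < R i j" for R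
      unfolding bform_def using n that by (intro sum_pos) auto
    have onesQ: "0 < bform ?I Q ?one ?one" by (rule ones) (rule Qpos)
    have onesq: "0 < bform ?I q ?one ?one" by (rule ones) (rule qpos)
    have symq: "sym_on ?I q" unfolding sym_on_def q_def by (simp add: add_ac)
    have L: "linear_functional (bform ?I Q ?one)" by (rule linear_functional_bform)
    have neg: "bform ?I q v v < 0" if v: "bform ?I Q ?one v = 0" "\<exists>i\<in>?I. v i \<noteq> 0" for v
    proof -
      have "bform ?I Q ?one ?one * bform ?I Q v v \<le> (bform ?I Q ?one v)\<^sup>2"
        using lor[OF K] unfolding lorentz_form_def Q_def by simp
      then have "bform ?I Q v v \<le> 0" using v(1) onesQ by (simp add: mult_le_0_iff)
      moreover have "0 < bform ?I P v v" unfolding P_def by (rule positive_weight_form_pos[OF v(2)])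
      ultimately show ?thesis unfolding bq using e mult_pos_pos[of \<epsilon> "bform ?I P v v"] by linarith
    qed
    have keys: "Poly_Mapping.keys \<alpha> \<subseteq> ?I" using \<alpha> by (auto simp: simplex_def)
    have hess: "hessian n (iter_deriv n \<alpha> ?F) = mat n n (\<lambda>(i, j). q (Suc i) (Suc j))"
      unfolding hessian_iter_deriv[OF keys] q_def ..
    show ?thesis unfolding hess
      by (intro conjI signature_of_negative_hyperplane[OF symq L neg onesq])
  qed
  then show ?thesis using d hom nonneg unfolding strictly_lorentzian_def by blast
qed

text \<open>
  The criterion of Branden and Huh, in the direction needed here.  The approximating polynomials are
  \<open>f (A x) - \<epsilon> h\<close>, where \<open>A\<close> is the identity plus \<open>t > 0\<close> in all entries and \<open>h\<close> has normalised
  coefficients \<open>positive_weight n\<close>.  The normalised coefficients of \<open>f (A x)\<close> are mixed derivatives of \<open>f\<close> along the columns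
  of \<open>A\<close>, which are strictly positive.
\<close>

theorem lorentzian_criterion:
  assumes d: "2 \<le> d" and hom: "homogeneous n d f" and f0: "f \<noteq> 0"
    and nonneg: "\<And>\<beta>. 0 \<le> Poly_Mapping.lookup f \<beta>"
    and conv: "M_convex {N. Poly_Mapping.lookup f (expo_of N) \<noteq> 0}"
    and quad: "\<And>\<alpha>. \<alpha> \<in> simplex n (d - 2) \<Longrightarrow>
      lorentz_form {1..n} (\<lambda>i j. ncoeff n f (\<alpha> + unit_expo i + unit_expo j))"
  shows "lorentzian n d f"
proof -
  let ?I = "{1..n}"
  define c where "c N = ncoeff n f (expo_of N)" for N
  have fact_nz: "expo_fact n \<beta> \<noteq> 0" for \<beta> using expo_fact_pos[of n \<beta>] by linarith
  have c0: "0 \<le> c N" for N using nonneg by (simp add: c_def ncoeff_def less_imp_le)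
  have cnz: "c N \<noteq> 0 \<longleftrightarrow> Poly_Mapping.lookup f (expo_of N) \<noteq> 0" for N
    by (simp add: c_def ncoeff_def fact_nz)
  have csupp: "size N = d \<and> set_mset N \<subseteq> ?I" if "c N \<noteq> 0" for N
  proof -
    have "expo_of N \<in> Poly_Mapping.keys f" using that by (simp add: cnz in_keys_iff)
    then have "expo_of N \<in> simplex n d" using hom unfolding homogeneous_def by blast
    then show ?thesis by (simp only: expo_of_in_simplex)
  qed
  obtain \<beta>0 where "Poly_Mapping.lookup f \<beta>0 \<noteq> 0" 
  proof -
    have "Poly_Mapping.keys f \<noteq> {}" using f0 by simp
    then obtain \<beta> where "\<beta> \<in> Poly_Mapping.keys f" by blast
    then show thesis using that[of \<beta>] by (simp add: in_keys_iff)
  qed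
  then have c_nz0: "c (mset_of \<beta>0) \<noteq> 0" by (simp add: cnz)
  have n: "1 \<le> n"
  proof (rule ccontr)
    assume "\<not> 1 \<le> n"
    then have "mset_of \<beta>0 = {#}" using csupp[OF c_nz0] by auto
    then show False using csupp[OF c_nz0] d by simp
  qed
  define a :: "real \<Rightarrow> nat \<Rightarrow> nat \<Rightarrow> real" where "a t x i = t + (if i = x then 1 else 0)" for t x i
  define G where "G t M = dir_derivs ?I (a t) c M {#}" for t M
  have a_pos: "0 < a t x i" if "0 < t" for t x i using that by (simp add: a_def)
  have G_pos: "0 < G t (mset_of \<beta>)" if "0 < t" "\<beta> \<in> simplex n d" for t \<beta>
  proof -
    have "0 < c (mset_of \<beta>0 + {#})" using c0[of "mset_of \<beta>0"] c_nz0 by simp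
    moreover have "size (mset_of \<beta>0) = size (mset_of \<beta>)" using csupp[OF c_nz0] that(2)
      by (simp add: in_simplex_iff)
    ultimately have "\<exists>M. size M = size (mset_of \<beta>) \<and> set_mset M \<subseteq> ?I \<and> 0 < c (M + {#})"
      using csupp[OF c_nz0] by blast
    then show ?thesis unfolding G_def
      by (rule iffD2[OF dir_derivs_pos_iff[OF _ c0 a_pos[OF that(1)]], rotated]) simp
  qed
  have G_lor: "lorentz_form ?I (\<lambda>i j. G t (add_mset i (add_mset j K)))"
    if t: "0 < t" and K: "size K = d - 2" "set_mset K \<subseteq> ?I" for t K
  proof -
    have lq: "lorentz_form ?I (\<lambda>p q. dir_derivs ?I (a t) c K {#p, q#})"
    proof (rule dir_derivs_lorentzian[OF refl])
      show "0 < a t x i" for x i by (rule a_pos[OF t])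
      show "0 \<le> c N" for N by (rule c0)
      show "M_convex {N. c N \<noteq> 0}" using conv by (simp add: cnz)
      show "size N = size K + 2 \<and> set_mset N \<subseteq> ?I" if "c N \<noteq> 0" for N
        using csupp[OF that] K d by simp
      fix M assume M: "size M = size K" "set_mset M \<subseteq> ?I"
      then have "expo_of M \<in> simplex n (d - 2)" using K by simp
      then have "lorentz_form ?I (\<lambda>i j. ncoeff n f (expo_of M + unit_expo i + unit_expo j))" by (rule quad)
      then show "lorentz_form ?I (\<lambda>i j. c (add_mset i (add_mset j M)))"
        by (simp add: c_def add_ac)
    qed
    have eq: "G t (add_mset i (add_mset j K))
        = bform ?I (\<lambda>p q. dir_derivs ?I (a t) c K {#p, q#}) (a t i) (a t j)" for i j
      unfolding G_def dir_derivs_add dir_deriv_def bform_def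
      by (simp add: sum_distrib_left mult.assoc add_mset_commute)
    show ?thesis unfolding eq
      by (rule lorentz_form_pullback[OF lq]) (use a_pos[OF t] in \<open>auto intro: less_imp_le\<close>)
  qed
  define t where "t k = 1 / real (Suc k)" for k
  have tpos: "0 < t k" for k by (simp add: t_def)
  have tlim: "t \<longlonglongrightarrow> 0" unfolding t_def by (rule lim_1_over_n[THEN LIMSEQ_Suc])
  have "\<forall>k. \<exists>e>0. e \<le> t k \<and> (\<forall>\<beta>\<in>simplex n d. e * positive_weight n (mset_of \<beta>) < G (t k) (mset_of \<beta>))"
  proof
    fix k
    show "\<exists>e>0. e \<le> t k \<and> (\<forall>\<beta>\<in>simplex n d. e * positive_weight n (mset_of \<beta>) < G (t k) (mset_of \<beta>))"
    proof (rule small_multiple_below[OF finite_simplex tpos])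
      show "0 < G (t k) (mset_of \<beta>)" if "\<beta> \<in> simplex n d" for \<beta> by (rule G_pos[OF tpos that])
      show "0 \<le> positive_weight n (mset_of \<beta>)" for \<beta>
        unfolding positive_weight_def by (intro sum_nonneg) simp
    qed
  qed
  from choice[OF this] obtain \<epsilon> where eps: "\<forall>k. 0 < \<epsilon> k \<and> \<epsilon> k \<le> t k \<and>
      (\<forall>\<beta>\<in>simplex n d. \<epsilon> k * positive_weight n (mset_of \<beta>) < G (t k) (mset_of \<beta>))" ..
  have eps_k: "0 < \<epsilon> k" "\<epsilon> k \<le> t k" for k using eps by blast+
  have elim: "(\<lambda>k. \<epsilon> k) \<longlonglongrightarrow> 0"
    by (rule tendsto_sandwich[OF _ _ tendsto_const tlim]) (simp_all add: eps_k less_imp_le)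
  define F where "F k = simplex_poly n d (\<lambda>M. G (t k) M - \<epsilon> k * positive_weight n M)" for k
  have strict: "strictly_lorentzian n d (F k)" for k
    unfolding F_def
  proof (rule strictly_lorentzian_perturbation[OF d n eps_k(1)])
    show "\<epsilon> k * positive_weight n (mset_of \<beta>) < G (t k) (mset_of \<beta>)" if "\<beta> \<in> simplex n d" for \<beta>
      using eps that by blast
    show "lorentz_form ?I (\<lambda>i j. G (t k) (add_mset i (add_mset j K)))"
      if "size K = d - 2" "set_mset K \<subseteq> ?I" for K
      by (rule G_lor[OF tpos that])
  qed
  have lim: "(\<lambda>k. Poly_Mapping.lookup (F k) \<beta>) \<longlonglongrightarrow> Poly_Mapping.lookup f \<beta>" if b: "\<beta> \<in> simplex n d" for \<beta>
  proof -
    have mb: "set_mset (mset_of \<beta>) \<subseteq> ?I" using b by (simp add: in_simplex_iff)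
    have "(\<lambda>k. a (t k) x i) \<longlonglongrightarrow> 0 + (if i = x then 1 else 0)" for x i
      unfolding a_def by (intro tendsto_add tlim tendsto_const)
    then have "(\<lambda>k. a (t k) x i) \<longlonglongrightarrow> (if i = x then 1 else 0)" for x i
      by (simp only: add_0)
    from dir_derivs_tendsto[OF this]
    have "(\<lambda>k. G (t k) (mset_of \<beta>)) \<longlonglongrightarrow> dir_derivs ?I (\<lambda>x i. if i = x then 1 else 0) c (mset_of \<beta>) {#}"
      unfolding G_def .
    also have "dir_derivs ?I (\<lambda>x i. if i = x then 1 else 0) c (mset_of \<beta>) {#} = c (mset_of \<beta>)"
      using dir_derivs_unit[OF _ mb, of c "{#}"] by simp
    finally have "(\<lambda>k. (G (t k) (mset_of \<beta>) - \<epsilon> k * positive_weight n (mset_of \<beta>)) / expo_fact n \<beta>)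
        \<longlonglongrightarrow> (c (mset_of \<beta>) - 0 * positive_weight n (mset_of \<beta>)) / expo_fact n \<beta>"
      by (intro tendsto_divide tendsto_diff tendsto_mult elim tendsto_const fact_nz)
    moreover have "(c (mset_of \<beta>) - 0 * positive_weight n (mset_of \<beta>)) / expo_fact n \<beta> = Poly_Mapping.lookup f \<beta>"
      by (simp add: c_def ncoeff_def fact_nz)
    ultimately show ?thesis unfolding F_def lookup_simplex_poly using b by simp
  qed
  show ?thesis unfolding lorentzian_def using hom strict lim by blast
qed

section \<open>Lorentzian polynomials satisfy triangle relations\<close>

lemma lorentz_form_limit:
  assumes lim: "\<And>i j. i \<in> I \<Longrightarrow> j \<in> I \<Longrightarrow> (\<lambda>k. Q k i j) \<longlonglongrightarrow> q i j"
    and lor: "\<And>k. lorentz_form I (Q k)"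
  shows "lorentz_form I q"
  unfolding lorentz_form_def
proof (intro allI impI)
  fix u v :: "'a \<Rightarrow> real" assume u: "\<forall>i\<in>I. 0 \<le> u i"
  have b: "(\<lambda>k. bform I (Q k) x y) \<longlonglongrightarrow> bform I q x y" for x y
    unfolding bform_def by (intro tendsto_sum tendsto_mult tendsto_const lim)
  have le: "bform I (Q k) u u * bform I (Q k) v v \<le> (bform I (Q k) u v)\<^sup>2" for k
    using lor[of k] u unfolding lorentz_form_def by blast
  show "bform I q u u * bform I q v v \<le> (bform I q u v)\<^sup>2"
    by (rule LIMSEQ_le[OF tendsto_mult[OF b b] tendsto_power[OF b]]) (use le in blast)
qed

lemma strictly_lorentzian_form:
  assumes F: "strictly_lorentzian n d F" and \<alpha>: "\<alpha> \<in> simplex n (d - 2)"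
  shows "lorentz_form {1..n} (\<lambda>i j. ncoeff n F (\<alpha> + unit_expo i + unit_expo j))"
proof -
  define q where "q i j = ncoeff n F (\<alpha> + unit_expo i + unit_expo j)" for i j
  have sym: "sym_on {1..n} q" unfolding sym_on_def q_def by (simp add: add_ac)
  have nonneg: "0 \<le> q i j" for i j
    unfolding q_def ncoeff_def using F expo_fact_pos by (simp add: strictly_lorentzian_def less_imp_le)
  have keys: "Poly_Mapping.keys \<alpha> \<subseteq> {1..n}" using \<alpha> by (auto simp: simplex_def)
  have hess: "hessian n (iter_deriv n \<alpha> F) = mat n n (\<lambda>(i, j). q (Suc i) (Suc j))"
    unfolding hessian_iter_deriv[OF keys] q_def ..
  have "num_eigenvalues (mat n n (\<lambda>(i, j). q (Suc i) (Suc j))) {0<..} = 1"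
    using F \<alpha> unfolding strictly_lorentzian_def hess[symmetric] by blast
  from negative_hyperplane_of_signature[OF sym this]
  obtain L where "linear_functional L" "\<And>v. L v = 0 \<Longrightarrow> bform {1..n} q v v \<le> 0" by blast
  from lorentz_formI[OF sym this nonneg] show ?thesis unfolding q_def .
qed

lemma lorentzian_form:
  assumes f: "lorentzian n d f" and \<alpha>: "\<alpha> \<in> simplex n (d - 2)"
  shows "lorentz_form {1..n} (\<lambda>i j. ncoeff n f (\<alpha> + unit_expo i + unit_expo j))"
proof -
  obtain F where F: "\<And>k. strictly_lorentzian n d (F k)"
    and lim: "\<And>\<alpha>. \<alpha> \<in> simplex n d \<Longrightarrow> (\<lambda>k. Poly_Mapping.lookup (F k) \<alpha>) \<longlonglongrightarrow> Poly_Mapping.lookup f \<alpha>"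
    using f unfolding lorentzian_def by blast
  have d: "2 \<le> d" using F[of 0] by (simp add: strictly_lorentzian_def)
  show ?thesis
  proof (rule lorentz_form_limit)
    fix i j assume "i \<in> {1..n}" "j \<in> {1..n}"
    from lim[OF simplex_add_two[OF \<alpha> d this]]
    show "(\<lambda>k. ncoeff n (F k) (\<alpha> + unit_expo i + unit_expo j))
        \<longlonglongrightarrow> ncoeff n f (\<alpha> + unit_expo i + unit_expo j)"
      unfolding ncoeff_def by (intro tendsto_mult tendsto_const)
  next
    show "lorentz_form {1..n} (\<lambda>i j. ncoeff n (F k) (\<alpha> + unit_expo i + unit_expo j))" for k
      by (rule strictly_lorentzian_form[OF F \<alpha>])
  qed
qed

lemma lorentzian_nonneg:
  assumes "lorentzian n d f" shows "0 \<le> Poly_Mapping.lookup f \<beta>"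
proof (cases "\<beta> \<in> simplex n d")
  case True
  obtain F where F: "\<And>k. strictly_lorentzian n d (F k)"
    and lim: "(\<lambda>k. Poly_Mapping.lookup (F k) \<beta>) \<longlonglongrightarrow> Poly_Mapping.lookup f \<beta>"
    using assms True unfolding lorentzian_def by blast
  show ?thesis
    by (rule LIMSEQ_le_const[OF lim]) (use F in \<open>auto simp: strictly_lorentzian_def\<close>)
next
  case False
  then have "\<beta> \<notin> Poly_Mapping.keys f" using assms unfolding lorentzian_def homogeneous_def by blast
  then show ?thesis by (simp add: in_keys_iff)
qed

lemma bform_two_points:
  assumes I: "finite I" and ij: "i \<in> I" "j \<in> I" "i \<noteq> j" and kl: "k \<in> I" "l \<in> I" "k \<noteq> l"
  shows "bform I p (\<lambda>m. if m = i then s else if m = j then t else 0) (\<lambda>m. if m = k then x else if m = l then y else 0)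
       = s * x * p i k + s * y * p i l + t * x * p j k + t * y * p j l"
proof -
  have two: "(\<Sum>m\<in>I. (if m = i then s else if m = j then t else 0) * g m) = s * g i + t * g j"
    if "i \<in> I" "j \<in> I" "i \<noteq> j" for i j s t and g :: "'a \<Rightarrow> real"
  proof -
    have "(\<Sum>m\<in>I. (if m = i then s else if m = j then t else 0) * g m)
        = (\<Sum>m\<in>I. (if m = i then s * g i else 0) + (if m = j then t * g j else 0))"
      using that by (intro sum.cong refl) auto
    then show ?thesis using I that by (simp add: sum.distrib)
  qed
  have "bform I p (\<lambda>m. if m = i then s else if m = j then t else 0) (\<lambda>m. if m = k then x else if m = l then y else 0)
      = (\<Sum>m\<in>I. (if m = i then s else if m = j then t else 0) *
          (\<Sum>m'\<in>I. (if m' = k then x else if m' = l then y else 0) * p m m'))"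
    unfolding bform_def by (simp only: sum_distrib_left mult.assoc)
  also have "\<dots> = s * x * p i k + s * y * p i l + t * x * p j k + t * y * p j l"
    unfolding two[OF kl] two[OF ij] by (simp add: algebra_simps)
  finally show ?thesis .
qed

text \<open>
  The reversed Cauchy-Schwarz inequality for vectors supported on \<open>{i, j}\<close> and \<open>{k, l}\<close>, with weights
  that make the right-hand side as small as possible.
\<close>

lemma lorentz_form_four_point:
  assumes I: "finite I" and sym: "sym_on I p" and nonneg: "\<And>i j. i \<in> I \<Longrightarrow> j \<in> I \<Longrightarrow> 0 \<le> p i j"
    and lor: "lorentz_form I p"
    and ijkl: "i \<in> I" "j \<in> I" "k \<in> I" "l \<in> I" "i \<noteq> j" "k \<noteq> l"
    and diag: "p i i = 0" "p j j = 0" "p k k = 0" "p l l = 0"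
  shows "sqrt (p i j * p k l) \<le> sqrt (p i k * p j l) + sqrt (p i l * p j k)"
proof -
  have pji: "p j i = p i j" "p l k = p k l" using sym ijkl unfolding sym_on_def by blast+
  have quad: "4 * (s * t * x * y) * (p i j * p k l)
      \<le> (s * x * p i k + s * y * p i l + t * x * p j k + t * y * p j l)\<^sup>2" if "0 \<le> s" "0 \<le> t" for s t x y
  proof -
    let ?u = "\<lambda>m. if m = i then s else if m = j then t else 0"
    let ?w = "\<lambda>m. if m = k then x else if m = l then y else 0"
    have "bform I p ?u ?u * bform I p ?w ?w \<le> (bform I p ?u ?w)\<^sup>2"
      using lor that unfolding lorentz_form_def by simp
    then have "(2 * (s * t * p i j)) * (2 * (x * y * p k l))
        \<le> (s * x * p i k + s * y * p i l + t * x * p j k + t * y * p j l)\<^sup>2"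
      using ijkl by (simp add: bform_two_points[OF I] diag pji algebra_simps)
    then show ?thesis by (simp add: mult_ac)
  qed
  have bound: "sqrt (p i j * p k l) \<le> sqrt (p i k + e) * sqrt (p j l + e) + sqrt (p i l + e) * sqrt (p j k + e)"
    if e: "0 < e" for e
  proof -
    \<comment> \<open>The weights \<open>b d\<close>, \<open>a c\<close> and \<open>b c\<close>, \<open>a d\<close> balance the four terms in pairs; \<open>e > 0\<close> keeps them positive
      when some coefficient vanishes.\<close>
    define a b c d where "a = sqrt (p i k + e)" and "b = sqrt (p j l + e)"
      and "c = sqrt (p i l + e)" and "d = sqrt (p j k + e)"
    have pos: "0 < a" "0 < b" "0 < c" "0 < d"
      unfolding a_def b_def c_def d_def using nonneg ijkl e by (simp_all add: add_nonneg_pos)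
    have sq: "p i k \<le> a\<^sup>2" "p j l \<le> b\<^sup>2" "p i l \<le> c\<^sup>2" "p j k \<le> d\<^sup>2"
      unfolding a_def b_def c_def d_def using nonneg ijkl e by (simp_all add: add_nonneg_nonneg)
    have "4 * ((b * d) * (a * c) * (b * c) * (a * d)) * (p i j * p k l)
        \<le> ((b * d) * (b * c) * p i k + (b * d) * (a * d) * p i l + (a * c) * (b * c) * p j k + (a * c) * (a * d) * p j l)\<^sup>2"
      using pos by (intro quad) auto
    also have "\<dots> \<le> ((b * d) * (b * c) * a\<^sup>2 + (b * d) * (a * d) * c\<^sup>2 + (a * c) * (b * c) * d\<^sup>2 + (a * c) * (a * d) * b\<^sup>2)\<^sup>2"
      using pos sq nonneg ijkl by (intro power_mono add_mono mult_left_mono add_nonneg_nonneg mult_nonneg_nonneg) auto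
    also have "\<dots> = 4 * ((b * d) * (a * c) * (b * c) * (a * d)) * (a * b + c * d)\<^sup>2"
      by (simp add: power2_eq_square algebra_simps)
    finally have "p i j * p k l \<le> (a * b + c * d)\<^sup>2"
      using pos by (simp add: mult_le_cancel_left)
    then have "sqrt (p i j * p k l) \<le> a * b + c * d"
      using pos by (intro real_le_lsqrt) auto
    then show ?thesis by (simp add: a_def b_def c_def d_def)
  qed
  have "((\<lambda>e. sqrt (p i k + e) * sqrt (p j l + e) + sqrt (p i l + e) * sqrt (p j k + e))
      \<longlongrightarrow> sqrt (p i k + 0) * sqrt (p j l + 0) + sqrt (p i l + 0) * sqrt (p j k + 0)) (at_right 0)"
    by (intro tendsto_intros)
  then have "sqrt (p i j * p k l) \<le> sqrt (p i k + 0) * sqrt (p j l + 0) + sqrt (p i l + 0) * sqrt (p j k + 0)"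
    by (rule tendsto_lowerbound) (auto simp: eventually_at_right_less bound intro: eventually_mono[OF eventually_at_right_less[of 0]])
  then show ?thesis by (simp add: real_sqrt_mult)
qed

lemma T_relation_2:
  assumes "0 \<le> x" "0 \<le> y" "0 \<le> z"
  shows "T_relation 2 x y z \<longleftrightarrow> sqrt x \<le> sqrt y + sqrt z \<and> sqrt y \<le> sqrt x + sqrt z \<and> sqrt z \<le> sqrt x + sqrt y"
  using assms by (simp add: T_relation_def powr_half_sqrt)

lemma T_relation_eq: "T_relation q x x 0" "T_relation q x 0 x" "T_relation q 0 x x"
  by (simp_all add: T_relation_def)

lemma T_relation_perm:
  "T_relation q x y z \<Longrightarrow> T_relation q y x z" "T_relation q x y z \<Longrightarrow> T_relation q x z y"
  by (simp_all add: T_relation_def add.commute)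

text \<open>The three products are permuted when the indices are, and the relation is trivial for repeated indices.\<close>

lemma T_relation_of_sorted:
  fixes p :: "'a :: linorder \<Rightarrow> 'a \<Rightarrow> real"
  assumes sym: "\<And>i j. p i j = p j i" and diag: "\<And>i. i \<in> I \<Longrightarrow> p i i = 0"
    and sorted: "\<And>i j k l. i \<in> I \<Longrightarrow> j \<in> I \<Longrightarrow> k \<in> I \<Longrightarrow> l \<in> I \<Longrightarrow> i < j \<Longrightarrow> j < k \<Longrightarrow> k < l \<Longrightarrow>
           T_relation q (p j k * p i l) (p i k * p j l) (p i j * p k l)"
    and ijkl: "i \<in> I" "j \<in> I" "k \<in> I" "l \<in> I"
  shows "T_relation q (p j k * p i l) (p i k * p j l) (p i j * p k l)"
proof -
  define P where "P i j k l \<longleftrightarrow> T_relation q (p j k * p i l) (p i k * p j l) (p i j * p k l)" for i j k l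
  have s12: "P j i k l" if "P i j k l" for i j k l
    using T_relation_perm(1)[OF that[unfolded P_def]] unfolding P_def by (simp only: sym[of j i])
  have s23: "P i k j l" if "P i j k l" for i j k l
    using T_relation_perm(2)[OF that[unfolded P_def]] unfolding P_def by (simp only: sym[of k j])
  have s34: "P i j l k" if "P i j k l" for i j k l
    using T_relation_perm(1)[OF that[unfolded P_def]] unfolding P_def by (simp only: sym[of l k] mult.commute)
  have A: "P i j k l" if "i \<in> I" "j \<in> I" "k \<in> I" "l \<in> I" "i < j" "j < k" "l \<noteq> i" "l \<noteq> j" "l \<noteq> k" for i j k l
  proof -
    \<comment> \<open>Only \<open>i < j < k\<close> is assumed in this step; the position of \<open>l\<close> is found by adjacent transpositions.\<close>
    consider "k < l" | "j < l" "l < k" | "i < l" "l < j" | "l < i" using \<open>l \<noteq> i\<close> \<open>l \<noteq> j\<close> \<open>l \<noteq> k\<close> by force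
    then show ?thesis
    proof cases
      case 1
      then show ?thesis unfolding P_def using that by (intro sorted)
    next
      case 2
      then have "P i j l k" unfolding P_def using that by (intro sorted)
      then show ?thesis by (rule s34)
    next
      case 3
      then have "P i l j k" unfolding P_def using that by (intro sorted)
      then show ?thesis by (rule s34[OF s23])
    next
      case 4
      then have "P l i j k" unfolding P_def using that by (intro sorted)
      then show ?thesis by (rule s34[OF s23[OF s12]])
    qed
  qed
  have B: "P i j k l" if "i \<in> I" "j \<in> I" "k \<in> I" "l \<in> I" "i < j" "k \<noteq> i" "k \<noteq> j" "l \<noteq> i" "l \<noteq> j" "l \<noteq> k" for i j k l
  proof -
    consider "j < k" | "i < k" "k < j" | "k < i" using \<open>k \<noteq> i\<close> \<open>k \<noteq> j\<close> by force
    then show ?thesis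
    proof cases
      case 1
      then show ?thesis using that by (intro A) auto
    next
      case 2
      then have "P i k j l" using that by (intro A) auto
      then show ?thesis by (rule s23)
    next
      case 3
      then have "P k i j l" using that by (intro A) auto
      then show ?thesis by (rule s23[OF s12])
    qed
  qed
  have C: "P i j k l" if "i \<noteq> j" "i \<noteq> k" "i \<noteq> l" "j \<noteq> k" "j \<noteq> l" "k \<noteq> l"
  proof (cases "i < j")
    case True
    then show ?thesis using that ijkl by (intro B) auto
  next
    case False
    then have "P j i k l" using that ijkl by (intro B) auto
    then show ?thesis by (rule s12)
  qed
  show ?thesis
  proof (cases "i = j \<or> i = k \<or> i = l \<or> j = k \<or> j = l \<or> k = l")
    case True
    then show ?thesis using ijkl diag T_relation_eq by (auto simp: sym mult.commute)
  next
    case False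
    then show ?thesis using C unfolding P_def by blast
  qed
qed

section \<open>Matroids\<close>

lemma basis_expos_eq: "basis_expos \<B> = (\<lambda>B. expo_of (mset_set B)) ` \<B>"
  unfolding basis_expos_def expo_of_def sum_unfold_sum_mset ..

lemma matroid_basesD:
  assumes "matroid_bases E \<B>"
  shows matroid_bases_nonempty: "\<B> \<noteq> {}"
    and matroid_bases_subset: "B \<in> \<B> \<Longrightarrow> B \<subseteq> E"
    and matroid_bases_exchange:
      "A \<in> \<B> \<Longrightarrow> B \<in> \<B> \<Longrightarrow> x \<in> A - B \<Longrightarrow> \<exists>y\<in>B - A. insert y (A - {x}) \<in> \<B>"
proof -
  note M = assms[unfolded matroid_bases_def, THEN conjunct2]
  show "\<B> \<noteq> {}" by (rule M[THEN conjunct1])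
  show "B \<subseteq> E" if "B \<in> \<B>" by (rule M[THEN conjunct2, THEN conjunct1, THEN bspec, OF that])
  show "\<exists>y\<in>B - A. insert y (A - {x}) \<in> \<B>" if "A \<in> \<B>" "B \<in> \<B>" "x \<in> A - B"
    by (rule M[THEN conjunct2, THEN conjunct2, THEN bspec, OF that(1), THEN bspec, OF that(2),
          THEN bspec, OF that(3)])
qed

lemma matroid_bases_finite:
  fixes n :: nat
  assumes "matroid_bases {1..n} \<B>"
  shows "finite \<B>" and "B \<in> \<B> \<Longrightarrow> finite B"
proof -
  have "\<B> \<subseteq> Pow {1..n}" using matroid_bases_subset[OF assms] by blast
  then show "finite \<B>" by (rule finite_subset) simp
  show "finite B" if "B \<in> \<B>" by (rule finite_subset[OF matroid_bases_subset[OF assms that]]) simp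
qed

lemma basis_expos_finite:
  assumes "matroid_bases {1..n} \<B>" shows "finite (basis_expos \<B>)"
  unfolding basis_expos_eq using matroid_bases_finite(1)[OF assms] by simp

lemma basis_expos_simplex:
  assumes M: "matroid_bases {1..n} \<B>" and "has_rank \<B> d"
  shows "basis_expos \<B> \<subseteq> simplex n d"
proof
  fix \<beta> assume "\<beta> \<in> basis_expos \<B>"
  then obtain B where B: "B \<in> \<B>" "\<beta> = expo_of (mset_set B)" unfolding basis_expos_eq by blast
  have "B \<subseteq> {1..n}" by (rule matroid_bases_subset[OF M B(1)])
  moreover have "card B = d" using assms(2) B(1) unfolding has_rank_def by blast
  ultimately show "\<beta> \<in> simplex n d" using matroid_bases_finite(2)[OF M B(1)] B(2) by simp
qed

lemma basis_expos_le_1: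
  assumes M: "matroid_bases {1..n} \<B>" and "\<beta> \<in> basis_expos \<B>"
  shows "Poly_Mapping.lookup \<beta> i \<le> 1"
proof -
  obtain B where "B \<in> \<B>" "\<beta> = expo_of (mset_set B)" using assms(2) unfolding basis_expos_eq by blast
  then show ?thesis using matroid_bases_finite(2)[OF M] by (simp add: count_mset_set')
qed

lemma basis_expos_M_convex:
  assumes M: "matroid_bases {1..n} \<B>"
  shows "M_convex {N. expo_of N \<in> basis_expos \<B>}"
proof -
  have inj: "N = N'" if "expo_of N = expo_of N'" for N N' using that by (metis mset_of_expo_of)
  have mem: "expo_of N \<in> basis_expos \<B> \<longleftrightarrow> (\<exists>B\<in>\<B>. N = mset_set B)" for N
    unfolding basis_expos_eq using inj by auto
  show ?thesis unfolding M_convex_def mem mem_Collect_eq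
  proof (intro ballI allI impI)
    fix N N' x assume "N \<in> {N. \<exists>B\<in>\<B>. N = mset_set B}" "N' \<in> {N. \<exists>B\<in>\<B>. N = mset_set B}"
      and less: "count N' x < count N x"
    then obtain A B where A: "A \<in> \<B>" "N = mset_set A" and B: "B \<in> \<B>" "N' = mset_set B" by blast
    have fin: "finite A" "finite B" using matroid_bases_finite(2)[OF M] A B by auto
    have "x \<in> A - B" using less fin unfolding A(2) B(2) by (simp add: count_mset_set' split: if_splits)
    then obtain y where y: "y \<in> B - A" "insert y (A - {x}) \<in> \<B>"
      using matroid_bases_exchange[OF M A(1) B(1)] by blast
    have "count N y < count N' y" using y(1) fin unfolding A(2) B(2) by (simp add: count_mset_set')
    moreover have "add_mset y (N - {#x#}) = mset_set (insert y (A - {x}))"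
      using y(1) fin \<open>x \<in> A - B\<close> unfolding A(2)
      by (subst mset_set.insert) (auto simp: mset_set_Diff)
    ultimately show "\<exists>y. count N y < count N' y \<and> (\<exists>B\<in>\<B>. add_mset y (N - {#x#}) = mset_set B)"
      using y(2) by blast
  qed
qed

lemma ncoeff_multiaffine:
  assumes "\<And>\<beta> i. \<beta> \<in> Poly_Mapping.keys f \<Longrightarrow> Poly_Mapping.lookup \<beta> i \<le> 1"
  shows "ncoeff n f \<beta> = Poly_Mapping.lookup f \<beta>"
proof (cases "\<beta> \<in> Poly_Mapping.keys f")
  case True
  have "fact (Poly_Mapping.lookup \<beta> i) = (1::real)" for i
  proof -
    consider "Poly_Mapping.lookup \<beta> i = 0" | "Poly_Mapping.lookup \<beta> i = 1"
      using assms[OF True, of i] by linarith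
    then show ?thesis by cases (simp_all only: fact_0 fact_1)
  qed
  then have "expo_fact n \<beta> = 1" unfolding expo_fact_def by (intro prod.neutral ballI)
  then show ?thesis by (simp only: ncoeff_def mult_1_left)
next
  case False
  then show ?thesis by (simp add: ncoeff_def in_keys_iff)
qed

lemma lookup_rep_poly:
  assumes "finite J" "{\<alpha>. \<rho> \<alpha> \<noteq> 0} = J"
  shows "Poly_Mapping.lookup (rep_poly J \<rho>) \<beta> = \<rho> \<beta>"
proof -
  have "Poly_Mapping.lookup (rep_poly J \<rho>) \<beta> = (\<Sum>\<alpha>\<in>J. if \<alpha> = \<beta> then \<rho> \<beta> else 0)"
    unfolding rep_poly_def lookup_sum by (intro sum.cong refl) (auto simp: lookup_single when_def)
  then show ?thesis using assms by auto
qed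

lemma delta_bounds:
  assumes "finite J" "\<beta> \<in> J"
  shows "delta_min J m \<le> Poly_Mapping.lookup \<beta> m" "Poly_Mapping.lookup \<beta> m \<le> delta_max J m"
  unfolding delta_min_def delta_max_def using assms by auto

lemma lookup_add_unit:
  "Poly_Mapping.lookup (\<alpha> + unit_expo i) m = Poly_Mapping.lookup \<alpha> m + (if i = m then 1 else 0)"
  by (simp add: lookup_add lookup_single when_def)

lemma weak_repD:
  assumes "weak_rep n d J q \<rho>"
  shows weak_rep_nonneg: "0 \<le> \<rho> \<alpha>" and weak_rep_support: "{\<alpha>. \<rho> \<alpha> \<noteq> 0} = J"
  using assms[unfolded weak_rep_def, THEN conjunct1, THEN spec, of \<alpha>]
    assms[unfolded weak_rep_def, THEN conjunct2, THEN conjunct1] .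

text \<open>
  The relations hold without the bounds \<open>delta_min\<close> and \<open>delta_max\<close> and for unsorted indices: for distinct
  indices that violate the bounds, all three products vanish.
\<close>

lemma weak_rep_T_relation:
  assumes J: "finite J" "\<And>\<beta> i. \<beta> \<in> J \<Longrightarrow> Poly_Mapping.lookup \<beta> i \<le> 1"
    and \<rho>: "weak_rep n d J q \<rho>" and \<alpha>: "\<alpha> \<in> simplex n (d - 2)"
    and ijkl: "i \<in> {1..n}" "j \<in> {1..n}" "k \<in> {1..n}" "l \<in> {1..n}"
  defines "p \<equiv> \<lambda>i j. \<rho> (\<alpha> + unit_expo i + unit_expo j)"
  shows "T_relation q (p j k * p i l) (p i k * p j l) (p i j * p k l)"
proof (rule T_relation_of_sorted[of p "{1..n}"])
  have supp: "\<rho> \<beta> \<noteq> 0 \<longleftrightarrow> \<beta> \<in> J" for \<beta>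
    using weak_rep_support[OF \<rho>] by blast
  have pJ: "p i j \<noteq> 0 \<longleftrightarrow> \<alpha> + unit_expo i + unit_expo j \<in> J" for i j unfolding p_def by (rule supp)
  have look2: "Poly_Mapping.lookup (\<alpha> + unit_expo i + unit_expo j) m
      = Poly_Mapping.lookup \<alpha> m + (if i = m then 1 else 0) + (if j = m then 1 else 0)" for i j m
    by (simp only: lookup_add_unit)
  show "p i j = p j i" for i j unfolding p_def by (simp add: add_ac)
  show "p i i = 0" for i
  proof (rule ccontr)
    assume "p i i \<noteq> 0"
    then have "Poly_Mapping.lookup (\<alpha> + unit_expo i + unit_expo i) i \<le> 1" using J(2) pJ by blast
    then show False unfolding look2 by simp
  qed
  show "i \<in> {1..n}" "j \<in> {1..n}" "k \<in> {1..n}" "l \<in> {1..n}" by (fact ijkl)+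
  fix i j k l assume I: "i \<in> {1..n}" "j \<in> {1..n}" "k \<in> {1..n}" "l \<in> {1..n}"
    and less: "i < j" "j < k" "k < l"
  show "T_relation q (p j k * p i l) (p i k * p j l) (p i j * p k l)"
  proof (cases "(\<forall>m\<in>{1..n}. delta_min J m \<le> Poly_Mapping.lookup \<alpha> m) \<and>
        (\<forall>m\<in>{1..n}. Poly_Mapping.lookup (\<alpha> + unit_expo i + unit_expo j + unit_expo k + unit_expo l) m \<le> delta_max J m)")
    case True
    have "1 \<le> i \<and> i \<le> j \<and> j \<le> k \<and> k \<le> l \<and> l \<le> n" using I less by auto
    then show ?thesis unfolding p_def using True
      by (intro \<rho>[unfolded weak_rep_def, THEN conjunct2, THEN conjunct2, THEN bspec, OF \<alpha>,
            THEN spec, THEN spec, THEN spec, THEN spec, THEN mp]) blast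
  next
    case False
    have zero: "p a b * p c e = 0" if abce: "{a,b,c,e} = {i,j,k,l}" "distinct [a,b,c,e]" for a b c e
    proof (rule ccontr)
      assume "p a b * p c e \<noteq> 0"
      then have ab: "\<alpha> + unit_expo a + unit_expo b \<in> J" and ce: "\<alpha> + unit_expo c + unit_expo e \<in> J"
        using pJ by auto
      have min: "delta_min J m \<le> Poly_Mapping.lookup \<alpha> m" for m
      proof (rule ccontr)
        assume "\<not> ?thesis"
        then have "m \<in> {a,b}" "m \<in> {c,e}"
          using delta_bounds(1)[OF J(1) ab, of m] delta_bounds(1)[OF J(1) ce, of m]
          unfolding look2 by (auto split: if_splits)
        then show False using abce(2) by auto
      qed
      have max: "Poly_Mapping.lookup (\<alpha> + unit_expo i + unit_expo j + unit_expo k + unit_expo l) m \<le> delta_max J m" for m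
      proof -
        have "Poly_Mapping.lookup (\<alpha> + unit_expo i + unit_expo j + unit_expo k + unit_expo l) m
          = Poly_Mapping.lookup \<alpha> m + (if m \<in> {i,j,k,l} then 1 else 0)"
          unfolding lookup_add_unit using less by auto
        also have "\<dots> = Poly_Mapping.lookup \<alpha> m + (if m \<in> {a,b,c,e} then 1 else 0)"
          by (simp only: abce(1))
        also have "\<dots> \<le> delta_max J m"
          using delta_bounds(2)[OF J(1) ab, of m] delta_bounds(2)[OF J(1) ce, of m]
          unfolding look2 by (auto split: if_splits)
        finally show ?thesis .
      qed
      show False using False min max by blast
    qed
    have "p j k * p i l = 0" "p i k * p j l = 0" "p i j * p k l = 0"
      by (rule zero; use less in auto)+
    then show ?thesis by (simp only: T_relation_eq)
  qed
qed

theorem weak_rep_space_subset_lorentzian_space: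
  fixes q :: real
  assumes M: "matroid_bases {1..n} \<B>" "has_rank \<B> d" and d: "2 \<le> d"
    and q: "0 < q" "2 * q * n * 2 ^ n \<le> 1"
  shows "weak_rep_space n d \<B> q \<subseteq> lorentzian_space n d \<B>"
proof
  let ?J = "basis_expos \<B>" and ?I = "{1..n}"
  have J: "finite ?J" "\<And>\<beta> i. \<beta> \<in> ?J \<Longrightarrow> Poly_Mapping.lookup \<beta> i \<le> 1"
    using basis_expos_finite[OF M(1)] basis_expos_le_1[OF M(1)] by auto
  fix f assume "f \<in> weak_rep_space n d \<B> q"
  then obtain \<rho> where f: "f = rep_poly ?J \<rho>" and \<rho>: "weak_rep n d ?J q \<rho>"
    unfolding weak_rep_space_def by blast
  note supp = weak_rep_support[OF \<rho>] and \<rho>0 = weak_rep_nonneg[OF \<rho>]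
  have look: "Poly_Mapping.lookup f \<beta> = \<rho> \<beta>" for \<beta> unfolding f by (rule lookup_rep_poly[OF J(1) supp])
  have keys: "Poly_Mapping.keys f = ?J"
    unfolding supp[symmetric] by (rule Set.set_eqI) (simp only: in_keys_iff look mem_Collect_eq)
  have nc: "ncoeff n f \<beta> = \<rho> \<beta>" for \<beta>
    by (rule ncoeff_multiaffine[of f n \<beta>, unfolded look]) (rule J(2), simp only: keys)
  have "lorentzian n d f"
  proof (rule lorentzian_criterion[OF d])
    show "homogeneous n d f"
      unfolding homogeneous_def keys by (rule basis_expos_simplex[OF M])
    have "?J \<noteq> {}" using matroid_bases_nonempty[OF M(1)] unfolding basis_expos_def by simp
    then show "f \<noteq> 0" using keys by auto
    show "0 \<le> Poly_Mapping.lookup f \<beta>" for \<beta> unfolding look by (rule \<rho>0)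
    show "M_convex {N. Poly_Mapping.lookup f (expo_of N) \<noteq> 0}"
      unfolding in_keys_iff[symmetric] keys by (rule basis_expos_M_convex[OF M(1)])
    fix \<alpha> assume \<alpha>: "\<alpha> \<in> simplex n (d - 2)"
    define p where "p i j = \<rho> (\<alpha> + unit_expo i + unit_expo j)" for i j
    have "lorentz_form ?I p"
    proof (rule triangular_form_lorentzian[OF _ q(1)])
      show "finite ?I" by simp
      show "2 * q * real (card ?I) * 2 ^ card ?I \<le> 1" using q(2) by simp
      show "sym_on ?I p" unfolding sym_on_def p_def by (simp add: add_ac)
      show "0 \<le> p i j" for i j unfolding p_def by (rule \<rho>0)
      show "p i i = 0" for i
      proof (rule ccontr)
        assume "p i i \<noteq> 0"
        then have "\<alpha> + unit_expo i + unit_expo i \<in> ?J" using supp by (simp only: p_def set_eq_iff mem_Collect_eq)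
        from J(2)[OF this, of i] show False unfolding lookup_add_unit by simp
      qed
      show "T_relation q (p j k * p i l) (p i k * p j l) (p i j * p k l)"
        if "i \<in> ?I" "j \<in> ?I" "k \<in> ?I" "l \<in> ?I" for i j k l
        unfolding p_def by (rule weak_rep_T_relation[OF J \<rho> \<alpha> that])
    qed
    then show "lorentz_form ?I (\<lambda>i j. ncoeff n f (\<alpha> + unit_expo i + unit_expo j))"
      unfolding nc p_def .
  qed
  then show "f \<in> lorentzian_space n d \<B>" unfolding lorentzian_space_def using keys by blast
qed

theorem lorentzian_space_subset_weak_rep_space:
  assumes M: "matroid_bases {1..n} \<B>" "has_rank \<B> d"
  shows "lorentzian_space n d \<B> \<subseteq> weak_rep_space n d \<B> 2"
proof
  let ?J = "basis_expos \<B>" and ?I = "{1..n}"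
  have J: "finite ?J" "\<And>\<beta> i. \<beta> \<in> ?J \<Longrightarrow> Poly_Mapping.lookup \<beta> i \<le> 1"
    using basis_expos_finite[OF M(1)] basis_expos_le_1[OF M(1)] by auto
  have Jne: "?J \<noteq> {}" using matroid_bases_nonempty[OF M(1)] unfolding basis_expos_def by simp
  fix f assume "f \<in> lorentzian_space n d \<B>"
  then have f: "lorentzian n d f" and keys: "Poly_Mapping.keys f = ?J"
    unfolding lorentzian_space_def by auto
  define \<rho> where "\<rho> = Poly_Mapping.lookup f"
  have supp: "{\<alpha>. \<rho> \<alpha> \<noteq> 0} = ?J" unfolding \<rho>_def keys[symmetric] by (auto simp: in_keys_iff)
  have \<rho>0: "0 \<le> \<rho> \<alpha>" for \<alpha> unfolding \<rho>_def by (rule lorentzian_nonneg[OF f])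
  have nc: "ncoeff n f \<beta> = \<rho> \<beta>" for \<beta>
    unfolding \<rho>_def by (rule ncoeff_multiaffine) (rule J(2), simp only: keys)
  have dmax: "delta_max ?J m \<le> 1" for m
    unfolding delta_max_def using J Jne by (subst Max_le_iff) auto
  have "weak_rep n d ?J 2 \<rho>"
    unfolding weak_rep_def
  proof (intro conjI allI ballI impI supp \<rho>0)
    fix \<alpha> i j k l
    assume \<alpha>: "\<alpha> \<in> simplex n (d - 2)"
      and H: "1 \<le> i \<and> i \<le> j \<and> j \<le> k \<and> k \<le> l \<and> l \<le> n \<and>
        (\<forall>m\<in>{1..n}. delta_min ?J m \<le> Poly_Mapping.lookup \<alpha> m) \<and>
        (\<forall>m\<in>{1..n}. Poly_Mapping.lookup (\<alpha> + unit_expo i + unit_expo j + unit_expo k + unit_expo l) m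
           \<le> delta_max ?J m)"
    have I: "i \<in> ?I" "j \<in> ?I" "k \<in> ?I" "l \<in> ?I" using H by auto
    define p where "p i j = \<rho> (\<alpha> + unit_expo i + unit_expo j)" for i j
    have le1: "Poly_Mapping.lookup \<alpha> m + (if i = m then 1 else 0) + (if j = m then 1 else 0)
        + (if k = m then 1 else 0) + (if l = m then 1 else 0) \<le> 1" if "m \<in> ?I" for m
    proof -
      have "Poly_Mapping.lookup (\<alpha> + unit_expo i + unit_expo j + unit_expo k + unit_expo l) m \<le> delta_max ?J m"
        using H that by blast
      then show ?thesis using dmax[of m] unfolding lookup_add_unit by linarith
    qed
    have "i \<noteq> j" "i \<noteq> k" "i \<noteq> l" by (rule notI, use le1[OF I(1)] in simp)+
    moreover have "j \<noteq> k" "j \<noteq> l" by (rule notI, use le1[OF I(2)] in simp)+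
    moreover have "k \<noteq> l" by (rule notI, use le1[OF I(3)] in simp)
    ultimately have dist: "i \<noteq> j" "i \<noteq> k" "i \<noteq> l" "j \<noteq> k" "j \<noteq> l" "k \<noteq> l" by blast+
    have lor: "lorentz_form ?I p"
      using lorentzian_form[OF f \<alpha>] unfolding nc p_def .
    have sym: "sym_on ?I p" unfolding sym_on_def p_def by (simp add: add_ac)
    have psym: "p i j = p j i" for i j unfolding p_def by (simp add: add_ac)
    have p0: "0 \<le> p i j" for i j unfolding p_def by (rule \<rho>0)
    have diag: "p m m = 0" for m
    proof (rule ccontr)
      assume "p m m \<noteq> 0"
      then have "\<alpha> + unit_expo m + unit_expo m \<in> ?J" using supp by (simp only: p_def set_eq_iff mem_Collect_eq)
      from J(2)[OF this, of m] show False unfolding lookup_add_unit by simp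
    qed
    have four: "sqrt (p a b * p c e) \<le> sqrt (p a c * p b e) + sqrt (p a e * p b c)"
      if "a \<in> ?I" "b \<in> ?I" "c \<in> ?I" "e \<in> ?I" "a \<noteq> b" "c \<noteq> e" for a b c e
      by (rule lorentz_form_four_point[OF _ sym p0 lor that]) (simp_all add: diag)
    have "T_relation 2 (p j k * p i l) (p i k * p j l) (p i j * p k l)"
      unfolding T_relation_2[OF mult_nonneg_nonneg[OF p0 p0] mult_nonneg_nonneg[OF p0 p0] mult_nonneg_nonneg[OF p0 p0]]
      using four[OF I(2,3,1,4) dist(4,3)] four[OF I(1,3,2,4) dist(2,5)] four[OF I(1,2,3,4) dist(1,6)]
      by (simp add: psym[of j i] psym[of k i] psym[of k j] mult.commute add.commute)
    then show "T_relation 2 (\<rho> (\<alpha> + unit_expo j + unit_expo k) * \<rho> (\<alpha> + unit_expo i + unit_expo l))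
        (\<rho> (\<alpha> + unit_expo i + unit_expo k) * \<rho> (\<alpha> + unit_expo j + unit_expo l))
        (\<rho> (\<alpha> + unit_expo i + unit_expo j) * \<rho> (\<alpha> + unit_expo k + unit_expo l))"
      unfolding p_def .
  qed
  moreover have "f = rep_poly ?J \<rho>"
    by (rule poly_mapping_eqI) (simp only: lookup_rep_poly[OF J(1) supp], simp only: \<rho>_def)
  ultimately show "f \<in> weak_rep_space n d \<B> 2" unfolding weak_rep_space_def by blast
qed

lemma quotient_mono: "A \<subseteq> B \<Longrightarrow> A // r \<subseteq> B // r"
  unfolding quotient_def by blast

theorem theorem5p6:
  fixes n d :: nat and \<B> :: "nat set set"
  assumes "matroid_bases {1..n} \<B>"
    and "has_rank \<B> d"
    and "2 \<le> d"
  shows "(\<exists>q\<^sub>M>0. \<forall>q::real. 0 < q \<and> q \<le> q\<^sub>M \<longrightarrow>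
            weak_rep_space n d \<B> q \<subseteq> lorentzian_space n d \<B> \<and>
            lorentzian_space n d \<B> \<subseteq> weak_rep_space n d \<B> 2) \<and>
         (\<exists>q\<^sub>M>0. \<forall>q::real. 0 < q \<and> q \<le> q\<^sub>M \<longrightarrow>
            weak_grassmannian n d \<B> q \<subseteq> proj_lorentzian_space n d \<B> \<and>
            proj_lorentzian_space n d \<B> \<subseteq> weak_grassmannian n d \<B> 2)"
proof -
  \<comment> \<open>The factor \<open>n + 1\<close> instead of \<open>n\<close> makes positivity evident.\<close>
  define qM :: real where "qM = 1 / (2 * real (n + 1) * 2 ^ n)"
  have pos: "0 < 2 * real (n + 1) * 2 ^ n" by (intro mult_pos_pos) auto
  then have qM: "0 < qM" unfolding qM_def by (simp only: zero_less_divide_1_iff)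
  have small: "2 * q * n * 2 ^ n \<le> 1" if "0 < q" "q \<le> qM" for q :: real
  proof -
    have "2 * q * n * 2 ^ n \<le> q * (2 * real (n + 1) * 2 ^ n)" using that by (simp add: algebra_simps)
    also have "\<dots> \<le> qM * (2 * real (n + 1) * 2 ^ n)" using that by (intro mult_right_mono) auto
    also have "\<dots> = 1" unfolding qM_def using pos by simp
    finally show ?thesis .
  qed
  have main: "weak_rep_space n d \<B> q \<subseteq> lorentzian_space n d \<B> \<and>
      lorentzian_space n d \<B> \<subseteq> weak_rep_space n d \<B> 2" if "0 < q \<and> q \<le> qM" for q
    using weak_rep_space_subset_lorentzian_space[OF assms _ small] that
      lorentzian_space_subset_weak_rep_space[OF assms(1,2)] by simp
  show ?thesis
    unfolding weak_grassmannian_def proj_lorentzian_space_def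
    by (intro conjI exI[of _ qM] allI impI qM quotient_mono) (use main in simp_all)
qed

end
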